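(* Let $r\ge1$ and let $\lambda,\mu\in\Lambda'(r)$. With $\psi\colon W\to\operatorname{End}_{\mathscr H}(\bigoplus_{\nu\in\Lambda'(r)}M^\nu)$ the superalgebra isomorphism and $\theta_T\in\mathsf a_\mu W\mathsf a_\lambda$ the webs attached to supertabloids $T$, as defined in the context, the set $\{\psi(\theta_T)\mid T\in\mathscr T_*(\lambda,\mu)\}$ forms a basis of $\operatorname{Hom}_{\mathscr H}(M^\lambda,M^\mu)$.
   Context: All vector spaces are over $\mathbb C$. A superspace is a $\mathbb Z/2$-graded vector space; $|v|$ denotes parity; homomorphisms of superalgebras are parity-preserving. Fix $r\ge1$. **Web superalgebra.** $\mathsf A(r)$ is the set of tuples $\mathsf a=(\mathsf a_1,\dots,\mathsf a_m)$, $m\ge1$, of positive integers with sum $r$. Local symbols, for $k,l>0$: merges $m_{k,l}\colon(k,l)\to(k+l)$ and splits $s_{k,l}\colon(k+l)\to(k,l)$, which are even, and dots $d_k\colon(k)\to(k)$, which are odd. For (possibly empty) tuples $x,y$ of positive integers and a symbol $g\colon u\to v$, $1_x\otimes g\otimes 1_y\colon(x,u,y)\to(x,v,y)$ denotes $g$ with identity strands $x$ to its left and $y$ to its right (tuples are concatenated). If $f$ is a linear combination of composites of such, $1_x\otimes f\otimes1_y$ means adding these strands to every factor. A product $fg$ means "$f$ on top of (after) $g$". For $f\colon u\to v$, $g\colon u'\to v'$, $f\otimes g:=(f\otimes1_{v'})(1_u\otimes g)$. Parity is the number of dots mod 2. $W=W(r)$ is the associative superalgebra generated by the even elements $\mathsf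 a\in\mathsf A(r)$ (identities, also written $1_{\mathsf a}$) and all $1_x\otimes g\otimes1_y$ ($g$ a symbol) whose source and target lie in $\mathsf A(r)$, subject to: the $\mathsf a$ are pairwise orthogonal idempotents; a generator $w$ with source $\mathsf a$ and target $\mathsf b$ satisfies $w=\mathsf b w\mathsf a$ (so non-composable products vanish); the superinterchange law $(1_x\otimes1_v\otimes1_y\otimes g\otimes1_z)(1_x\otimes f\otimes1_y\otimes1_{u'}\otimes1_z)=(-1)^{|f||g|}(1_x\otimes f\otimes1_y\otimes1_{v'}\otimes1_z)(1_x\otimes1_u\otimes1_y\otimes g\otimes1_z)$ for symbols $f\colon u\to v$, $g\colon u'\to v'$; and the local relations below. A local relation is understood to hold after applying $1_x\otimes(-)\otimes1_y$ for all $x,y$ for which the source lies in $\mathsf A(r)$. Conventions: strands labelled $0$ are erased, so $m_{0,k}=m_{k,0}=s_{0,k}=s_{k,0}=1_k$; $d_0=0$; any expression containing a strand with negative label is $0$. Ladders: $E^{(j)}_{k,l}=(m_{k,j}\otimes1_{l-j})(1_k\otimes s_{j,l-j})\colon(k,l)\to(k+j,l-j)$ and $F^{(j)}_{k,l}=(1_{k-j}\otimes m_{j,l})(s_{k-j,j}\otimes1_l)\colon(k,l)\to(k-j,l+j)$; $E=E^{(1)}$, $F=F^{(1)}$; with a dot on the rung, $\bar E_{k,l}=(m_{k,1}\otimes1_{l-1})(1_k\otimes d_1\otimes1_{l-1})(1_k\otimes s_{1,l-1})$ and $\bar F_{k,l}=(1_{k-1}\otimes m_{1,l})(1_{k-1}\otimes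 d_1\otimes1_l)(s_{k-1,1}\otimes1_l)$. Subscripts $k,l$ are suppressed when determined by the source. On three strands $(h,k,l)$, $G_1$ (resp. $G_2$) is the ladder $G$ applied to the first two (resp. last two) strands. Local relations ($h,k,l>0$): - $m_{h+k,l}(m_{h,k}\otimes1_l)=m_{h,k+l}(1_h\otimes m_{k,l})$ and $(1_h\otimes s_{k,l})s_{h,k+l}=(s_{h,k}\otimes1_l)s_{h+k,l}$; - $m_{k,l}s_{k,l}=\binom{k+l}{l}1_{k+l}$; - $d_kd_k=k\,1_k$; - $d_{1+k}m_{1,k}=m_{1,k}(d_1\otimes1_k)+m_{1,k}(1_1\otimes d_k)$, $s_{1,k}d_{1+k}=(d_1\otimes1_k)s_{1,k}+(1_1\otimes d_k)s_{1,k}$, and their mirror images $d_{k+1}m_{k,1}=m_{k,1}(d_k\otimes1_1)+m_{k,1}(1_k\otimes d_1)$, $s_{k,1}d_{k+1}=(d_k\otimes1_1)s_{k,1}+(1_k\otimes d_1)s_{k,1}$; - $s_{1,1}m_{1,1}-(d_1\otimes d_1)s_{1,1}m_{1,1}(d_1\otimes d_1)=2\cdot1_{(1,1)}$; - on $(k,l)$: $EF-FE=(k-l)1_{(k,l)}$; - on $(k,l)$: $\bar EF-F\bar E=d_k\otimes1_l-1_k\otimes d_l=E\bar F-\bar FE$; - on $(h,k,l)$: $E_1E_2-E_2E_1=\bar E_1\bar E_2+\bar E_2\bar E_1$ and $F_2F_1-F_1F_2=\bar F_2\bar F_1+\bar F_1\bar F_2$; - on $(h,k,l)$: $E_1\bar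 E_2-\bar E_2E_1=\bar E_1E_2-E_2\bar E_1$ and $F_1\bar F_2-\bar F_2F_1=\bar F_1F_2-F_2\bar F_1$. **Sergeev superalgebra.** $\mathscr H=\mathscr H_c(r)$ is the associative unital superalgebra generated by even $s_1,\dots,s_{r-1}$ and odd $c_1,\dots,c_r$ subject to $c_i^2=1$, $c_ic_j=-c_jc_i$ ($i\ne j$), $s_i^2=1$, $s_is_{i+1}s_i=s_{i+1}s_is_{i+1}$, $s_is_j=s_js_i$ ($|i-j|>1$), $c_is_i=s_ic_{i+1}$, $c_{i+1}s_i=s_ic_i$, and $c_j$ commutes with $s_i$ for $j\neq i,i+1$. The symmetric group algebra $\mathbb C\mathfrak S_r$ is the subalgebra generated by the $s_i=(i\ \,i+1)$ (permutations composed right to left). **Permutation supermodules and operators.** $\Lambda(r)$ is the set of $\lambda=(\lambda_1,\dots,\lambda_r)$ of nonnegative integers with sum $r$; $\Lambda'(r)\subset\Lambda(r)$ is the subset of those whose only zeros are trailing. For $\mathsf a\in\mathsf A(r)$ of length $m$, $\widehat{\mathsf a}\in\Lambda'(r)$ is $\mathsf a$ followed by $r-m$ zeros; for $\lambda\in\Lambda'(r)$, $\mathsf a_\lambda\in\mathsf A(r)$ is the tuple of nonzero entries of $\lambda$, and $l(\lambda)$ is its length. $V=\mathbb C^{r|r}$ has homogeneous basis $v_1,\dots,v_r$ (even), $v_{\bar1},\dots,v_{\bar r}$ (odd); bars cancel in pairs; $|i|$ is the parity of $v_i$; $\underline i$ is the unbarred version of $i$. $M^\lambda\subseteq V^{\otimes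 r}$ is the span of the monomials $v_{i_1}\otimes\cdots\otimes v_{i_r}$ having exactly $\lambda_k$ tensor factors with $\underline{i_j}=k$ for each $k$. With the odd map $P(v_i)=(-1)^{|i|}\sqrt{-1}\,v_{\bar i}$, $\mathscr H$ acts on $V^{\otimes r}$ and on each $M^\lambda$ by $s_i.(u_1\otimes\cdots\otimes u_r)=(-1)^{|u_i||u_{i+1}|}u_1\otimes\cdots\otimes u_{i+1}\otimes u_i\otimes\cdots\otimes u_r$ and $c_j.(u_1\otimes\cdots\otimes u_r)=(-1)^{|u_1|+\cdots+|u_{j-1}|}u_1\otimes\cdots\otimes P(u_j)\otimes\cdots\otimes u_r$. Operators on $V^{\otimes r}$: $1_\lambda$ is the projection onto $M^\lambda$; $e_i,f_i$ (even, $1\le i\le r-1$) and $h_{\bar j}$ (odd, $1\le j\le r$) are given on $V$ for $k\in\{1,\dots,r,\bar1,\dots,\bar r\}$ by: $e_i$ sends $v_k$ to $0$ unless $\underline k=i+1$, in which case it lowers the index by one keeping the bar (or lack of bar); $f_i$ sends $v_k$ to $0$ unless $\underline k=i$, in which case it raises the index by one keeping the bar (or lack of bar); $h_{\bar j}v_k=\delta_{j,\underline k}v_{\bar k}$. They act on $V^{\otimes r}$ by $x(v_{i_1}\otimes\cdots\otimes v_{i_r})=\sum_{t}(-1)^{|x|(|i_1|+\cdots+|i_{t-1}|)}v_{i_1}\otimes\cdots\otimes x v_{i_t}\otimes\cdots\otimes v_{i_r}$. Divided powers: $e_i^{(p)}=e_i^p/p!$, $f_i^{(p)}=f_i^p/p!$.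 $\operatorname{Hom}_{\mathscr H}$ consists of sums of homogeneous maps $f$ with $f(hv)=(-1)^{|f||h|}hf(v)$. **The isomorphism $\psi$.** It is known (another theorem of the paper) that there is an isomorphism of superalgebras $\psi\colon W\to\operatorname{End}_{\mathscr H}(\bigoplus_{\nu\in\Lambda'(r)}M^\nu)$ given, for $\mathsf a=(\mathsf a_1,\dots,\mathsf a_m)\in\mathsf A(r)$ and $\mathsf b=(\mathsf a_1,\dots,\mathsf a_i+\mathsf a_{i+1},\dots,\mathsf a_m)$, by: $\mathsf a\mapsto1_{\widehat{\mathsf a}}$; the merge $\mathsf a\to\mathsf b$ of strands $i,i+1$ maps to $e_{r-1}^{(\widehat{\mathsf a}_r)}\cdots e_{i+1}^{(\widehat{\mathsf a}_{i+2})}e_i^{(\widehat{\mathsf a}_{i+1})}1_{\widehat{\mathsf a}}$; the split $\mathsf b\to\mathsf a$ of strand $i$ maps to $f_i^{(\widehat{\mathsf a}_{i+1})}f_{i+1}^{(\widehat{\mathsf a}_{i+2})}\cdots f_{r-1}^{(\widehat{\mathsf a}_r)}1_{\widehat{\mathsf b}}$; the dot on strand $j$ of $\mathsf a$ maps to $h_{\bar j}1_{\widehat{\mathsf a}}$. It restricts to isomorphisms $\mathsf bW\mathsf a\to\operatorname{Hom}_{\mathscr H}(M^{\widehat{\mathsf a}},M^{\widehat{\mathsf b}})$ for all $\mathsf a,\mathsf b\in\mathsf A(r)$. **Sergeev diagrams.** Let $\mathsf a_\omega=(1,\dots,1)\in\mathsf A(r)$. The crossing is $X=s_{1,1}m_{1,1}-1_{(1,1)}\colon(1,1)\to(1,1)$.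 There is a superalgebra isomorphism $\xi\colon\mathscr H\to\mathsf a_\omega W\mathsf a_\omega$ sending $s_i$ to the crossing of the $i$-th and $(i+1)$-st strands and $c_j$ to the dot on the $j$-th strand; elements of $\mathscr H$ are identified with their images. **Supertabloids.** $D=\{1'<1<2'<2<3'<3<\cdots\}$, $D_r=\{1',1,\dots,r',r\}$; elements $k'$ are called primed. For $\lambda,\mu\in\Lambda'(r)$, a $\lambda$-supertabloid of type $\mu$ is an arrangement $T$ of $r$ elements of $D_r$ (repetitions allowed) into rows, considered up to permutations within rows, with $\lambda_i$ entries in row $i$ and exactly $\mu_j$ entries in $\{j,j'\}$ for each $j$. $\mathscr T(\lambda,\mu)$ is the set of these, and $\mathscr T_*(\lambda,\mu)$ is the set of $T\in\mathscr T(\lambda,\mu)$ such that for $1\le i\le l(\lambda)$, $1\le j\le l(\mu)$ the element $j'$ occurs at most once in row $i$. **The webs $w_T,\theta_T$.** For $T\in\mathscr T(\lambda,\mu)$ write each row in increasing order of $D$ and read all entries left to right, from the first row down, giving $t_1,\dots,t_r$; let $t_p\in\{k(p),k(p)'\}$. Let $\sigma_T\in\mathfrak S_r$, $\sigma_T(p)=\mu_1+\cdots+\mu_{k(p)-1}+\#\{q\le p: k(q)=k(p)\}$, and let $a_{\sigma_T(p)}=1$ if $t_p$ is primed and $0$ otherwise. Then $w_T=c_1^{a_1}\cdots c_r^{a_r}\sigma_T\in\mathsf a_\omega W\mathsf a_\omega$. Let $S_1=M_1=1_1$, $S_k=(1_1\otimes S_{k-1})s_{1,k-1}\colon(k)\to(1,\dots,1)$,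 $M_k=m_{1,k-1}(1_1\otimes M_{k-1})\colon(1,\dots,1)\to(k)$, the complete split and complete merge. Then $\theta_T=(M_{\mu_1}\otimes\cdots\otimes M_{\mu_{l(\mu)}})\,w_T\,(S_{\lambda_1}\otimes\cdots\otimes S_{\lambda_{l(\lambda)}})\in\mathsf a_\mu W\mathsf a_\lambda$. *)

theory Defs
  imports
    Complex_Main
    "HOL-Algebra.QuotRing"
    "HOL-Algebra.Module"
    "HOL-Library.Poly_Mapping"
    "HOL-Library.Function_Algebras"
    "HOL-Library.Multiset"
    "HOL-Combinatorics.Transposition"
begin

section \<open>Free superalgebras and presentations\<close>

text \<open>Words form a monoid (written additively, as required by \<^type>\<open>poly_mapping\<close>), so that finitely
  supported functions from words to the complex numbers are the free associative unital algebra.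
  The same type serves as the tensor algebra of a vector space with a given basis.\<close>

datatype 'g word = Word (letters: "'g list")

instantiation word :: (type) monoid_add
begin
definition zero_word :: "'a word" where "zero_word = Word []"
definition plus_word :: "'a word \<Rightarrow> 'a word \<Rightarrow> 'a word"
  where "plus_word v w = Word (letters v @ letters w)"
instance by standard (simp_all add: zero_word_def plus_word_def)
end

type_synonym 'g fa = "'g word \<Rightarrow>\<^sub>0 complex"

definition mono :: "'g list \<Rightarrow> 'g fa"
  where "mono w = Poly_Mapping.single (Word w) 1"

definition fscale :: "complex \<Rightarrow> 'g fa \<Rightarrow> 'g fa"
  where "fscale c x = Poly_Mapping.single 0 c * x"

global_interpretation fvs: vector_space fscale
  defines fspan = "fvs.span"
  by unfold_locales
    (simp_all add: fscale_def distrib_left distrib_right single_add mult_single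
      flip: mult.assoc)

definition lin_ext :: "('g list \<Rightarrow> 'h fa) \<Rightarrow> 'g fa \<Rightarrow> 'h fa"
  where "lin_ext b x = (\<Sum>w\<in>Poly_Mapping.keys x. fscale (Poly_Mapping.lookup x w) (b (letters w)))"

text \<open>Parities are truth values, \<^const>\<open>True\<close> meaning odd; the sum of two parities is \<open>p \<noteq> q\<close>.\<close>

definition list_parity :: "('g \<Rightarrow> bool) \<Rightarrow> 'g list \<Rightarrow> bool"
  where "list_parity par w = odd (length (filter par w))"

definition homog :: "('g \<Rightarrow> bool) \<Rightarrow> bool \<Rightarrow> 'g fa set"
  where "homog par p = {x. \<forall>w\<in>Poly_Mapping.keys x. list_parity par (letters w) = p}"

definition ksign :: "bool \<Rightarrow> complex"
  where "ksign b = (if b then - 1 else 1)"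

record 'a superalgebra = "(complex, 'a) module" +
  hom_part :: "bool \<Rightarrow> 'a set"

definition superalg_iso ::
    "('a, 'm) superalgebra_scheme \<Rightarrow> ('b, 'n) superalgebra_scheme \<Rightarrow> ('a \<Rightarrow> 'b) set"
  where "superalg_iso A B = {\<phi> \<in> ring_iso A B.
     (\<forall>c. \<forall>x\<in>carrier A. \<phi> (c \<odot>\<^bsub>A\<^esub> x) = c \<odot>\<^bsub>B\<^esub> \<phi> x) \<and>
     (\<forall>p. \<phi> ` hom_part A p \<subseteq> hom_part B p)}"

definition free_superalg :: "'g set \<Rightarrow> ('g \<Rightarrow> bool) \<Rightarrow> 'g fa superalgebra"
  where "free_superalg G par =
    \<lparr>carrier = {x. \<forall>w\<in>Poly_Mapping.keys x. set (letters w) \<subseteq> G},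
     monoid.mult = (*), one = 1, zero = 0, add = (+), smult = fscale,
     hom_part = (\<lambda>p. {x \<in> homog par p. \<forall>w\<in>Poly_Mapping.keys x. set (letters w) \<subseteq> G})\<rparr>"

text \<open>\<^const>\<open>genideal\<close> is an intersection of ideals, which is only meaningful over a ring.\<close>

lemma ring_free_superalg: "ring (free_superalg G par)"
proof (rule ringI)
  show "abelian_group (free_superalg G par)"
  proof (rule abelian_groupI)
    fix x y assume "x \<in> carrier (free_superalg G par)" "y \<in> carrier (free_superalg G par)"
    then show "x \<oplus>\<^bsub>free_superalg G par\<^esub> y \<in> carrier (free_superalg G par)"
      using keys_add[of x y] by (auto simp: free_superalg_def)
  next
    fix x assume "x \<in> carrier (free_superalg G par)"
    then show "\<exists>y\<in>carrier (free_superalg G par).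
        y \<oplus>\<^bsub>free_superalg G par\<^esub> x = \<zero>\<^bsub>free_superalg G par\<^esub>"
      by (intro bexI[of _ "- x"]) (auto simp: free_superalg_def)
  qed (auto simp: free_superalg_def add.assoc add.commute)
next
  show "Group.monoid (free_superalg G par)"
  proof (rule monoidI)
    fix x y assume *: "x \<in> carrier (free_superalg G par)" "y \<in> carrier (free_superalg G par)"
    have "set (letters w) \<subseteq> G" if "w \<in> Poly_Mapping.keys (x * y)" for w
    proof -
      from that keys_mult[of x y] obtain u v where
        "u \<in> Poly_Mapping.keys x" "v \<in> Poly_Mapping.keys y" "w = u + v" by blast
      with * show ?thesis by (fastforce simp: free_superalg_def plus_word_def)
    qed
    then show "x \<otimes>\<^bsub>free_superalg G par\<^esub> y \<in> carrier (free_superalg G par)"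
      by (auto simp: free_superalg_def)
  qed (auto simp: free_superalg_def mult.assoc zero_word_def)
qed (auto simp: free_superalg_def distrib_left distrib_right)

definition rel_ideal :: "'g set \<Rightarrow> ('g \<Rightarrow> bool) \<Rightarrow> 'g fa set \<Rightarrow> 'g fa set"
  where "rel_ideal G par R = Idl\<^bsub>free_superalg G par\<^esub> R"

text \<open>The class of \<open>x\<close> in the algebra with generators \<open>G\<close> and relators \<open>R\<close>.\<close>

definition pres_class :: "'g set \<Rightarrow> ('g \<Rightarrow> bool) \<Rightarrow> 'g fa set \<Rightarrow> 'g fa \<Rightarrow> 'g fa set"
  where "pres_class G par R x = rel_ideal G par R +>\<^bsub>free_superalg G par\<^esub> x"

definition presented :: "'g set \<Rightarrow> ('g \<Rightarrow> bool) \<Rightarrow> 'g fa set \<Rightarrow> 'g fa set superalgebra"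
  where "presented G par R =
    (let F = free_superalg G par; Q = F Quot rel_ideal G par R in
     \<lparr>carrier = carrier Q, monoid.mult = monoid.mult Q, one = one Q, zero = zero Q, add = add Q,
      smult = (\<lambda>c X. \<Union>x\<in>X. pres_class G par R (c \<odot>\<^bsub>F\<^esub> x)),
      hom_part = (\<lambda>p. pres_class G par R ` hom_part F p)\<rparr>)"

text \<open>Generators and relations without unit: the classes of elements without constant term. If no
  relator has a constant term, this is the non-unital free algebra modulo the ideal
  generated by \<open>R\<close>. The unit is an element \<open>e\<close> which is neutral modulo the relators.\<close>

definition presented_nonunital ::
    "'g set \<Rightarrow> ('g \<Rightarrow> bool) \<Rightarrow> 'g fa set \<Rightarrow> 'g fa \<Rightarrow> 'g fa set superalgebra"
  where "presented_nonunital G par R e = (presented G par R)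
    \<lparr>carrier := pres_class G par R `
        {x \<in> carrier (free_superalg G par). Poly_Mapping.lookup x 0 = 0},
     one := pres_class G par R e,
     hom_part := (\<lambda>p. pres_class G par R `
        {x \<in> hom_part (free_superalg G par) p. Poly_Mapping.lookup x 0 = 0})\<rparr>"

definition corner :: "('a, 'm) superalgebra_scheme \<Rightarrow> 'a \<Rightarrow> ('a, 'm) superalgebra_scheme"
  where "corner A e = A
    \<lparr>carrier := (\<lambda>x. e \<otimes>\<^bsub>A\<^esub> x \<otimes>\<^bsub>A\<^esub> e) ` carrier A,
     one := e,
     hom_part := (\<lambda>p. (\<lambda>x. e \<otimes>\<^bsub>A\<^esub> x \<otimes>\<^bsub>A\<^esub> e) ` hom_part A p)\<rparr>"


section \<open>Compositions\<close>

definition Acomp :: "nat \<Rightarrow> nat list set"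
  where "Acomp r = {a. a \<noteq> [] \<and> (\<forall>k\<in>set a. 0 < k) \<and> sum_list a = r}"

text \<open>\<open>\<lambda>\<^sub>i\<close> is \<open>\<lambda> ! (i - 1)\<close>.\<close>

definition Lam :: "nat \<Rightarrow> nat list set"
  where "Lam r = {lam. length lam = r \<and> sum_list lam = r}"

definition Lam' :: "nat \<Rightarrow> nat list set"
  where "Lam' r = {lam \<in> Lam r. \<forall>i j. i < j \<and> j < r \<and> lam ! i = 0 \<longrightarrow> lam ! j = 0}"

definition hat :: "nat \<Rightarrow> nat list \<Rightarrow> nat list"
  where "hat r a = a @ replicate (r - length a) 0"

definition erase :: "nat list \<Rightarrow> nat list"
  where "erase u = filter (\<lambda>k. 0 < k) u"

abbreviation comp_of :: "nat list \<Rightarrow> nat list"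
  where "comp_of lam \<equiv> erase lam"

definition len :: "nat list \<Rightarrow> nat"
  where "len lam = length (comp_of lam)"


section \<open>The web superalgebra\<close>

datatype symb = Merge nat nat | Split nat nat | Dot nat

fun sym_src :: "symb \<Rightarrow> nat list" where
  "sym_src (Merge k l) = [k, l]"
| "sym_src (Split k l) = [k + l]"
| "sym_src (Dot k) = [k]"

fun sym_tgt :: "symb \<Rightarrow> nat list" where
  "sym_tgt (Merge k l) = [k + l]"
| "sym_tgt (Split k l) = [k, l]"
| "sym_tgt (Dot k) = [k]"

fun sym_ok :: "symb \<Rightarrow> bool" where
  "sym_ok (Merge k l) = (0 < k \<and> 0 < l)"
| "sym_ok (Split k l) = (0 < k \<and> 0 < l)"
| "sym_ok (Dot k) = (0 < k)"

fun sym_odd :: "symb \<Rightarrow> bool" where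
  "sym_odd (Dot k) = True"
| "sym_odd _ = False"

text \<open>\<open>Gen x g y\<close> is \<open>1\<^sub>x \<otimes> g \<otimes> 1\<^sub>y\<close>.\<close>

datatype wgen = Idn "nat list" | Gen "nat list" symb "nat list"

fun gen_src :: "wgen \<Rightarrow> nat list" where
  "gen_src (Idn a) = a"
| "gen_src (Gen x g y) = x @ sym_src g @ y"

fun gen_tgt :: "wgen \<Rightarrow> nat list" where
  "gen_tgt (Idn a) = a"
| "gen_tgt (Gen x g y) = x @ sym_tgt g @ y"

fun gen_odd :: "wgen \<Rightarrow> bool" where
  "gen_odd (Idn a) = False"
| "gen_odd (Gen x g y) = sym_odd g"

definition web_gens :: "nat \<Rightarrow> wgen set"
  where "web_gens r = {Idn a | a. a \<in> Acomp r} \<union>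
    {Gen x g y | x g y. sym_ok g \<and> x @ sym_src g @ y \<in> Acomp r \<and> x @ sym_tgt g @ y \<in> Acomp r}"

text \<open>Local webs are elements of the free algebra on \<^typ>\<open>wgen\<close>, a product \<open>f * g\<close> meaning \<open>f\<close> on top
  of \<open>g\<close>. Strands labelled 0 are erased throughout, and \<^term>\<open>pad x y f\<close> is \<open>1\<^sub>x \<otimes> f \<otimes> 1\<^sub>y\<close>.\<close>

definition idw :: "nat list \<Rightarrow> wgen fa"
  where "idw u = mono [Idn (erase u)]"

definition mrg :: "nat \<Rightarrow> nat \<Rightarrow> wgen fa"
  where "mrg k l = (if k = 0 \<or> l = 0 then idw [k + l] else mono [Gen [] (Merge k l) []])"

definition spl :: "nat \<Rightarrow> nat \<Rightarrow> wgen fa"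
  where "spl k l = (if k = 0 \<or> l = 0 then idw [k + l] else mono [Gen [] (Split k l) []])"

definition dot :: "nat \<Rightarrow> wgen fa"
  where "dot k = (if k = 0 then 0 else mono [Gen [] (Dot k) []])"

fun pad_gen :: "nat list \<Rightarrow> nat list \<Rightarrow> wgen \<Rightarrow> wgen" where
  "pad_gen x y (Idn u) = Idn (erase x @ u @ erase y)"
| "pad_gen x y (Gen x' g y') = Gen (erase x @ x') g (y' @ erase y)"

definition pad :: "nat list \<Rightarrow> nat list \<Rightarrow> wgen fa \<Rightarrow> wgen fa"
  where "pad x y = lin_ext (\<lambda>w. mono (map (pad_gen x y) w))"

text \<open>Expressions with a negatively labelled strand are zero; the case distinctions below also keep
  the truncated subtractions harmless.\<close>

definition ladE :: "nat \<Rightarrow> nat \<Rightarrow> wgen fa"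
  where "ladE k l = (if l < 1 then 0 else pad [] [l - 1] (mrg k 1) * pad [k] [] (spl 1 (l - 1)))"

definition ladF :: "nat \<Rightarrow> nat \<Rightarrow> wgen fa"
  where "ladF k l = (if k < 1 then 0 else pad [k - 1] [] (mrg 1 l) * pad [] [l] (spl (k - 1) 1))"

definition ladE_dot :: "nat \<Rightarrow> nat \<Rightarrow> wgen fa"
  where "ladE_dot k l = (if l < 1 then 0 else
    pad [] [l - 1] (mrg k 1) * pad [k] [l - 1] (dot 1) * pad [k] [] (spl 1 (l - 1)))"

definition ladF_dot :: "nat \<Rightarrow> nat \<Rightarrow> wgen fa"
  where "ladF_dot k l = (if k < 1 then 0 else
    pad [k - 1] [] (mrg 1 l) * pad [k - 1] [l] (dot 1) * pad [] [l] (spl (k - 1) 1))"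

text \<open>Products \<open>G G'\<close> of ladders, where \<open>G, G'\<close> are of type \<open>E\<close> or \<open>F\<close>, dotted or not:
  \<open>EF\<close>, \<open>FE\<close> on \<open>(k,l)\<close>, and \<open>E\<^sub>1E\<^sub>2\<close>, \<open>E\<^sub>2E\<^sub>1\<close>, \<open>F\<^sub>1F\<^sub>2\<close>, \<open>F\<^sub>2F\<^sub>1\<close> on \<open>(h,k,l)\<close>. The
  subscripts of the upper ladder are the labels produced by the lower one; they are only used
  with \<open>h, k, l > 0\<close>.\<close>

type_synonym ladder = "nat \<Rightarrow> nat \<Rightarrow> wgen fa"

definition lEF :: "ladder \<Rightarrow> ladder \<Rightarrow> nat \<Rightarrow> nat \<Rightarrow> wgen fa"
  where "lEF G G' k l = G (k - 1) (l + 1) * G' k l"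

definition lFE :: "ladder \<Rightarrow> ladder \<Rightarrow> nat \<Rightarrow> nat \<Rightarrow> wgen fa"
  where "lFE G G' k l = G (k + 1) (l - 1) * G' k l"

definition lE1E2 :: "ladder \<Rightarrow> ladder \<Rightarrow> nat \<Rightarrow> nat \<Rightarrow> nat \<Rightarrow> wgen fa"
  where "lE1E2 G G' h k l = pad [] [l - 1] (G h (k + 1)) * pad [h] [] (G' k l)"

definition lE2E1 :: "ladder \<Rightarrow> ladder \<Rightarrow> nat \<Rightarrow> nat \<Rightarrow> nat \<Rightarrow> wgen fa"
  where "lE2E1 G G' h k l = pad [h + 1] [] (G (k - 1) l) * pad [] [l] (G' h k)"

definition lF1F2 :: "ladder \<Rightarrow> ladder \<Rightarrow> nat \<Rightarrow> nat \<Rightarrow> nat \<Rightarrow> wgen fa"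
  where "lF1F2 G G' h k l = pad [] [l + 1] (G h (k - 1)) * pad [h] [] (G' k l)"

definition lF2F1 :: "ladder \<Rightarrow> ladder \<Rightarrow> nat \<Rightarrow> nat \<Rightarrow> nat \<Rightarrow> wgen fa"
  where "lF2F1 G G' h k l = pad [h - 1] [] (G (k + 1) l) * pad [] [l] (G' h k)"

text \<open>\<open>f \<otimes> g\<close> for \<open>f: u \<rightarrow> v\<close> and \<open>g: u' \<rightarrow> v'\<close>.\<close>

definition wtensor :: "nat list \<Rightarrow> nat list \<Rightarrow> wgen fa \<Rightarrow> wgen fa \<Rightarrow> wgen fa"
  where "wtensor u v' f g = pad [] v' f * pad u [] g"

abbreviation dot_dot :: "wgen fa"
  where "dot_dot \<equiv> wtensor [1] [1] (dot 1) (dot 1)"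

text \<open>\<^term>\<open>local_rel u f g\<close>: the defining relation \<open>f = g\<close> between local webs with source \<open>u\<close>.\<close>

inductive local_rel :: "nat list \<Rightarrow> wgen fa \<Rightarrow> wgen fa \<Rightarrow> bool" where
  merge_assoc: "\<lbrakk>0 < h; 0 < k; 0 < l\<rbrakk> \<Longrightarrow> local_rel [h, k, l]
    (mrg (h + k) l * pad [] [l] (mrg h k)) (mrg h (k + l) * pad [h] [] (mrg k l))"
| split_assoc: "\<lbrakk>0 < h; 0 < k; 0 < l\<rbrakk> \<Longrightarrow> local_rel [h + k + l]
    (pad [h] [] (spl k l) * spl h (k + l)) (pad [] [l] (spl h k) * spl (h + k) l)"
| digon: "\<lbrakk>0 < k; 0 < l\<rbrakk> \<Longrightarrow> local_rel [k + l]
    (mrg k l * spl k l) (fscale (of_nat ((k + l) choose l)) (idw [k + l]))"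
| dot_square: "0 < k \<Longrightarrow> local_rel [k] (dot k * dot k) (fscale (of_nat k) (idw [k]))"
| dot_merge_left: "0 < k \<Longrightarrow> local_rel [1, k]
    (dot (1 + k) * mrg 1 k) (mrg 1 k * pad [] [k] (dot 1) + mrg 1 k * pad [1] [] (dot k))"
| dot_split_left: "0 < k \<Longrightarrow> local_rel [1 + k]
    (spl 1 k * dot (1 + k)) (pad [] [k] (dot 1) * spl 1 k + pad [1] [] (dot k) * spl 1 k)"
| dot_merge_right: "0 < k \<Longrightarrow> local_rel [k, 1]
    (dot (k + 1) * mrg k 1) (mrg k 1 * pad [] [1] (dot k) + mrg k 1 * pad [k] [] (dot 1))"
| dot_split_right: "0 < k \<Longrightarrow> local_rel [k + 1]
    (spl k 1 * dot (k + 1)) (pad [] [1] (dot k) * spl k 1 + pad [k] [] (dot 1) * spl k 1)"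
| dumbbell: "local_rel [1, 1]
    (spl 1 1 * mrg 1 1 - dot_dot * (spl 1 1 * mrg 1 1) * dot_dot) (fscale 2 (idw [1, 1]))"
| square: "\<lbrakk>0 < k; 0 < l\<rbrakk> \<Longrightarrow> local_rel [k, l]
    (lEF ladE ladF k l - lFE ladF ladE k l) (fscale (of_nat k - of_nat l) (idw [k, l]))"
| square_dotE: "\<lbrakk>0 < k; 0 < l\<rbrakk> \<Longrightarrow> local_rel [k, l]
    (lEF ladE_dot ladF k l - lFE ladF ladE_dot k l) (pad [] [l] (dot k) - pad [k] [] (dot l))"
| square_dotF: "\<lbrakk>0 < k; 0 < l\<rbrakk> \<Longrightarrow> local_rel [k, l]
    (lEF ladE ladF_dot k l - lFE ladF_dot ladE k l) (pad [] [l] (dot k) - pad [k] [] (dot l))"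
| serreE: "\<lbrakk>0 < h; 0 < k; 0 < l\<rbrakk> \<Longrightarrow> local_rel [h, k, l]
    (lE1E2 ladE ladE h k l - lE2E1 ladE ladE h k l)
    (lE1E2 ladE_dot ladE_dot h k l + lE2E1 ladE_dot ladE_dot h k l)"
| serreF: "\<lbrakk>0 < h; 0 < k; 0 < l\<rbrakk> \<Longrightarrow> local_rel [h, k, l]
    (lF2F1 ladF ladF h k l - lF1F2 ladF ladF h k l)
    (lF2F1 ladF_dot ladF_dot h k l + lF1F2 ladF_dot ladF_dot h k l)"
| serreE_dot: "\<lbrakk>0 < h; 0 < k; 0 < l\<rbrakk> \<Longrightarrow> local_rel [h, k, l]
    (lE1E2 ladE ladE_dot h k l - lE2E1 ladE_dot ladE h k l)
    (lE1E2 ladE_dot ladE h k l - lE2E1 ladE ladE_dot h k l)"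
| serreF_dot: "\<lbrakk>0 < h; 0 < k; 0 < l\<rbrakk> \<Longrightarrow> local_rel [h, k, l]
    (lF1F2 ladF ladF_dot h k l - lF2F1 ladF_dot ladF h k l)
    (lF1F2 ladF_dot ladF h k l - lF2F1 ladF ladF_dot h k l)"

definition web_rels :: "nat \<Rightarrow> wgen fa set"
  where "web_rels r =
    {mono [Idn a] * mono [Idn b] - (if a = b then mono [Idn a] else 0) | a b.
       a \<in> Acomp r \<and> b \<in> Acomp r} \<union>
    {mono [w] - mono [Idn (gen_tgt w)] * mono [w] * mono [Idn (gen_src w)] | w.
       w \<in> web_gens r} \<union>
    {mono [Gen (x @ sym_tgt f @ y) g z] * mono [Gen x f (y @ sym_src g @ z)]
       - fscale (ksign (sym_odd f \<and> sym_odd g))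
           (mono [Gen x f (y @ sym_tgt g @ z)] * mono [Gen (x @ sym_src f @ y) g z]) | x f y g z.
       sym_ok f \<and> sym_ok g \<and> x @ sym_src f @ y @ sym_src g @ z \<in> Acomp r} \<union>
    {pad x y f - pad x y g | x y u f g. local_rel u f g \<and> x @ u @ y \<in> Acomp r}"

definition web :: "nat \<Rightarrow> wgen fa set superalgebra"
  where "web r = presented_nonunital (web_gens r) gen_odd (web_rels r)
    (\<Sum>a\<in>Acomp r. mono [Idn a])"

definition web_class :: "nat \<Rightarrow> wgen fa \<Rightarrow> wgen fa set"
  where "web_class r = pres_class (web_gens r) gen_odd (web_rels r)"


section \<open>The Sergeev superalgebra and its action on tensor superspace\<close>

datatype sgen = S nat | C nat

fun sgen_odd :: "sgen \<Rightarrow> bool" where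
  "sgen_odd (S i) = False"
| "sgen_odd (C j) = True"

definition sgens :: "nat \<Rightarrow> sgen set"
  where "sgens r = S ` {1..<r} \<union> C ` {1..r}"

definition sergeev_rels :: "nat \<Rightarrow> sgen fa set"
  where "sergeev_rels r =
    {mono [C i, C i] - 1 | i. i \<in> {1..r}} \<union>
    {mono [C i, C j] + mono [C j, C i] | i j. i \<in> {1..r} \<and> j \<in> {1..r} \<and> i \<noteq> j} \<union>
    {mono [S i, S i] - 1 | i. i \<in> {1..<r}} \<union>
    {mono [S i, S (i + 1), S i] - mono [S (i + 1), S i, S (i + 1)] | i.
       i \<in> {1..<r} \<and> i + 1 \<in> {1..<r}} \<union>
    {mono [S i, S j] - mono [S j, S i] | i j.
       i \<in> {1..<r} \<and> j \<in> {1..<r} \<and> (i + 1 < j \<or> j + 1 < i)} \<union>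
    {mono [C i, S i] - mono [S i, C (i + 1)] | i. i \<in> {1..<r}} \<union>
    {mono [C (i + 1), S i] - mono [S i, C i] | i. i \<in> {1..<r}} \<union>
    {mono [C j, S i] - mono [S i, C j] | i j.
       i \<in> {1..<r} \<and> j \<in> {1..r} \<and> j \<noteq> i \<and> j \<noteq> i + 1}"

definition sergeev :: "nat \<Rightarrow> sgen fa set superalgebra"
  where "sergeev r = presented (sgens r) sgen_odd (sergeev_rels r)"

definition sergeev_class :: "nat \<Rightarrow> sgen fa \<Rightarrow> sgen fa set"
  where "sergeev_class r = pres_class (sgens r) sgen_odd (sergeev_rels r)"

text \<open>The element of the Sergeev superalgebra given by a permutation: a product
  \<open>s\<^bsub>i\<^sub>1\<^esub> \<cdots> s\<^bsub>i\<^sub>n\<^esub>\<close> along an arbitrary factorization of the permutation (the result does not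
  depend on the choice, by the Coxeter relations).\<close>

definition sergeev_perm :: "nat \<Rightarrow> (nat \<Rightarrow> nat) \<Rightarrow> sgen fa set"
  where "sergeev_perm r \<sigma> = sergeev_class r (mono (map S (SOME is. set is \<subseteq> {1..<r} \<and>
    foldr (\<lambda>i \<pi>. transpose i (i + 1) \<circ> \<pi>) is id = \<sigma>)))"

text \<open>The pair \<open>(k, b)\<close> indexes the basis vector \<open>v\<^sub>k\<close> of \<open>V\<close>, barred (odd) iff \<open>b\<close>. The tensor algebra
  of \<open>V\<close> is \<open>vidx fa\<close>, with \<open>\<otimes>\<close> being multiplication; the \<open>r\<close>-th tensor power of \<open>V\<close> is spanned by
  the words of length \<open>r\<close> with indices in \<open>{1..r}\<close>.\<close>

type_synonym vidx = "nat \<times> bool"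

definition apply_at :: "bool \<Rightarrow> nat \<Rightarrow> (vidx \<Rightarrow> vidx fa) \<Rightarrow> vidx list \<Rightarrow> vidx fa"
  where "apply_at p t X w = fscale (ksign (p \<and> list_parity snd (take t w)))
    (mono (take t w) * X (w ! t) * mono (drop (t + 1) w))"

fun sgen_act :: "sgen \<Rightarrow> vidx fa \<Rightarrow> vidx fa" where
  "sgen_act (S i) = lin_ext (\<lambda>w. fscale (ksign (snd (w ! (i - 1)) \<and> snd (w ! i)))
      (mono (w[i - 1 := w ! i, i := w ! (i - 1)])))"
| "sgen_act (C j) = lin_ext (apply_at True (j - 1)
      (\<lambda>(k, b). fscale (ksign b * \<i>) (mono [(k, \<not> b)])))"

definition free_act :: "sgen fa \<Rightarrow> vidx fa \<Rightarrow> vidx fa"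
  where "free_act x v = (\<Sum>w\<in>Poly_Mapping.keys x.
    fscale (Poly_Mapping.lookup x w) (foldr sgen_act (letters w) v))"

text \<open>The action of a class is that of any representative.\<close>

definition sergeev_act :: "sgen fa set \<Rightarrow> vidx fa \<Rightarrow> vidx fa"
  where "sergeev_act X v = free_act (SOME x. x \<in> X) v"

definition Mperm :: "nat \<Rightarrow> nat list \<Rightarrow> vidx fa set"
  where "Mperm r lam = fspan {mono w | w. length w = r \<and> fst ` set w \<subseteq> {1..r} \<and>
    (\<forall>k\<in>{1..r}. length (filter (\<lambda>i. fst i = k) w) = lam ! (k - 1))}"

text \<open>The direct sum is internal, as different \<open>\<nu>\<close> involve different monomials.\<close>

definition Msum :: "nat \<Rightarrow> vidx fa set"
  where "Msum r = fspan (\<Union>\<nu>\<in>Lam' r. Mperm r \<nu>)"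

text \<open>Let \<open>A\<close> be a subspace spanned by monomials. A linear map defined on \<open>A\<close> is encoded as the
  linear map on the whole tensor algebra which extends it by zero on all other monomials. In
  particular maps \<open>M\<^sup>\<lambda> \<rightarrow> M\<^sup>\<mu>\<close> are identified with the endomorphisms \<open>f = 1\<^sub>\<mu> f 1\<^sub>\<lambda>\<close> of the direct sum.\<close>

definition HomH_part :: "nat \<Rightarrow> bool \<Rightarrow> vidx fa set \<Rightarrow> vidx fa set \<Rightarrow> (vidx fa \<Rightarrow> vidx fa) set"
  where "HomH_part r p A B = {f. Vector_Spaces.linear fscale fscale f \<and>
     (\<forall>w. mono w \<notin> A \<longrightarrow> f (mono w) = 0) \<and>
     f ` A \<subseteq> B \<and>
     (\<forall>q. f ` (A \<inter> homog snd q) \<subseteq> homog snd (p \<noteq> q)) \<and>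
     (\<forall>q. \<forall>X\<in>hom_part (sergeev r) q. \<forall>v\<in>A.
        f (sergeev_act X v) = fscale (ksign (p \<and> q)) (sergeev_act X (f v)))}"

definition HomH :: "nat \<Rightarrow> vidx fa set \<Rightarrow> vidx fa set \<Rightarrow> (vidx fa \<Rightarrow> vidx fa) set"
  where "HomH r A B = {f + g | f g. f \<in> HomH_part r False A B \<and> g \<in> HomH_part r True A B}"

definition op_scale :: "complex \<Rightarrow> (vidx fa \<Rightarrow> vidx fa) \<Rightarrow> vidx fa \<Rightarrow> vidx fa"
  where "op_scale c f = (\<lambda>v. fscale c (f v))"

global_interpretation ops: vector_space op_scale
  defines op_span = "ops.span" and op_dependent = "ops.dependent"
  by unfold_locales
    (simp_all add: op_scale_def fun_eq_iff fvs.scale_right_distrib fvs.scale_left_distrib)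

definition proj :: "vidx fa set \<Rightarrow> vidx fa \<Rightarrow> vidx fa"
  where "proj A = lin_ext (\<lambda>w. if mono w \<in> A then mono w else 0)"

definition EndH :: "nat \<Rightarrow> (vidx fa \<Rightarrow> vidx fa) superalgebra"
  where "EndH r =
    \<lparr>carrier = HomH r (Msum r) (Msum r), monoid.mult = (\<circ>), one = proj (Msum r), zero = 0, add = (+),
     smult = op_scale, hom_part = (\<lambda>p. HomH_part r p (Msum r) (Msum r))\<rparr>"


section \<open>The isomorphisms \<open>\<psi>\<close> and \<open>\<xi>\<close>\<close>

definition leibniz :: "bool \<Rightarrow> (vidx \<Rightarrow> vidx fa) \<Rightarrow> vidx fa \<Rightarrow> vidx fa"
  where "leibniz p X = lin_ext (\<lambda>w. \<Sum>t<length w. apply_at p t X w)"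

definition e_op :: "nat \<Rightarrow> vidx fa \<Rightarrow> vidx fa"
  where "e_op i = leibniz False (\<lambda>(k, b). if k = i + 1 then mono [(i, b)] else 0)"

definition f_op :: "nat \<Rightarrow> vidx fa \<Rightarrow> vidx fa"
  where "f_op i = leibniz False (\<lambda>(k, b). if k = i then mono [(i + 1, b)] else 0)"

definition hbar_op :: "nat \<Rightarrow> vidx fa \<Rightarrow> vidx fa"
  where "hbar_op j = leibniz True (\<lambda>(k, b). if k = j then mono [(k, \<not> b)] else 0)"

definition divpow :: "(vidx fa \<Rightarrow> vidx fa) \<Rightarrow> nat \<Rightarrow> vidx fa \<Rightarrow> vidx fa"
  where "divpow f p = op_scale (1 / fact p) (f ^^ p)"

abbreviation proj_comp :: "nat \<Rightarrow> nat list \<Rightarrow> vidx fa \<Rightarrow> vidx fa"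
  where "proj_comp r a \<equiv> proj (Mperm r (hat r a))"

text \<open>\<open>a\<close> is the composition before the merge, resp. after the split, of its strands \<open>i\<close> and \<open>i + 1\<close>;
  the entry of its padding \<open>hat r a\<close> with (one-based) number \<open>j + 1\<close> is \<open>hat r a ! j\<close>.
  Up to divided powers, the operators are \<open>e\<^bsub>r-1\<^esub> \<cdots> e\<^bsub>i+1\<^esub> e\<^bsub>i\<^esub>\<close> and \<open>f\<^bsub>i\<^esub> f\<^bsub>i+1\<^esub> \<cdots> f\<^bsub>r-1\<^esub>\<close>, restricted
  to the source.\<close>

definition merge_op :: "nat \<Rightarrow> nat list \<Rightarrow> nat \<Rightarrow> vidx fa \<Rightarrow> vidx fa"
  where "merge_op r a i =
    fold (\<lambda>j F. divpow (e_op j) (hat r a ! j) \<circ> F) [i..<r] (proj_comp r a)"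

definition split_op :: "nat \<Rightarrow> nat list \<Rightarrow> nat list \<Rightarrow> nat \<Rightarrow> vidx fa \<Rightarrow> vidx fa"
  where "split_op r a b i =
    foldr (\<lambda>j F. divpow (f_op j) (hat r a ! j) \<circ> F) [i..<r] (proj_comp r b)"

definition is_psi :: "nat \<Rightarrow> (wgen fa set \<Rightarrow> vidx fa \<Rightarrow> vidx fa) \<Rightarrow> bool"
  where "is_psi r \<psi> \<longleftrightarrow> \<psi> \<in> superalg_iso (web r) (EndH r) \<and>
    (\<forall>a\<in>Acomp r. \<psi> (web_class r (mono [Idn a])) = proj_comp r a) \<and>
    (\<forall>x k l y. x @ [k, l] @ y \<in> Acomp r \<longrightarrow>
       \<psi> (web_class r (mono [Gen x (Merge k l) y]))
         = merge_op r (x @ [k, l] @ y) (length x + 1) \<and>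
       \<psi> (web_class r (mono [Gen x (Split k l) y]))
         = split_op r (x @ [k, l] @ y) (x @ [k + l] @ y) (length x + 1)) \<and>
    (\<forall>x k y. x @ [k] @ y \<in> Acomp r \<longrightarrow>
       \<psi> (web_class r (mono [Gen x (Dot k) y]))
         = hbar_op (length x + 1) \<circ> proj_comp r (x @ [k] @ y))"

definition ones :: "nat \<Rightarrow> nat list"
  where "ones n = replicate n 1"

definition crossing :: "wgen fa"
  where "crossing = spl 1 1 * mrg 1 1 - idw [1, 1]"

definition is_xi :: "nat \<Rightarrow> (sgen fa set \<Rightarrow> wgen fa set) \<Rightarrow> bool"
  where "is_xi r \<xi> \<longleftrightarrow>
    \<xi> \<in> superalg_iso (sergeev r) (corner (web r) (web_class r (mono [Idn (ones r)]))) \<and>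
    (\<forall>i\<in>{1..<r}. \<xi> (sergeev_class r (mono [S i]))
       = web_class r (pad (ones (i - 1)) (ones (r - i - 1)) crossing)) \<and>
    (\<forall>j\<in>{1..r}. \<xi> (sergeev_class r (mono [C j]))
       = web_class r (pad (ones (j - 1)) (ones (r - j)) (dot 1)))"


section \<open>Supertabloids and the webs attached to them\<close>

text \<open>The ordered alphabet \<open>1' < 1 < 2' < 2 < \<dots>\<close>.\<close>

datatype entry = Entry (num: nat) (primed: bool)

lemma entry_eq_iff: "x = y \<longleftrightarrow> num x = num y \<and> primed x = primed y"
  by (cases x; cases y) auto

instantiation entry :: linorder
begin
definition less_entry :: "entry \<Rightarrow> entry \<Rightarrow> bool"
  where "less_entry x y \<longleftrightarrow> num x < num y \<or> (num x = num y \<and> primed x \<and> \<not> primed y)"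
definition less_eq_entry :: "entry \<Rightarrow> entry \<Rightarrow> bool"
  where "less_eq_entry (x::entry) y \<longleftrightarrow> x < y \<or> x = y"
instance by standard (auto simp: less_entry_def less_eq_entry_def entry_eq_iff)
end

text \<open>A supertabloid is the list of its \<open>r\<close> rows, each of them a multiset.\<close>

definition supertabloids :: "nat \<Rightarrow> nat list \<Rightarrow> nat list \<Rightarrow> entry multiset list set"
  where "supertabloids r lam mu = {T. length T = r \<and>
     (\<forall>R\<in>set T. \<forall>x\<in>#R. num x \<in> {1..r}) \<and>
     (\<forall>i<r. size (T ! i) = lam ! i) \<and>
     (\<forall>j\<in>{1..r}. (\<Sum>R\<leftarrow>T. size (filter_mset (\<lambda>x. num x = j) R)) = mu ! (j - 1))}"

definition supertabloids_star :: "nat \<Rightarrow> nat list \<Rightarrow> nat list \<Rightarrow> entry multiset list set"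
  where "supertabloids_star r lam mu = {T \<in> supertabloids r lam mu.
     \<forall>i\<in>{1..len lam}. \<forall>j\<in>{1..len mu}. count (T ! (i - 1)) (Entry j True) \<le> 1}"

definition reading :: "entry multiset list \<Rightarrow> entry list"
  where "reading T = concat (map sorted_list_of_multiset T)"

definition tab_entry :: "entry multiset list \<Rightarrow> nat \<Rightarrow> entry"
  where "tab_entry T p = reading T ! (p - 1)"

definition tab_perm :: "nat \<Rightarrow> nat list \<Rightarrow> entry multiset list \<Rightarrow> nat \<Rightarrow> nat"
  where "tab_perm r mu T p = (if p \<in> {1..r}
     then sum_list (take (num (tab_entry T p) - 1) mu)
       + card {q \<in> {1..p}. num (tab_entry T q) = num (tab_entry T p)}
     else p)"

definition tab_dotted :: "nat \<Rightarrow> nat list \<Rightarrow> entry multiset list \<Rightarrow> nat \<Rightarrow> bool"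
  where "tab_dotted r mu T j \<longleftrightarrow> (\<exists>p\<in>{1..r}. tab_perm r mu T p = j \<and> primed (tab_entry T p))"

definition w_tab :: "nat \<Rightarrow> (sgen fa set \<Rightarrow> wgen fa set) \<Rightarrow> nat list \<Rightarrow> entry multiset list
    \<Rightarrow> wgen fa set"
  where "w_tab r \<xi> mu T =
    \<xi> (sergeev_class r (mono (map C (filter (tab_dotted r mu T) [1..<r + 1])))
        \<otimes>\<^bsub>sergeev r\<^esub> sergeev_perm r (tab_perm r mu T))"

fun csplit :: "nat \<Rightarrow> wgen fa" where
  "csplit 0 = 0"
| "csplit (Suc 0) = idw [1]"
| "csplit (Suc (Suc n)) = pad [1] [] (csplit (Suc n)) * spl 1 (Suc n)"

fun cmerge :: "nat \<Rightarrow> wgen fa" where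
  "cmerge 0 = 0"
| "cmerge (Suc 0) = idw [1]"
| "cmerge (Suc (Suc n)) = mrg 1 (Suc n) * pad [1] [] (cmerge (Suc n))"

fun csplits :: "nat list \<Rightarrow> wgen fa" where
  "csplits [] = idw []"
| "csplits [k] = csplit k"
| "csplits (k # a) = wtensor [k] (ones (sum_list a)) (csplit k) (csplits a)"

fun cmerges :: "nat list \<Rightarrow> wgen fa" where
  "cmerges [] = idw []"
| "cmerges [k] = cmerge k"
| "cmerges (k # a) = wtensor (ones k) a (cmerge k) (cmerges a)"

definition theta :: "nat \<Rightarrow> (sgen fa set \<Rightarrow> wgen fa set) \<Rightarrow> nat list \<Rightarrow> nat list
    \<Rightarrow> entry multiset list \<Rightarrow> wgen fa set"
  where "theta r \<xi> lam mu T =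
    web_class r (cmerges (comp_of mu)) \<otimes>\<^bsub>web r\<^esub> w_tab r \<xi> mu T
      \<otimes>\<^bsub>web r\<^esub> web_class r (csplits (comp_of lam))"

end

theory Submission
  imports Defs "HOL-Combinatorics.Permutations"
begin

text \<open>Let \<open>v\<close> be the monomial of \<open>M\<^sup>\<lambda>\<close> whose letters are even and weakly increasing,
  \<open>v = v\<^sub>1 \<otimes> \<dots> \<otimes> v\<^sub>1 \<otimes> v\<^sub>2 \<otimes> \<dots>\<close>; in the code it is \<open>even_word (blocks a)\<close>, where \<open>a\<close> is the composition
  obtained from \<open>\<lambda>\<close>. The places carrying the label \<open>i\<close> form the \<open>i\<close>-th row of \<open>\<lambda>\<close>. The proof compares
  both sides of the claim through the map \<open>f \<mapsto> f(v)\<close>.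

  \<^emph>\<open>Upper bound.\<close> The Sergeev superalgebra exchanges neighbouring letters and changes bars, so \<open>v\<close>
  generates \<open>M\<^sup>\<lambda>\<close>, and a homomorphism is determined by \<open>f(v)\<close> (\<open>HomH_determined\<close>). Exchanging two
  places of the same row fixes \<open>v\<close>, hence it fixes \<open>f(v)\<close> (\<open>HomH_row_invariant\<close>). Therefore the
  coefficients of \<open>f(v)\<close> agree up to sign along every orbit of words of content \<open>\<mu>\<close> under permutations
  within rows. These orbits are the supertabloids, with the reading word as a representative, and on
  an orbit with a primed entry repeated in a row the coefficient is zero, because the exchange of two
  equal odd letters changes the sign (\<open>row_invariant_vanishes\<close>). So the coefficients of \<open>f(v)\<close> at the
  reading words of the \<open>T \<in> \<T>\<^sub>*(\<lambda>, \<mu>)\<close> determine \<open>f\<close>.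

  \<^emph>\<open>The images of the webs.\<close> Under \<open>\<psi>\<close>, an iterated merge relabels the letters of a monomial by a
  monotone map, an iterated split sends a monomial to the sum over a fibre of such a map, a crossing
  exchanges two labels, and a dot changes the bar of one letter up to sign. Hence \<open>\<psi>(\<theta>\<^sub>T)(v)\<close> is a sum
  over the permutations \<open>\<tau>\<close> that preserve the rows, the summand being the reading word of \<open>T\<close> permuted by
  \<open>\<tau>\<close>, with a sign (\<open>theta_even_word\<close>).

  \<^emph>\<open>Comparison.\<close> Permuting within rows does not change the tabloid, so the coefficient of \<open>\<psi>(\<theta>\<^sub>T)(v)\<close>
  at the reading word of \<open>T'\<close> vanishes for \<open>T' \<noteq> T\<close>. For \<open>T' = T\<close> and \<open>T \<in> \<T>\<^sub>*(\<lambda>, \<mu>)\<close>, the permutations that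
  contribute fix the places of all primed entries, and the sign depends only on these places
  (\<open>dot_sign_row_perm\<close>); so nothing cancels. The matrix of coefficients is therefore diagonal with
  nonzero diagonal entries (\<open>coeff_theta\<close>), which gives injectivity, linear independence and, by the
  upper bound, the spanning property.\<close>

section \<open>Linear maps on free algebras\<close>

abbreviation lin :: "('g fa \<Rightarrow> 'h fa) \<Rightarrow> bool"
  where "lin f \<equiv> Vector_Spaces.linear fscale fscale f"

lemma lin_add: "lin f \<Longrightarrow> f (x + y) = f x + f y"
  by (metis Vector_Spaces.linear_def module_hom.add)

lemma lin_scale: "lin f \<Longrightarrow> f (fscale c x) = fscale c (f x)"
  by (metis Vector_Spaces.linear_def module_hom.scale)

lemma lin_zero: "lin f \<Longrightarrow> f 0 = 0"
  by (metis Vector_Spaces.linear_def module_hom.zero)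

lemma lin_diff: "lin f \<Longrightarrow> f (x - y) = f x - f y"
  by (metis Vector_Spaces.linear_def module_hom.diff)

lemma lin_sum: "lin f \<Longrightarrow> f (sum g A) = (\<Sum>a\<in>A. f (g a))"
  by (metis Vector_Spaces.linear_def module_hom.sum)

lemma linI:
  assumes "\<And>x y. f (x + y) = f x + f y" "\<And>c x. f (fscale c x) = fscale c (f x)"
  shows "lin (f :: 'g fa \<Rightarrow> 'h fa)"
  using assms by unfold_locales auto

lemma lin_comp: "lin f \<Longrightarrow> lin g \<Longrightarrow> lin (f \<circ> g)"
  by (auto intro!: linI simp: lin_add lin_scale)

lemma lin_plus: "lin f \<Longrightarrow> lin g \<Longrightarrow> lin (f + g)"
  by (auto intro!: linI simp: lin_add lin_scale fvs.scale_right_distrib)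

lemma lookup_mono: "Poly_Mapping.lookup (mono v) w = (if w = Word v then 1 else 0)"
  by (simp add: mono_def lookup_single when_def)

lemma keys_mono [simp]: "Poly_Mapping.keys (mono w) = {Word w}"
  by (simp add: mono_def)

lemma mono_eq_iff [simp]: "mono v = mono w \<longleftrightarrow> v = w"
  by (metis keys_mono singleton_iff word.inject)

lemma mono_neq_0 [simp]: "mono v \<noteq> 0"
  by (metis keys_mono keys_zero insert_not_empty)

lemma mono_mult: "mono v * mono w = mono (v @ w)"
  by (simp add: mono_def mult_single plus_word_def)

lemma mono_Nil: "mono [] = 1"
  by (simp add: mono_def zero_word_def [symmetric])

lemma lookup_fscale: "Poly_Mapping.lookup (fscale c x) w = c * Poly_Mapping.lookup x w"
  by (simp add: fscale_def Poly_Mapping.map.rep_eq mult_map_scale_conv_mult [symmetric] when_def)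

lemma keys_fscale: "Poly_Mapping.keys (fscale c x) \<subseteq> Poly_Mapping.keys x"
  by (auto simp: in_keys_iff lookup_fscale)

lemma fscale_eq_0_iff: "fscale c x = 0 \<longleftrightarrow> c = 0 \<or> x = 0"
  by (rule fvs.scale_eq_0_iff)

lemma fscale_mult_left: "fscale c x * y = fscale c (x * y)"
  by (simp add: fscale_def mult.assoc)

lemma fa_expansion:
  fixes x :: "'g fa"
  shows "x = (\<Sum>w\<in>Poly_Mapping.keys x. fscale (Poly_Mapping.lookup x w) (mono (letters w)))"
proof (rule poly_mapping_eqI)
  fix v
  have "Poly_Mapping.lookup (\<Sum>w\<in>Poly_Mapping.keys x. fscale (Poly_Mapping.lookup x w) (mono (letters w))) v
     = (\<Sum>w\<in>Poly_Mapping.keys x. if v = w then Poly_Mapping.lookup x w else 0)"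
    unfolding lookup_sum by (rule sum.cong) (auto simp: lookup_fscale lookup_mono)
  also have "\<dots> = Poly_Mapping.lookup x v"
    by (simp add: sum.delta' in_keys_iff)
  finally show "Poly_Mapping.lookup x v = Poly_Mapping.lookup (\<Sum>w\<in>Poly_Mapping.keys x.
      fscale (Poly_Mapping.lookup x w) (mono (letters w))) v" by simp
qed

lemma fscale_mult_right: "x * fscale c y = fscale c (x * y)"
proof -
  have *: "mono v * Poly_Mapping.single 0 c = Poly_Mapping.single 0 c * mono v" for v :: "'a list"
    by (simp add: mono_def mult_single)
  have "x * Poly_Mapping.single 0 c = Poly_Mapping.single 0 c * x"
    by (subst (1 2) fa_expansion [of x])
      (simp add: sum_distrib_left sum_distrib_right fscale_mult_left *,
        simp add: fscale_def mult_single mult.commute flip: mult.assoc)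
  then show ?thesis by (metis fscale_def mult.assoc)
qed

lemma lin_eqI:
  assumes "lin f" "lin g" "\<And>w. Word w \<in> Poly_Mapping.keys x \<Longrightarrow> f (mono w) = g (mono w)"
  shows "f x = g x"
proof -
  have *: "Word (letters w) = w" for w :: "'a word" by (cases w) simp
  show ?thesis
    by (subst (1 2) fa_expansion [of x])
      (use assms in \<open>auto simp: lin_sum lin_scale * intro!: sum.cong\<close>)
qed

lemma lin_ext_superset:
  assumes "finite A" "Poly_Mapping.keys x \<subseteq> A"
  shows "lin_ext b x = (\<Sum>w\<in>A. fscale (Poly_Mapping.lookup x w) (b (letters w)))"
  unfolding lin_ext_def
  by (rule sum.mono_neutral_left) (use assms in \<open>auto simp: in_keys_iff\<close>)

lemma lin_lin_ext: "lin (lin_ext b)"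
proof (rule linI)
  fix x y :: "'a fa" and c
  let ?A = "Poly_Mapping.keys x \<union> Poly_Mapping.keys y"
  show "lin_ext b (x + y) = lin_ext b x + lin_ext b y"
    by (subst (1 2 3) lin_ext_superset [of ?A])
      (use keys_add [of x y] in \<open>auto simp: lookup_add fvs.scale_left_distrib sum.distrib\<close>)
  show "lin_ext b (fscale c x) = fscale c (lin_ext b x)"
    by (subst (1 2) lin_ext_superset [of ?A])
      (use keys_fscale [of c x] in \<open>auto simp: lookup_fscale fvs.scale_sum_right\<close>)
qed

lemma lin_ext_mono [simp]: "lin_ext b (mono w) = b w"
  by (simp add: lin_ext_def mono_def)

text \<open>Parity components, permutation supermodules and their sum are spanned by monomials. Describing such a space
  by the support of its elements turns membership into a statement about coefficients.\<close>

definition words_span :: "'g list set \<Rightarrow> 'g fa set"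
  where "words_span A = {x. \<forall>w\<in>Poly_Mapping.keys x. letters w \<in> A}"

lemma fspan_mono: "fspan (mono ` A) = words_span A"
proof (intro equalityI subsetI)
  fix x assume "x \<in> fspan (mono ` A)"
  then show "x \<in> words_span A"
  proof (induction rule: fvs.span_induct_alt)
    case (step c x y)
    then show ?case using keys_add [of "fscale c x" y] keys_fscale [of c x]
      by (fastforce simp: words_span_def)
  qed (simp add: words_span_def)
next
  fix x assume "x \<in> words_span A"
  then show "x \<in> fspan (mono ` A)"
    by (subst fa_expansion [of x], intro fvs.span_sum fvs.span_scale)
      (auto simp: words_span_def intro: fvs.span_base)
qed

lemma mono_in_words_span [simp]: "mono w \<in> words_span A \<longleftrightarrow> w \<in> A"
  by (simp add: words_span_def)

lemma words_span_lookup: "x \<in> words_span A \<longleftrightarrow> (\<forall>w. w \<notin> A \<longrightarrow> Poly_Mapping.lookup x (Word w) = 0)"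
  unfolding words_span_def
  by (smt (verit, best) in_keys_iff mem_Collect_eq word.collapse word.sel)

lemma words_span_add: "x \<in> words_span A \<Longrightarrow> y \<in> words_span A \<Longrightarrow> x + y \<in> words_span A"
  by (simp add: words_span_lookup lookup_add)

lemma words_span_scale: "x \<in> words_span A \<Longrightarrow> fscale c x \<in> words_span A"
  by (simp add: words_span_lookup lookup_fscale)

lemma words_span_zero: "0 \<in> words_span A"
  by (simp add: words_span_lookup)

lemma words_span_sum: "(\<And>i. i \<in> I \<Longrightarrow> g i \<in> words_span A) \<Longrightarrow> sum g I \<in> words_span A"
  by (induction I rule: infinite_finite_induct) (auto intro: words_span_add words_span_zero)

lemma lin_maps_words_span:
  assumes "lin f" "\<And>w. w \<in> A \<Longrightarrow> f (mono w) \<in> words_span B" "x \<in> words_span A"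
  shows "f x \<in> words_span B"
proof -
  have "f x = (\<Sum>w\<in>Poly_Mapping.keys x. fscale (Poly_Mapping.lookup x w) (f (mono (letters w))))"
    by (subst (1) fa_expansion [of x]) (simp add: assms lin_sum lin_scale)
  moreover have "f (mono (letters w)) \<in> words_span B" if "w \<in> Poly_Mapping.keys x" for w
    using assms(2,3) that by (auto simp: words_span_def)
  ultimately show ?thesis by (simp add: words_span_sum words_span_scale)
qed

lemma homog_eq_words_span: "homog par p = words_span {w. list_parity par w = p}"
  by (simp add: homog_def words_span_def)

section \<open>Presented algebras\<close>

lemma carrier_free_superalg:
  "carrier (free_superalg G par) = words_span {w. set w \<subseteq> G}"
  by (simp add: free_superalg_def words_span_def)

text \<open>\<open>Idl\<close> intersects all ideals that contain the relators. Unless the relators lie in the free algebra there are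
  none, and the result is not an ideal.\<close>

locale presentation =
  fixes G :: "'g set" and par :: "'g \<Rightarrow> bool" and R :: "'g fa set"
  assumes relators: "R \<subseteq> carrier (free_superalg G par)"
begin

abbreviation cl where "cl \<equiv> pres_class G par R"

lemma ideal: "ideal (rel_ideal G par R) (free_superalg G par)"
  unfolding rel_ideal_def by (rule ring.genideal_ideal [OF ring_free_superalg relators])

lemma cl_mult:
  assumes "x \<in> carrier (free_superalg G par)" "y \<in> carrier (free_superalg G par)"
  shows "cl x \<otimes>\<^bsub>presented G par R\<^esub> cl y = cl (x * y)"
  using ideal.rcoset_mult_add [OF ideal assms]
  by (simp add: presented_def pres_class_def Let_def FactRing_def free_superalg_def)

lemma cl_add:
  assumes "x \<in> carrier (free_superalg G par)" "y \<in> carrier (free_superalg G par)"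
  shows "cl x \<oplus>\<^bsub>presented G par R\<^esub> cl y = cl (x + y)"
  using ideal.a_rcos_sum [OF ideal assms]
  by (simp add: presented_def pres_class_def Let_def FactRing_def free_superalg_def)

lemma cl_memD:
  assumes "x' \<in> cl x"
  shows "x' - x \<in> rel_ideal G par R"
  using assms by (auto simp: pres_class_def a_r_coset_def' free_superalg_def)

lemma cl_self: "x \<in> cl x"
proof -
  have "0 \<in> rel_ideal G par R"
    using additive_subgroup.zero_closed [OF ideal.axioms(1) [OF ideal]]
    by (simp add: free_superalg_def)
  then show ?thesis
    by (force simp: pres_class_def a_r_coset_def' free_superalg_def)
qed

end

lemma words_span_mult:
  assumes "x \<in> words_span A" "y \<in> words_span B" "\<And>v w. v \<in> A \<Longrightarrow> w \<in> B \<Longrightarrow> v @ w \<in> E"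
  shows "x * y \<in> words_span E"
  using assms keys_mult [of x y] unfolding words_span_def plus_word_def by fastforce

section \<open>The action of the Sergeev superalgebra\<close>

lemma lin_sgen_act: "lin (sgen_act g)"
  by (cases g) (simp_all add: lin_lin_ext)

lemma lin_foldr_sgen_act: "lin (foldr sgen_act w)"
proof (induction w)
  case Nil
  show ?case by (auto intro: linI)
next
  case (Cons g w)
  then show ?case using lin_comp [OF lin_sgen_act Cons.IH] by (simp add: comp_def)
qed

lemma free_act_superset:
  assumes "finite A" "Poly_Mapping.keys x \<subseteq> A"
  shows "free_act x v = (\<Sum>w\<in>A. fscale (Poly_Mapping.lookup x w) (foldr sgen_act (letters w) v))"
  unfolding free_act_def
  by (rule sum.mono_neutral_left) (use assms in \<open>auto simp: in_keys_iff\<close>)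

lemma lin_free_act_left: "lin (\<lambda>x. free_act x v)"
proof (rule linI)
  fix x y :: "sgen fa" and c
  let ?A = "Poly_Mapping.keys x \<union> Poly_Mapping.keys y"
  show "free_act (x + y) v = free_act x v + free_act y v"
    by (subst (1 2 3) free_act_superset [of ?A])
      (use keys_add [of x y] in \<open>auto simp: lookup_add fvs.scale_left_distrib sum.distrib\<close>)
  show "free_act (fscale c x) v = fscale c (free_act x v)"
    by (subst (1 2) free_act_superset [of ?A])
      (use keys_fscale [of c x] in \<open>auto simp: lookup_fscale fvs.scale_sum_right\<close>)
qed

lemma lin_free_act: "lin (free_act x)"
  unfolding free_act_def
  by (rule linI) (simp_all add: lin_add [OF lin_foldr_sgen_act] lin_scale [OF lin_foldr_sgen_act]
      fvs.scale_right_distrib sum.distrib fvs.scale_sum_right mult.commute)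

lemma free_act_mono: "free_act (mono w) v = foldr sgen_act w v"
  by (simp add: free_act_def mono_def)

lemma free_act_mult: "free_act (x * y) v = free_act x (free_act y v)"
proof (rule lin_eqI [of "\<lambda>x. free_act (x * y) v" "\<lambda>x. free_act x (free_act y v)"])
  show "lin (\<lambda>x. free_act (x * y) v)"
    by (rule linI) (simp_all add: distrib_right lin_add [OF lin_free_act_left]
        fscale_mult_left lin_scale [OF lin_free_act_left])
  fix u
  show "free_act (mono u * y) v = free_act (mono u) (free_act y v)"
  proof (rule lin_eqI [of "\<lambda>y. free_act (mono u * y) v"])
    show "lin (\<lambda>y. free_act (mono u * y) v)"
      by (rule linI) (simp_all add: distrib_left lin_add [OF lin_free_act_left]
          fscale_mult_right lin_scale [OF lin_free_act_left])
    show "lin (\<lambda>y. free_act (mono u) (free_act y v))"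
      using lin_comp [OF lin_free_act lin_free_act_left] by (simp add: comp_def)
  qed (simp add: mono_mult free_act_mono)
qed (rule lin_free_act_left)

lemma list_parity_simps [simp]:
  "list_parity par [] = False"
  "list_parity par (x # u) = (par x \<noteq> list_parity par u)"
  "list_parity par (u @ v) = (list_parity par u \<noteq> list_parity par v)"
  by (auto simp: list_parity_def)

lemma list_parity_update:
  "t < length u \<Longrightarrow> list_parity par (u[t := y]) = (list_parity par u \<noteq> (par y \<noteq> par (u ! t)))"
  by (induction u arbitrary: t) (auto split: nat.split)

lemma list_parity_take_update:
  assumes "t < length w"
  shows "list_parity par (take m (w[t := y]))
    = (list_parity par (take m w) \<noteq> (t < m \<and> par y \<noteq> par (w ! t)))"
  using assms by (cases "t < m") (auto simp: take_update_swap list_parity_update list_update_beyond)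

lemma apply_at_mono:
  assumes "t < length w" "X (w ! t) = fscale c (mono [y])"
  shows "apply_at p t X w = fscale (ksign (p \<and> list_parity snd (take t w)) * c) (mono (w[t := y]))"
  using assms by (simp add: apply_at_def fscale_mult_left fscale_mult_right mono_mult upd_conv_take_nth_drop)

lemma sgen_act_C:
  assumes "1 \<le> j" "j \<le> length w"
  shows "sgen_act (C j) (mono w) = fscale
    (ksign (list_parity snd (take (j - 1) w)) * (ksign (snd (w ! (j - 1))) * \<i>))
    (mono (w[j - 1 := (fst (w ! (j - 1)), \<not> snd (w ! (j - 1)))]))"
proof -
  obtain k b where "w ! (j - 1) = (k, b)" by fastforce
  with assms show ?thesis
    by (simp add: apply_at_mono [where y = "(k, \<not> b)" and c = "ksign b * \<i>"])
qed

lemma sgen_act_S: "sgen_act (S i) (mono w) = fscale (ksign (snd (w ! (i - 1)) \<and> snd (w ! i)))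
      (mono (w[i - 1 := w ! i, i := w ! (i - 1)]))"
  by simp

lemma sgen_act_homogeneous:
  assumes "g \<in> sgens r" "x \<in> words_span {w. length w = r}"
  shows "sgen_act g x \<in> words_span {w. length w = r}"
proof (rule lin_maps_words_span [OF lin_sgen_act _ assms(2)])
  fix w :: "vidx list" assume "w \<in> {w. length w = r}"
  with assms(1) show "sgen_act g (mono w) \<in> words_span {w. length w = r}"
    by (auto simp: sgens_def sgen_act_C simp del: sgen_act.simps(2) intro!: words_span_scale)
qed

text \<open>Every generator sends a monomial to a multiple of a monomial. So a relation between products of
  generators amounts to an equality of words and an equality of scalars, and the latter only involves the
  parities of the letters concerned and of the initial segments of the word.\<close>

lemma sergeev_relators_act_zero:
  assumes "x \<in> sergeev_rels r" "length w = r"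
  shows "free_act x (mono w) = 0"
proof -
  note simps = lin_diff [OF lin_free_act_left] lin_add [OF lin_free_act_left] free_act_mono
    sgen_act_C sgen_act_S lin_scale [OF lin_sgen_act] list_parity_take_update nth_list_update
  note [simp del] = sgen_act.simps
  consider
    (cc) i where "i \<in> {1..r}" "x = mono [C i, C i] - mono []"
  | (cc') i j where "i \<in> {1..r}" "j \<in> {1..r}" "i \<noteq> j" "x = mono [C i, C j] + mono [C j, C i]"
  | (ss) i where "i \<in> {1..<r}" "x = mono [S i, S i] - mono []"
  | (braid) i where "i \<in> {1..<r}" "i + 1 \<in> {1..<r}"
      "x = mono [S i, S (i + 1), S i] - mono [S (i + 1), S i, S (i + 1)]"
  | (ss') i j where "i \<in> {1..<r}" "j \<in> {1..<r}" "i + 1 < j \<or> j + 1 < i"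
      "x = mono [S i, S j] - mono [S j, S i]"
  | (cs) i where "i \<in> {1..<r}" "x = mono [C i, S i] - mono [S i, C (i + 1)]"
  | (cs') i where "i \<in> {1..<r}" "x = mono [C (i + 1), S i] - mono [S i, C i]"
  | (far) i j where "i \<in> {1..<r}" "j \<in> {1..r}" "j \<noteq> i" "j \<noteq> i + 1"
      "x = mono [C j, S i] - mono [S i, C j]"
    using assms(1) unfolding sergeev_rels_def mono_Nil by blast
  then show ?thesis
  proof cases
    case cc
    have flip: "w[t := (fst (w ! t), b)] = w" if "snd (w ! t) = b" for t b
      using that list_update_id [of w t] by (cases "w ! t") auto
    show ?thesis using cc assms(2) by (auto simp: simps ksign_def flip)
  next
    case cc'
    then have ij: "i - Suc 0 < length w" "j - Suc 0 < length w" "i - Suc 0 \<noteq> j - Suc 0"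
        "1 \<le> i" "i \<le> length w" "1 \<le> j" "j \<le> length w"
      using assms(2) by auto
    have lists: "w[j - Suc 0 := a, i - Suc 0 := b] = w[i - Suc 0 := b, j - Suc 0 := a]" for a b
      using ij by (metis list_update_swap)
    from ij cc'(4) show ?thesis
      by (cases "i < j") (simp_all add: simps lists ksign_def flip: fvs.scale_left_distrib)
  next
    case ss
    then show ?thesis using assms(2) by (auto simp: simps ksign_def; intro nth_equalityI; auto simp: nth_list_update)
  next
    case braid
    then have i: "i \<noteq> i - Suc 0" "i - Suc 0 \<noteq> Suc i" "i - Suc 0 < length w" "i < length w" "Suc i < length w"
      using assms(2) by auto
    have lists: "w[i - Suc 0 := w ! i, i := w ! Suc i, Suc i := w ! (i - Suc 0), i - Suc 0 := w ! Suc i, i := w ! i]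
      = w[i - Suc 0 := w ! Suc i, Suc i := w ! (i - Suc 0)]"
      "w[i := w ! Suc i, Suc i := w ! i, i - Suc 0 := w ! Suc i, i := w ! i, Suc i := w ! (i - Suc 0)]
      = w[i - Suc 0 := w ! Suc i, Suc i := w ! (i - Suc 0)]"
      using i by (auto intro!: nth_equalityI simp: nth_list_update)
    let ?a = "snd (w ! (i - Suc 0))" and ?b = "snd (w ! i)" and ?c = "snd (w ! Suc i)"
    have "foldr sgen_act [S i, S (i + 1), S i] (mono w) = fscale
        (ksign (?a \<and> ?b) * (ksign (?a \<and> ?c) * ksign (?b \<and> ?c)))
        (mono (w[i - Suc 0 := w ! Suc i, Suc i := w ! (i - Suc 0)]))"
      using i by (simp add: sgen_act_S lin_scale [OF lin_sgen_act] nth_list_update lists mult.assoc)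
    moreover have "foldr sgen_act [S (i + 1), S i, S (i + 1)] (mono w) = fscale
        (ksign (?b \<and> ?c) * (ksign (?a \<and> ?c) * ksign (?a \<and> ?b)))
        (mono (w[i - Suc 0 := w ! Suc i, Suc i := w ! (i - Suc 0)]))"
      using i by (simp add: sgen_act_S lin_scale [OF lin_sgen_act] nth_list_update lists mult.assoc)
    ultimately show ?thesis
      unfolding braid(3) lin_diff [OF lin_free_act_left] free_act_mono by (simp add: mult_ac)
  next
    case ss'
    then have ij: "i - Suc 0 < length w" "i < length w" "j - Suc 0 < length w" "j < length w"
        "i - Suc 0 \<noteq> j - Suc 0" "i - Suc 0 \<noteq> j" "i \<noteq> j - Suc 0" "i \<noteq> j"
      using assms(2) by auto
    have "w[j - Suc 0 := w ! j, j := w ! (j - Suc 0), i - Suc 0 := w ! i, i := w ! (i - Suc 0)]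
      = w[i - Suc 0 := w ! i, i := w ! (i - Suc 0), j - Suc 0 := w ! j, j := w ! (j - Suc 0)]"
      using ij by (metis list_update_swap)
    with ij ss'(4) show ?thesis by (simp add: simps mult.commute)
  next
    case cs
    then have i: "i - Suc 0 < length w" "i < length w" "i - Suc 0 < i" "1 \<le> i" "i \<le> length w"
      using assms(2) by auto
    have par: "list_parity snd (take i w) = (list_parity snd (take (i - Suc 0) w) \<noteq> snd (w ! (i - Suc 0)))"
      using i by (cases i) (auto simp: take_Suc_conv_app_nth)
    have "w[i - Suc 0 := a, i := b, i - Suc 0 := z] = w[i - Suc 0 := z, i := b]"
      "w[i := z, i - Suc 0 := a, i := b] = w[i - Suc 0 := a, i := b]" for a b z
      using i by (auto intro!: nth_equalityI simp: nth_list_update)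
    with i cs(2) show ?thesis
      by (simp add: simps par) (simp add: ksign_def)
  next
    case cs'
    then have i: "i - Suc 0 < length w" "i < length w" "i - Suc 0 < i" "1 \<le> i" "i \<le> length w"
      using assms(2) by auto
    have par: "list_parity snd (take i w) = (list_parity snd (take (i - Suc 0) w) \<noteq> snd (w ! (i - Suc 0)))"
      using i by (cases i) (auto simp: take_Suc_conv_app_nth)
    have "w[i - Suc 0 := z, i - Suc 0 := a, i := b] = w[i - Suc 0 := a, i := b]"
      "w[i - Suc 0 := a, i := b, i := z] = w[i - Suc 0 := a, i := z]" for a b z
      using i by (auto intro!: nth_equalityI simp: nth_list_update)
    with i cs'(2) show ?thesis
      by (simp add: simps par) (simp add: ksign_def)
  next
    case far
    then have ij: "i - Suc 0 < length w" "i < length w" "j - Suc 0 < length w" "1 \<le> j" "j \<le> length w"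
        "i - Suc 0 \<noteq> j - Suc 0" "i \<noteq> j - Suc 0" "i - Suc 0 < j - Suc 0 \<longleftrightarrow> i < j - Suc 0"
      using assms(2) by auto
    have "w[i - Suc 0 := w ! i, i := w ! (i - Suc 0), j - Suc 0 := z]
      = w[j - Suc 0 := z, i - Suc 0 := w ! i, i := w ! (i - Suc 0)]" for z
      using ij by (metis list_update_swap)
    with ij far(5) show ?thesis
      by (simp add: simps)
        (cases "i < j - Suc 0"; cases "snd (w ! i)"; cases "snd (w ! (i - Suc 0))"; simp add: ksign_def)
  qed
qed

lemma free_act_homogeneous:
  assumes "x \<in> carrier (free_superalg (sgens r) sgen_odd)" "v \<in> words_span {w. length w = r}"
  shows "free_act x v \<in> words_span {w. length w = r}"
proof (rule lin_maps_words_span [OF lin_free_act_left _ assms(1) [unfolded carrier_free_superalg]])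
  fix w assume "w \<in> {w. set w \<subseteq> sgens r}"
  then show "free_act (mono w) v \<in> words_span {w. length w = r}"
    using assms(2) unfolding free_act_mono by (induction w) (auto intro: sgen_act_homogeneous)
qed

lemma presentation_sergeev: "presentation (sgens r) sgen_odd (sergeev_rels r)"
proof
  show "sergeev_rels r \<subseteq> carrier (free_superalg (sgens r) sgen_odd)"
    unfolding carrier_free_superalg
    by (auto simp: sergeev_rels_def sgens_def words_span_lookup lookup_add lookup_minus lookup_mono
        simp flip: mono_Nil)
qed

text \<open>The elements that act by zero on all words of length \<open>r\<close> form an ideal which contains the relators.\<close>

lemma sergeev_ideal_acts_zero:
  assumes "x \<in> rel_ideal (sgens r) sgen_odd (sergeev_rels r)" "v \<in> words_span {w. length w = r}"
  shows "free_act x v = 0"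
proof -
  let ?F = "free_superalg (sgens r) sgen_odd"
  let ?N = "{x \<in> carrier ?F. \<forall>v\<in>words_span {w. length w = r}. free_act x v = 0}"
  interpret F: ring ?F by (rule ring_free_superalg)
  have neg: "\<ominus>\<^bsub>?F\<^esub> y = - y" if "y \<in> carrier ?F" for y
  proof (rule F.minus_equality)
    show "- y \<in> carrier ?F" using that by (simp add: free_superalg_def)
  qed (use that in \<open>auto simp: free_superalg_def\<close>)
  have ops: "x \<otimes>\<^bsub>?F\<^esub> y = x * y" "x \<oplus>\<^bsub>?F\<^esub> y = x + y" "\<zero>\<^bsub>?F\<^esub> = 0" for x y
    by (simp_all add: free_superalg_def)
  have "ideal ?N ?F"
  proof (rule idealI [OF ring_free_superalg])
    show "subgroup ?N (add_monoid ?F)"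
    proof (rule F.add.subgroupI)
      show "?N \<noteq> {}"
        using F.zero_closed by (auto simp: ops intro!: exI [of _ 0] lin_zero [OF lin_free_act_left])
      have neg_act: "free_act (- y) v = - free_act y v" for y v
        using lin_diff [OF lin_free_act_left, of 0 y v] by (simp add: lin_zero [OF lin_free_act_left])
      show "\<ominus>\<^bsub>?F\<^esub> y \<in> ?N" if "y \<in> ?N" for y
        using that F.a_inv_closed [of y]
        by (auto simp: neg neg_act
            lin_zero [OF lin_free_act_left])
      show "a \<oplus>\<^bsub>?F\<^esub> b \<in> ?N" if "a \<in> ?N" "b \<in> ?N" for a b
        using that F.add.m_closed [of a b] by (auto simp: ops lin_add [OF lin_free_act_left])
    qed auto
    show "b \<otimes>\<^bsub>?F\<^esub> a \<in> ?N" if "a \<in> ?N" "b \<in> carrier ?F" for a b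
      using that F.m_closed [of b a] by (auto simp: ops free_act_mult lin_zero [OF lin_free_act])
    show "a \<otimes>\<^bsub>?F\<^esub> b \<in> ?N" if "a \<in> ?N" "b \<in> carrier ?F" for a b
      using that F.m_closed [of a b] by (auto simp: ops free_act_mult free_act_homogeneous)
  qed
  moreover have "sergeev_rels r \<subseteq> ?N"
  proof
    fix x assume x: "x \<in> sergeev_rels r"
    have "free_act x v = 0" if "v \<in> words_span {w. length w = r}" for v
      using lin_eqI [OF lin_free_act, of "\<lambda>_. 0" v x] sergeev_relators_act_zero [OF x] that
      by (force simp: words_span_def intro: linI)
    then show "x \<in> ?N" using x presentation.relators [OF presentation_sergeev] by auto
  qed
  ultimately have "rel_ideal (sgens r) sgen_odd (sergeev_rels r) \<subseteq> ?N"
    unfolding rel_ideal_def by (rule F.genideal_minimal)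
  then show ?thesis using assms by auto
qed

text \<open>The action of a class is defined by an arbitrary representative, and two representatives differ by an
  element that acts by zero.\<close>

lemma sergeev_act_class:
  assumes "v \<in> words_span {w. length w = r}"
  shows "sergeev_act (sergeev_class r x) v = free_act x v"
proof -
  interpret presentation "sgens r" sgen_odd "sergeev_rels r" by (rule presentation_sergeev)
  have "(SOME x'. x' \<in> cl x) - x \<in> rel_ideal (sgens r) sgen_odd (sergeev_rels r)"
    by (rule cl_memD, rule someI) (rule cl_self)
  from sergeev_ideal_acts_zero [OF this assms] show ?thesis
    by (simp add: sergeev_act_def sergeev_class_def lin_diff [OF lin_free_act_left])
qed

lemma sergeev_generator_class:
  assumes "g \<in> sgens r"
  shows "sergeev_class r (mono [g]) \<in> hom_part (sergeev r) (sgen_odd g)"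
  using assms unfolding sergeev_def presented_def sergeev_class_def Let_def
  by (auto simp: free_superalg_def homog_def intro!: imageI)

lemma sergeev_act_generator:
  assumes "v \<in> words_span {w. length w = r}"
  shows "sergeev_act (sergeev_class r (mono [g])) v = sgen_act g v"
  using sergeev_act_class [OF assms] by (simp add: free_act_mono)

section \<open>Operators on words\<close>

abbreviation cnt :: "nat \<Rightarrow> vidx list \<Rightarrow> nat"
  where "cnt k w \<equiv> length (filter (\<lambda>i. fst i = k) w)"

text \<open>The content is a function on all labels. In this form merging two strands is a formula without
  bounds (see \<open>merge_cont\<close> below), and the zeros that pad a composition do not appear.\<close>

definition content_words :: "nat \<Rightarrow> (nat \<Rightarrow> nat) \<Rightarrow> vidx list set"
  where "content_words r c = {w. length w = r \<and> (\<forall>k. cnt k w = c k)}"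

definition cont :: "nat list \<Rightarrow> nat \<Rightarrow> nat"
  where "cont a k = (if 1 \<le> k \<and> k \<le> length a then a ! (k - 1) else 0)"

abbreviation words :: "nat \<Rightarrow> nat list \<Rightarrow> vidx list set"
  where "words r a \<equiv> content_words r (cont a)"

definition relabel :: "(nat \<Rightarrow> nat) \<Rightarrow> vidx list \<Rightarrow> vidx list"
  where "relabel \<rho> w = map (apfst \<rho>) w"

lemma length_relabel [simp]: "length (relabel \<rho> w) = length w"
  by (simp add: relabel_def)

lemma relabel_nth [simp]: "t < length w \<Longrightarrow> relabel \<rho> w ! t = (\<rho> (fst (w ! t)), snd (w ! t))"
  by (simp add: relabel_def apfst_def map_prod_def case_prod_beta)

lemma relabel_relabel: "relabel \<rho> (relabel \<rho>' w) = relabel (\<rho> \<circ> \<rho>') w"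
  by (simp add: relabel_def apfst_def map_prod_def case_prod_beta)

lemma relabel_cong: "(\<And>k. k \<in> fst ` set w \<Longrightarrow> \<rho> k = \<rho>' k) \<Longrightarrow> relabel \<rho> w = relabel \<rho>' w"
  by (force simp: relabel_def apfst_def map_prod_def)

lemma cnt_relabel: "cnt k (relabel \<rho> w) = length (filter (\<lambda>i. \<rho> (fst i) = k) w)"
  by (simp add: relabel_def filter_map comp_def)

lemma cnt_eq_0: "cnt k w = 0 \<longleftrightarrow> k \<notin> fst ` set w"
  by (auto simp: filter_empty_conv)

lemma length_le_sum_list: "\<forall>k\<in>set a. 0 < k \<Longrightarrow> length a \<le> sum_list a"
  by (induction a) auto

lemma length_hat: "a \<in> Acomp r \<Longrightarrow> length (hat r a) = r"
  using length_le_sum_list [of a] by (auto simp: Acomp_def hat_def)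

text \<open>The contents of a composition of \<open>r\<close> add up to \<open>r\<close>, so prescribing them for all labels also bounds
  the labels.\<close>

lemma Mperm_eq: "a \<in> Acomp r \<Longrightarrow> Mperm r (hat r a) = words_span (words r a)"
proof -
  assume a: "a \<in> Acomp r"
  have le: "length a \<le> r" using a length_le_sum_list [of a] by (auto simp: Acomp_def)
  have hat: "hat r a ! (k - 1) = cont a k" if "k \<in> {1..r}" for k
    using that le by (auto simp: hat_def cont_def nth_append)
  have "length w = r \<and> fst ` set w \<subseteq> {1..r} \<and> (\<forall>k\<in>{1..r}. cnt k w = hat r a ! (k - 1))
     \<longleftrightarrow> w \<in> words r a" for w
  proof -
    have "fst ` set w \<subseteq> {1..r}" if "\<forall>k. cnt k w = cont a k"
    proof
      fix k assume "k \<in> fst ` set w"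
      with that have "cont a k \<noteq> 0" using cnt_eq_0 by metis
      then show "k \<in> {1..r}" using le by (auto simp: cont_def split: if_splits)
    qed
    moreover have "cnt k w = cont a k" if "k \<notin> {1..r}" "fst ` set w \<subseteq> {1..r}" for k
    proof -
      have "cnt k w = 0" using that cnt_eq_0 by blast
      then show ?thesis using that le by (auto simp: cont_def)
    qed
    ultimately show ?thesis using hat unfolding content_words_def by auto
  qed
  then have "{mono w | w. length w = r \<and> fst ` set w \<subseteq> {1..r} \<and>
      (\<forall>k\<in>{1..r}. cnt k w = hat r a ! (k - 1))} = mono ` words r a"
    by blast
  then show ?thesis unfolding Mperm_def by (simp add: fspan_mono)
qed

lemma lin_proj: "lin (proj A)"
  by (simp add: proj_def lin_lin_ext)

lemma proj_mono: "proj (words_span A) (mono w) = (if w \<in> A then mono w else 0)"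
  by (simp add: proj_def)

section \<open>Divided powers\<close>

definition move :: "nat \<Rightarrow> nat \<Rightarrow> vidx fa \<Rightarrow> vidx fa"
  where "move m n = leibniz False (\<lambda>(k, b). if k = m then mono [(n, b)] else 0)"

lemma e_op_eq: "e_op i = move (Suc i) i"
  by (simp add: e_op_def move_def)

lemma f_op_eq: "f_op i = move i (Suc i)"
  by (simp only: f_op_def move_def Suc_eq_plus1)

lemma lin_move: "lin (move m n)"
  by (simp add: move_def leibniz_def lin_lin_ext)

lemma lin_funpow: "lin (f :: vidx fa \<Rightarrow> vidx fa) \<Longrightarrow> lin (f ^^ p)"
proof (induction p)
  case 0
  show ?case by (auto intro: linI)
next
  case (Suc p)
  then show ?case by (metis funpow.simps(2) lin_comp)
qed

lemma lin_divpow: "lin f \<Longrightarrow> lin (divpow f p)"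
  by (rule linI) (simp_all add: divpow_def op_scale_def lin_add [OF lin_funpow]
      lin_scale [OF lin_funpow] fvs.scale_right_distrib mult.commute)

definition positions :: "nat \<Rightarrow> vidx list \<Rightarrow> nat set"
  where "positions m w = {t. t < length w \<and> fst (w ! t) = m}"

lemma card_positions: "card (positions m w) = cnt m w"
  by (simp add: positions_def length_filter_conv_card)

lemma finite_positions [simp]: "finite (positions m w)"
  by (simp add: positions_def)

text \<open>A divided power of \<open>e\<^sub>i\<close> or \<open>f\<^sub>i\<close> changes the labels at a chosen set of positions and keeps all bars;
  no signs arise, as these operators are even.\<close>

definition relabel_at :: "nat set \<Rightarrow> nat \<Rightarrow> vidx list \<Rightarrow> vidx list"
  where "relabel_at A n w = map (\<lambda>t. if t \<in> A then (n, snd (w ! t)) else w ! t) [0..<length w]"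

lemma length_relabel_at [simp]: "length (relabel_at A n w) = length w"
  by (simp add: relabel_at_def)

lemma relabel_at_nth [simp]:
  "t < length w \<Longrightarrow> relabel_at A n w ! t = (if t \<in> A then (n, snd (w ! t)) else w ! t)"
  by (simp add: relabel_at_def)

lemma move_mono: "move m n (mono w) = (\<Sum>t\<in>positions m w. mono (relabel_at {t} n w))"
proof -
  let ?X = "\<lambda>(k, b). if k = m then mono [(n, b)] else 0 :: vidx fa"
  have "move m n (mono w) = (\<Sum>t<length w. apply_at False t ?X w)"
    by (simp add: move_def leibniz_def)
  also have "\<dots> = (\<Sum>t\<in>positions m w. apply_at False t ?X w)"
    by (rule sum.mono_neutral_right)
      (auto simp: positions_def apply_at_def case_prod_beta)
  also have "\<dots> = (\<Sum>t\<in>positions m w. mono (relabel_at {t} n w))"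
  proof (rule sum.cong)
    fix t assume t: "t \<in> positions m w"
    have "apply_at False t ?X w = fscale (ksign False * 1) (mono (w[t := (n, snd (w ! t))]))"
      using t apply_at_mono [of t w ?X 1 "(n, snd (w ! t))" False]
      by (simp add: positions_def case_prod_beta)
    moreover have "w[t := (n, snd (w ! t))] = relabel_at {t} n w"
      using t by (auto intro!: nth_equalityI simp: nth_list_update positions_def)
    ultimately show "apply_at False t ?X w = mono (relabel_at {t} n w)"
      by (simp add: ksign_def)
  qed simp
  finally show ?thesis .
qed

lemma fscale_of_nat: "fscale (of_nat n) x = of_nat n * x"
  by (simp add: fscale_def)

text \<open>Double counting: a set with \<open>Suc p\<close> elements is obtained by inserting any one of its elements into
  the rest.\<close>

lemma sum_insert_subsets:
  fixes g :: "'b set \<Rightarrow> 'g fa"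
  assumes "finite P"
  shows "(\<Sum>A\<in>{A. A \<subseteq> P \<and> card A = p}. \<Sum>t\<in>P - A. g (insert t A))
    = fscale (of_nat (Suc p)) (\<Sum>B\<in>{B. B \<subseteq> P \<and> card B = Suc p}. g B)"
proof -
  have fin: "finite {A. A \<subseteq> P \<and> card A = q}" for q
    using assms by simp
  have finP: "finite A" if "A \<subseteq> P" for A
    using that assms finite_subset by blast
  have "(\<Sum>A\<in>{A. A \<subseteq> P \<and> card A = p}. \<Sum>t\<in>P - A. g (insert t A))
    = (\<Sum>(A, t)\<in>Sigma {A. A \<subseteq> P \<and> card A = p} (\<lambda>A. P - A). g (insert t A))"
    using assms by (intro sum.Sigma) auto
  also have "\<dots> = (\<Sum>(B, t)\<in>Sigma {B. B \<subseteq> P \<and> card B = Suc p} (\<lambda>B. B). g B)"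
    by (rule sum.reindex_bij_witness [where i = "\<lambda>(B, t). (B - {t}, t)" and j = "\<lambda>(A, t). (insert t A, t)"])
      (auto simp: finP insert_absorb)
  also have "\<dots> = (\<Sum>B\<in>{B. B \<subseteq> P \<and> card B = Suc p}. \<Sum>t\<in>B. g B)"
    using assms finP by (intro sum.Sigma [symmetric]) auto
  also have "\<dots> = (\<Sum>B\<in>{B. B \<subseteq> P \<and> card B = Suc p}. fscale (of_nat (Suc p)) (g B))"
    by (rule sum.cong) (auto simp: fscale_of_nat simp del: of_nat_Suc)
  finally show ?thesis by (simp add: fvs.scale_sum_right)
qed

text \<open>The \<open>p\<close>-th power moves \<open>p\<close> different positions one after the other. The \<open>fact p\<close> orders in which the
  positions of a given set can be moved lead to the same word, and the divided power removes this factor.\<close>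

lemma divpow_move_mono:
  assumes "m \<noteq> n"
  shows "divpow (move m n) p (mono w)
    = (\<Sum>A\<in>{A. A \<subseteq> positions m w \<and> card A = p}. mono (relabel_at A n w))"
proof -
  have step: "move m n (mono (relabel_at A n w))
      = (\<Sum>t\<in>positions m w - A. mono (relabel_at (insert t A) n w))" if "A \<subseteq> positions m w" for A
  proof -
    have "positions m (relabel_at A n w) = positions m w - A"
      using assms by (auto simp: positions_def split: if_splits)
    moreover have "relabel_at {t} n (relabel_at A n w) = relabel_at (insert t A) n w" for t
      by (auto intro!: nth_equalityI)
    ultimately show ?thesis by (simp add: move_mono)
  qed
  have "(move m n ^^ p) (mono w)
    = fscale (fact p) (\<Sum>A\<in>{A. A \<subseteq> positions m w \<and> card A = p}. mono (relabel_at A n w))"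
  proof (induction p)
    case 0
    have "{A. A \<subseteq> positions m w \<and> card A = 0} = {{}}"
      by (auto dest: finite_subset)
    moreover have "relabel_at {} n w = w" by (auto intro!: nth_equalityI)
    ultimately show ?case by simp
  next
    case (Suc p)
    have "(\<Sum>A\<in>{A. A \<subseteq> positions m w \<and> card A = p}. move m n (mono (relabel_at A n w)))
      = (\<Sum>A\<in>{A. A \<subseteq> positions m w \<and> card A = p}.
          \<Sum>t\<in>positions m w - A. mono (relabel_at (insert t A) n w))"
      using step by (intro sum.cong) auto
    with Suc show ?case
      by (simp add: lin_scale [OF lin_move] lin_sum [OF lin_move]
          sum_insert_subsets [where g = "\<lambda>A. mono (relabel_at A n w)"] mult.commute del: of_nat_Suc)
  qed
  then show ?thesis by (simp add: divpow_def op_scale_def)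
qed

lemma divpow_move_all:
  assumes "m \<noteq> n" "cnt m w = p"
  shows "divpow (move m n) p (mono w) = mono (relabel (\<lambda>k. if k = m then n else k) w)"
proof -
  have "{A. A \<subseteq> positions m w \<and> card A = p} = {positions m w}"
    using assms(2) card_subset_eq [OF finite_positions] by (auto simp: card_positions)
  moreover have "relabel_at (positions m w) n w = relabel (\<lambda>k. if k = m then n else k) w"
    by (auto intro!: nth_equalityI simp: positions_def)
  ultimately show ?thesis by (simp add: divpow_move_mono [OF assms(1)])
qed

section \<open>Merges and splits\<close>

definition merge_labels :: "nat \<Rightarrow> nat \<Rightarrow> nat"
  where "merge_labels i k = (if k \<le> i then k else k - 1)"

definition merge_cont :: "nat \<Rightarrow> (nat \<Rightarrow> nat) \<Rightarrow> nat \<Rightarrow> nat"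
  where "merge_cont i c k = (if k < i then c k else if k = i then c i + c (Suc i) else c (Suc k))"

lemma cnt_merge_labels:
  assumes "0 < i"
  shows "cnt k (relabel (merge_labels i) w) = merge_cont i (\<lambda>k. cnt k w) k"
proof -
  have "(merge_labels i l = k) = (if k < i then l = k else if k = i then l = i \<or> l = Suc i else l = Suc k)" for l
    using assms by (auto simp: merge_labels_def)
  moreover have "length (filter (\<lambda>x. fst x = i \<or> fst x = Suc i) w) = cnt i w + cnt (Suc i) w"
    by (induction w) auto
  ultimately show ?thesis by (simp add: cnt_relabel merge_cont_def)
qed

text \<open>Merging loses information on the two merged strands only, and the content of one of them is recovered
  from the sum and the other one.\<close>

lemma merge_cont_inj:
  assumes "merge_cont i c = merge_cont i d" "c (Suc i) = d (Suc i)"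
  shows "c = d"
proof
  fix k
  consider "k < i" | "k = i" | "k = Suc i" | l where "k = Suc l" "i < l"
    by (metis Suc_lessE linorder_neqE_nat not_less_eq)
  then show "c k = d k"
  proof cases
    case 1
    then show ?thesis using fun_cong [OF assms(1), of k] by (simp add: merge_cont_def)
  next
    case 2
    then show ?thesis using fun_cong [OF assms(1), of i] assms(2) by (simp add: merge_cont_def)
  next
    case 3
    then show ?thesis using assms(2) by simp
  next
    case 4
    then show ?thesis using fun_cong [OF assms(1), of l] by (simp add: merge_cont_def)
  qed
qed

lemma merge_labels_content:
  assumes "0 < i" "w \<in> content_words r c"
  shows "relabel (merge_labels i) w \<in> content_words r (merge_cont i c)"
  using assms(2) by (simp add: content_words_def cnt_merge_labels [OF assms(1)] merge_cont_def)

text \<open>When its turn comes, \<open>e\<^sub>j\<close> is raised to the number of letters with label \<open>Suc j\<close>, so all of them are moved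
  to the label \<open>j\<close>. For \<open>j > i\<close> the preceding factor has emptied this label, and for \<open>j = i\<close> this is the merge.\<close>

lemma fold_e_mono:
  assumes "i \<le> m" "F (mono w) = mono w" "\<And>k. i < k \<Longrightarrow> k \<le> m \<Longrightarrow> c (k - 1) = cnt k w"
  shows "fold (\<lambda>j F. divpow (e_op j) (c j) \<circ> F) [i..<m] F (mono w)
    = mono (relabel (\<lambda>k. if i < k \<and> k \<le> m then k - 1 else k) w)"
  using assms
proof (induction m rule: dec_induct)
  case base
  have "relabel (\<lambda>k. if i < k \<and> k \<le> i then k - 1 else k) w = w"
    by (auto intro!: nth_equalityI)
  with base show ?case by simp
next
  case (step m)
  let ?w = "relabel (\<lambda>k. if i < k \<and> k \<le> m then k - 1 else k) w"
  have "cnt (Suc m) ?w = c m"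
    unfolding cnt_relabel using step.hyps step.prems(2) [of "Suc m"]
    by (auto intro!: arg_cong [of _ _ length] filter_cong)
  moreover have "relabel (\<lambda>k. if k = Suc m then m else k) ?w
      = relabel (\<lambda>k. if i < k \<and> k \<le> Suc m then k - 1 else k) w"
    unfolding relabel_relabel using step.hyps by (intro relabel_cong) auto
  ultimately show ?case
    using step by (simp add: e_op_eq divpow_move_all)
qed

lemma merge_op_mono:
  assumes "a \<in> Acomp r" "w \<in> words r a" "0 < i" "i < r"
  shows "merge_op r a i (mono w) = mono (relabel (merge_labels i) w)"
proof -
  have len: "length a \<le> r" using assms(1) length_le_sum_list [of a] by (auto simp: Acomp_def)
  have "hat r a ! (k - 1) = cnt k w" if "i < k" "k \<le> r" for k
    using that assms(2) len by (auto simp: hat_def nth_append content_words_def cont_def)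
  moreover have "proj_comp r a (mono w) = mono w"
    using assms(1,2) by (simp add: Mperm_eq proj_mono)
  moreover have "relabel (\<lambda>k. if i < k \<and> k \<le> r then k - 1 else k) w = relabel (merge_labels i) w"
  proof (rule relabel_cong)
    fix k assume "k \<in> fst ` set w"
    then have "cont a k \<noteq> 0"
      using assms(2) cnt_eq_0 unfolding content_words_def by (metis (mono_tags, lifting) mem_Collect_eq)
    then show "(if i < k \<and> k \<le> r then k - 1 else k) = merge_labels i k"
      using len by (auto simp: cont_def merge_labels_def split: if_splits)
  qed
  ultimately show ?thesis
    using fold_e_mono [of i r "proj_comp r a" w "\<lambda>j. hat r a ! j"] assms(4)
    by (simp add: merge_op_def)
qed

text \<open>When its turn comes, \<open>f\<^sub>j\<close> is raised to the number of letters with label \<open>j\<close>, so all of them are moved up,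
  and the label \<open>j\<close> becomes free for the next factor.\<close>

lemma foldr_f_mono:
  assumes "m \<le> r" "F (mono w) = mono w" "\<And>k. m \<le> k \<Longrightarrow> k < r \<Longrightarrow> c k = cnt k w"
    "\<And>k. k \<in> fst ` set w \<Longrightarrow> k < r"
  shows "foldr (\<lambda>j F. divpow (f_op j) (c j) \<circ> F) [m..<r] F (mono w)
    = mono (relabel (\<lambda>k. if m \<le> k then Suc k else k) w)"
  using assms
proof (induction m rule: inc_induct)
  case base
  have "relabel (\<lambda>k. if r \<le> k then Suc k else k) w = w"
    using base.prems(3) by (force intro!: nth_equalityI dest: nth_mem simp: not_le)
  with base show ?case by simp
next
  case (step m)
  let ?w = "relabel (\<lambda>k. if Suc m \<le> k then Suc k else k) w"
  have "cnt m ?w = c m"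
    unfolding cnt_relabel using step.hyps step.prems(2) [of m]
    by (auto intro!: arg_cong [of _ _ length] filter_cong)
  moreover have "relabel (\<lambda>k. if k = m then Suc m else k) ?w
      = relabel (\<lambda>k. if m \<le> k then Suc k else k) w"
    unfolding relabel_relabel by (intro relabel_cong) auto
  ultimately show ?case
    using step by (simp add: f_op_eq divpow_move_all upt_conv_Cons)
qed

text \<open>Let \<open>u\<close> be \<open>w\<close> with the labels after \<open>i\<close> moved up by one. A word in the fibre of the merging map over \<open>w\<close>
  is \<open>u\<close> with some of its labels \<open>i\<close> raised, and it is determined by the positions which it labels \<open>Suc i\<close>.\<close>

lemma sum_subsets_eq_fibre:
  assumes "0 < i" "w \<in> content_words r (merge_cont i c)"
  defines "u \<equiv> relabel (\<lambda>k. if Suc i \<le> k then Suc k else k) w"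
  shows "(\<Sum>A\<in>{A. A \<subseteq> positions i u \<and> card A = c (Suc i)}. mono (relabel_at A (Suc i) u))
    = (\<Sum>w'\<in>{w' \<in> content_words r c. relabel (merge_labels i) w' = w}. mono w')"
proof (rule sum.reindex_bij_witness [where j = "\<lambda>A. relabel_at A (Suc i) u" and i = "positions (Suc i)"])
  have len: "length w = r" "length u = r"
    using assms(2) by (simp_all add: content_words_def u_def)
  fix A assume A: "A \<in> {A. A \<subseteq> positions i u \<and> card A = c (Suc i)}"
  let ?v = "relabel_at A (Suc i) u"
  have Aw: "t < r \<and> fst (w ! t) = i" if "t \<in> A" for t
  proof -
    have "t < r" "fst (u ! t) = i" using that A len by (auto simp: positions_def)
    then show ?thesis using len by (simp add: u_def split: if_splits)
  qed
  show pos: "positions (Suc i) ?v = A"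
    using Aw len by (auto simp: positions_def u_def split: if_splits)
  have w: "relabel (merge_labels i) ?v = w"
    using Aw len by (auto intro!: nth_equalityI simp: u_def merge_labels_def prod_eq_iff)
  have "(\<lambda>k. cnt k ?v) = c"
  proof (rule merge_cont_inj)
    show "merge_cont i (\<lambda>k. cnt k ?v) = merge_cont i c"
      using cnt_merge_labels [OF assms(1), of _ ?v] assms(2) w by (auto simp: content_words_def)
    show "cnt (Suc i) ?v = c (Suc i)" using pos A by (simp flip: card_positions)
  qed
  then have "cnt k ?v = c k" for k by (rule fun_cong)
  then show "?v \<in> {w' \<in> content_words r c. relabel (merge_labels i) w' = w}"
    using w len by (simp add: content_words_def)
next
  fix w' assume w': "w' \<in> {w' \<in> content_words r c. relabel (merge_labels i) w' = w}"
  then have w: "w = relabel (merge_labels i) w'" by simp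
  show "relabel_at (positions (Suc i) w') (Suc i) u = w'"
    by (auto intro!: nth_equalityI simp: u_def w positions_def merge_labels_def prod_eq_iff)
  have "positions (Suc i) w' \<subseteq> positions i u"
    by (auto simp: u_def w positions_def merge_labels_def)
  then show "positions (Suc i) w' \<in> {A. A \<subseteq> positions i u \<and> card A = c (Suc i)}"
    using w' by (simp add: card_positions content_words_def)
qed simp

text \<open>The factors applied first vacate the label \<open>Suc i\<close>, and the last one distributes the letters with label \<open>i\<close>
  to both strands in all possible ways. This is the sum over the fibre of the corresponding merge.\<close>

lemma split_op_mono:
  assumes "a \<in> Acomp r" "b \<in> Acomp r" "cont b = merge_cont i (cont a)" "w \<in> words r b"
    and "0 < i" "i < length a"
  shows "split_op r a b i (mono w)
    = (\<Sum>w'\<in>{w' \<in> words r a. relabel (merge_labels i) w' = w}. mono w')"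
proof -
  have len: "length a \<le> r" using assms(1) length_le_sum_list [of a] by (auto simp: Acomp_def)
  let ?u = "relabel (\<lambda>k. if Suc i \<le> k then Suc k else k) w"
  have cnt: "cnt k w = merge_cont i (cont a) k" for k
    using assms(3,4) by (simp add: content_words_def)
  have "foldr (\<lambda>j F. divpow (f_op j) (hat r a ! j) \<circ> F) [Suc i..<r] (proj_comp r b) (mono w) = mono ?u"
  proof (rule foldr_f_mono)
    show "proj_comp r b (mono w) = mono w"
      using assms(2,4) by (simp add: Mperm_eq proj_mono)
    show "hat r a ! k = cnt k w" if "Suc i \<le> k" "k < r" for k
      using that len by (auto simp: cnt merge_cont_def cont_def hat_def nth_append)
    show "k < r" if "k \<in> fst ` set w" for k
    proof -
      have "merge_cont i (cont a) k \<noteq> 0" using that cnt cnt_eq_0 by metis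
      then show ?thesis using len assms(6) by (auto simp: merge_cont_def cont_def split: if_splits)
    qed
  qed (use len assms(6) in simp)
  moreover have "hat r a ! i = cont a (Suc i)"
    using assms(6) by (simp add: hat_def cont_def nth_append)
  moreover have "[i..<r] = i # [Suc i..<r]"
    using assms(6) len by (simp add: upt_conv_Cons)
  ultimately have "split_op r a b i (mono w) = (\<Sum>A\<in>{A. A \<subseteq> positions i ?u \<and> card A = cont a (Suc i)}.
      mono (relabel_at A (Suc i) ?u))"
    by (simp add: split_op_def f_op_eq divpow_move_mono)
  also have "\<dots> = (\<Sum>w'\<in>{w' \<in> words r a. relabel (merge_labels i) w' = w}. mono w')"
    using sum_subsets_eq_fibre [of i w r "cont a"] assms(3-5) by simp
  finally show ?thesis .
qed

section \<open>Dots\<close>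

lemma hbar_op_mono:
  assumes "t < length w" "\<And>s. s < length w \<Longrightarrow> fst (w ! s) = j \<longleftrightarrow> s = t"
  shows "hbar_op j (mono w)
    = fscale (ksign (list_parity snd (take t w))) (mono (w[t := (j, \<not> snd (w ! t))]))"
proof -
  let ?X = "\<lambda>(k, b). if k = j then mono [(k, \<not> b)] else 0 :: vidx fa"
  have "hbar_op j (mono w) = (\<Sum>s<length w. apply_at True s ?X w)"
    by (simp add: hbar_op_def leibniz_def)
  also have "\<dots> = (\<Sum>s\<in>{t}. apply_at True s ?X w)"
    by (rule sum.mono_neutral_right)
      (use assms in \<open>auto simp: apply_at_def case_prod_beta\<close>)
  also have "\<dots> = fscale (ksign (list_parity snd (take t w))) (mono (w[t := (j, \<not> snd (w ! t))]))"
    using assms apply_at_mono [of t w ?X 1 "(j, \<not> snd (w ! t))" True]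
    by (simp add: case_prod_beta)
  finally show ?thesis .
qed

section \<open>The spaces of supermodule homomorphisms\<close>

lemma lin_0: "lin 0"
  by (rule linI) auto

lemma lin_op_scale: "lin f \<Longrightarrow> lin (op_scale c f)"
  by (rule linI) (auto simp: op_scale_def lin_add lin_scale fvs.scale_right_distrib mult.commute)

lemma homog_add: "x \<in> homog par p \<Longrightarrow> y \<in> homog par p \<Longrightarrow> x + y \<in> homog par p"
  by (simp add: homog_eq_words_span words_span_add)

lemma homog_scale: "x \<in> homog par p \<Longrightarrow> fscale c x \<in> homog par p"
  by (simp add: homog_eq_words_span words_span_scale)

lemma lin_sergeev_act: "lin (sergeev_act X)"
  unfolding sergeev_act_def by (rule lin_free_act)

lemma HomH_part_iff:
  "f \<in> HomH_part r p A B \<longleftrightarrow> lin f \<and> (\<forall>w. mono w \<notin> A \<longrightarrow> f (mono w) = 0) \<and> (\<forall>x\<in>A. f x \<in> B) \<and>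
     (\<forall>q. \<forall>x\<in>A \<inter> homog snd q. f x \<in> homog snd (p \<noteq> q)) \<and>
     (\<forall>q. \<forall>X\<in>hom_part (sergeev r) q. \<forall>x\<in>A.
        f (sergeev_act X x) = fscale (ksign (p \<and> q)) (sergeev_act X (f x)))"
  unfolding HomH_part_def mem_Collect_eq image_subset_iff ..

lemma HomH_part_zero: "0 \<in> HomH_part r p (words_span A) (words_span B)"
  unfolding HomH_part_iff
  by (simp add: lin_0 words_span_zero homog_eq_words_span lin_zero [OF lin_sergeev_act])

lemma HomH_part_add:
  assumes "f \<in> HomH_part r p (words_span A) (words_span B)" "g \<in> HomH_part r p (words_span A) (words_span B)"
  shows "f + g \<in> HomH_part r p (words_span A) (words_span B)"
  using assms unfolding HomH_part_iff
  by (simp add: lin_plus words_span_add homog_add lin_add [OF lin_sergeev_act] fvs.scale_right_distrib)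

lemma HomH_part_scale:
  assumes "f \<in> HomH_part r p (words_span A) (words_span B)"
  shows "op_scale c f \<in> HomH_part r p (words_span A) (words_span B)"
  using assms unfolding HomH_part_iff
  by (simp add: lin_op_scale [unfolded op_scale_def] op_scale_def words_span_scale homog_scale
      lin_scale [OF lin_sergeev_act] mult.commute)

lemma HomH_subspace: "ops.subspace (HomH r (words_span A) (words_span B))"
proof (rule ops.subspaceI)
  show "0 \<in> HomH r (words_span A) (words_span B)"
    unfolding HomH_def mem_Collect_eq
    by (rule exI [of _ 0], rule exI [of _ 0]) (simp add: HomH_part_zero)
next
  fix f g assume "f \<in> HomH r (words_span A) (words_span B)" "g \<in> HomH r (words_span A) (words_span B)"
  then obtain f0 f1 g0 g1 where *: "f = f0 + f1" "g = g0 + g1"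
    "f0 \<in> HomH_part r False (words_span A) (words_span B)" "f1 \<in> HomH_part r True (words_span A) (words_span B)"
    "g0 \<in> HomH_part r False (words_span A) (words_span B)" "g1 \<in> HomH_part r True (words_span A) (words_span B)"
    by (auto simp: HomH_def)
  have "f + g = (f0 + g0) + (f1 + g1)" by (simp add: * add_ac)
  then show "f + g \<in> HomH r (words_span A) (words_span B)"
    unfolding HomH_def using * HomH_part_add by blast
next
  fix c f assume "f \<in> HomH r (words_span A) (words_span B)"
  then obtain f0 f1 where *: "f = f0 + f1"
    "f0 \<in> HomH_part r False (words_span A) (words_span B)" "f1 \<in> HomH_part r True (words_span A) (words_span B)"
    by (auto simp: HomH_def)
  have "op_scale c f = op_scale c f0 + op_scale c f1" by (simp add: * ops.scale_right_distrib)
  then show "op_scale c f \<in> HomH r (words_span A) (words_span B)"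
    unfolding HomH_def using * HomH_part_scale by blast
qed

section \<open>Evaluating webs on words\<close>

lemma length_ones [simp]: "length (ones n) = n"
  by (simp add: ones_def)

lemma sum_list_ones [simp]: "sum_list (ones n) = n"
  by (simp add: ones_def sum_list_replicate)

lemma ones_Acomp: "0 < n \<Longrightarrow> ones n \<in> Acomp n"
  by (auto simp: Acomp_def ones_def sum_list_replicate)

lemma erase_append: "erase (x @ y) = erase x @ erase y"
  by (simp add: erase_def)

lemma hat_in_Lam': "a \<in> Acomp r \<Longrightarrow> hat r a \<in> Lam' r"
proof -
  assume a: "a \<in> Acomp r"
  have "hat r a ! i \<noteq> 0" if "i < length a" for i
    using that a nth_mem [OF that] by (auto simp: Acomp_def hat_def nth_append)
  moreover have "hat r a ! i = 0" if "\<not> i < length a" "i < r" for i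
    using that by (simp add: hat_def nth_append)
  moreover have "sum_list (hat r a) = r"
    using a by (simp add: hat_def Acomp_def sum_list_replicate)
  ultimately show ?thesis
    using length_hat [OF a] unfolding Lam'_def Lam_def by (auto, metis order.strict_trans)
qed

text \<open>Since zeros are trailing, padding the nonzero entries with zeros restores the weight.\<close>

lemma Lam'_eq_hat:
  assumes "lam \<in> Lam' r" "1 \<le> r"
  shows "erase lam \<in> Acomp r" "hat r (erase lam) = lam"
proof -
  have len: "length lam = r" and sum: "sum_list lam = r"
    and zeros: "\<And>i j. i < j \<Longrightarrow> j < r \<Longrightarrow> lam ! i = 0 \<Longrightarrow> lam ! j = 0"
    using assms(1) by (auto simp: Lam'_def Lam_def)
  have "lam = erase lam @ replicate (length lam - length (erase lam)) 0"
    using zeros unfolding len [symmetric]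
  proof (induction lam)
    case (Cons k lam)
    show ?case
    proof (cases "k = 0")
      case True
      have "(k # lam) ! j = 0" if "j < length (k # lam)" for j
        using Cons.prems [of 0 j] that True by (cases j) auto
      then have "\<forall>x\<in>set (k # lam). x = 0" by (metis in_set_conv_nth)
      then have "k # lam = replicate (length (k # lam)) 0" "erase (k # lam) = []"
        by (auto simp: erase_def intro: replicate_eqI)
      then show ?thesis by simp
    next
      case False
      have "lam = erase lam @ replicate (length lam - length (erase lam)) 0"
        by (rule Cons.IH) (use Cons.prems in \<open>metis Suc_less_eq length_Cons nth_Cons_Suc\<close>)
      with False show ?thesis by (simp add: erase_def)
    qed
  qed (simp add: erase_def)
  then show hat: "hat r (erase lam) = lam" by (simp add: hat_def len)
  have "sum_list (erase lam) = r"
    using sum by (subst (asm) hat [symmetric]) (simp add: hat_def sum_list_replicate)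
  moreover from this have "erase lam \<noteq> []" using assms(2) by auto
  ultimately show "erase lam \<in> Acomp r" by (auto simp: Acomp_def erase_def)
qed

lemma Msum_eq: "1 \<le> r \<Longrightarrow> Msum r = words_span (\<Union>a\<in>Acomp r. words r a)"
proof -
  assume r: "1 \<le> r"
  have "(\<Union>\<nu>\<in>Lam' r. Mperm r \<nu>) = (\<Union>a\<in>Acomp r. words_span (words r a))"
  proof -
    have "Lam' r = hat r ` Acomp r"
      using hat_in_Lam' Lam'_eq_hat [OF _ r] by (auto intro!: image_eqI [of _ _ "erase _"])
    then show ?thesis by (simp add: Mperm_eq)
  qed
  then have "Msum r = fspan (\<Union>a\<in>Acomp r. words_span (words r a))"
    by (simp add: Msum_def)
  also have "\<dots> = words_span (\<Union>a\<in>Acomp r. words r a)"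
  proof
    have "(\<Union>a\<in>Acomp r. words_span (words r a)) \<subseteq> words_span (\<Union>a\<in>Acomp r. words r a)"
      by (fastforce simp: words_span_def)
    then show "fspan (\<Union>a\<in>Acomp r. words_span (words r a)) \<subseteq> words_span (\<Union>a\<in>Acomp r. words r a)"
      unfolding fspan_mono [symmetric] by (rule fvs.span_minimal) (rule fvs.subspace_span)
    show "words_span (\<Union>a\<in>Acomp r. words r a) \<subseteq> fspan (\<Union>a\<in>Acomp r. words_span (words r a))"
      unfolding fspan_mono [of "\<Union>a\<in>Acomp r. words r a", symmetric]
      by (rule fvs.span_mono) auto
  qed
  finally show ?thesis .
qed

definition nonconst :: "nat \<Rightarrow> wgen fa set"
  where "nonconst r = words_span {w. set w \<subseteq> web_gens r \<and> w \<noteq> []}"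

lemma nonconst_eq:
  "nonconst r = {x \<in> carrier (free_superalg (web_gens r) gen_odd). Poly_Mapping.lookup x 0 = 0}"
proof -
  have "(\<forall>w. \<not> (set w \<subseteq> web_gens r \<and> w \<noteq> []) \<longrightarrow> Poly_Mapping.lookup x (Word w) = 0) \<longleftrightarrow>
      (\<forall>w. \<not> set w \<subseteq> web_gens r \<longrightarrow> Poly_Mapping.lookup x (Word w) = 0) \<and>
      Poly_Mapping.lookup x (Word []) = 0" for x :: "wgen fa"
    by blast
  then show ?thesis
    unfolding nonconst_def carrier_free_superalg zero_word_def
    by (simp add: set_eq_iff words_span_lookup)
qed

lemma nonconst_mult: "x \<in> nonconst r \<Longrightarrow> y \<in> nonconst r \<Longrightarrow> x * y \<in> nonconst r"
  unfolding nonconst_def by (erule words_span_mult) auto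

lemma carrier_web: "carrier (web r) = web_class r ` nonconst r"
  by (simp add: web_def presented_nonunital_def web_class_def nonconst_eq)

lemma words_ones_upt: "map (\<lambda>k. (k, b)) [1..<Suc r] \<in> words r (ones r)"
proof -
  have "cnt k (map (\<lambda>k. (k, b)) [1..<Suc r]) = (if 1 \<le> k \<and> k \<le> r then 1 else 0)" for k
    by (induction r) (auto simp: comp_def)
  then show ?thesis
    by (simp add: content_words_def cont_def ones_def del: upt_Suc) auto
qed

locale web_isomorphism =
  fixes r :: nat and \<psi> :: "wgen fa set \<Rightarrow> vidx fa \<Rightarrow> vidx fa"
  assumes r_pos: "1 \<le> r" and psi: "is_psi r \<psi>"
begin

abbreviation ev :: "wgen fa \<Rightarrow> vidx fa \<Rightarrow> vidx fa"
  where "ev x \<equiv> \<psi> (web_class r x)"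

lemma psi_iso: "\<psi> \<in> ring_iso (web r) (EndH r)"
  using psi by (simp add: is_psi_def superalg_iso_def)

lemma ev_Idn: "a \<in> Acomp r \<Longrightarrow> ev (mono [Idn a]) = proj (words_span (words r a))"
  using psi by (simp add: is_psi_def Mperm_eq)

lemma Idn_nonconst: "a \<in> Acomp r \<Longrightarrow> mono [Idn a] \<in> nonconst r"
  by (simp add: nonconst_def web_gens_def)

lemma HomH_carrier: "X \<in> carrier (web r) \<Longrightarrow> \<psi> X \<in> HomH r (Msum r) (Msum r)"
  using psi_iso by (auto simp: ring_iso_def ring_hom_def EndH_def)

text \<open>If some relator were not in the free algebra, then no ideal would contain the relators and the
  intersection of all these ideals would be everything. The web superalgebra would then have one
  element, but \<open>\<psi>\<close> is a bijection onto an algebra that contains zero and a nonzero projection.\<close>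

lemma presentation_web: "presentation (web_gens r) gen_odd (web_rels r)"
proof (unfold_locales, rule ccontr)
  let ?F = "free_superalg (web_gens r) gen_odd"
  assume neg: "\<not> web_rels r \<subseteq> carrier ?F"
  have "\<not> ideal I ?F" if "web_rels r \<subseteq> I" for I
    using neg that additive_subgroup.a_subset [OF ideal.axioms(1)] by blast
  then have "rel_ideal (web_gens r) gen_odd (web_rels r) = UNIV"
    unfolding rel_ideal_def genideal_def by blast
  then have cl: "web_class r x = UNIV" for x
    unfolding web_class_def pres_class_def a_r_coset_def'
    by (auto simp: free_superalg_def) (metis diff_add_cancel)
  have "\<psi> ` carrier (web r) = carrier (EndH r)"
    using psi_iso by (auto simp: ring_iso_def bij_betw_def)
  then have "0 \<in> \<psi> ` carrier (web r)"
    using ops.subspace_0 [OF HomH_subspace] Msum_eq [OF r_pos] by (simp add: EndH_def)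
  then have "ev (mono [Idn (ones r)]) = 0" using cl by (auto simp: carrier_web)
  then have "proj (words_span (words r (ones r))) (mono (map (\<lambda>k. (k, False)) [1..<Suc r])) = 0"
    using ev_Idn ones_Acomp r_pos by simp
  then show False using words_ones_upt by (simp add: proj_mono del: upt_Suc)
qed

sublocale presentation "web_gens r" gen_odd "web_rels r"
  by (rule presentation_web)

lemma ev_mult:
  assumes "x \<in> nonconst r" "y \<in> nonconst r"
  shows "web_class r x \<otimes>\<^bsub>web r\<^esub> web_class r y = web_class r (x * y)"
    and "ev (x * y) = ev x \<circ> ev y"
proof -
  show eq: "web_class r x \<otimes>\<^bsub>web r\<^esub> web_class r y = web_class r (x * y)"
    using assms cl_mult by (simp add: web_def presented_nonunital_def web_class_def nonconst_eq)
  have "\<psi> (web_class r x \<otimes>\<^bsub>web r\<^esub> web_class r y) = ev x \<circ> ev y"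
    using psi_iso assms by (auto simp: ring_iso_def ring_hom_def EndH_def carrier_web)
  then show "ev (x * y) = ev x \<circ> ev y" by (simp add: eq)
qed

lemma ev_add:
  assumes "x \<in> nonconst r" "y \<in> nonconst r"
  shows "ev (x + y) = ev x + ev y"
proof -
  have eq: "web_class r x \<oplus>\<^bsub>web r\<^esub> web_class r y = web_class r (x + y)"
    using assms cl_add by (simp add: web_def presented_nonunital_def web_class_def nonconst_eq)
  have "\<psi> (web_class r x \<oplus>\<^bsub>web r\<^esub> web_class r y) = ev x + ev y"
    using psi_iso assms by (auto simp: ring_iso_def ring_hom_def EndH_def carrier_web)
  then show ?thesis by (simp add: eq)
qed

lemma lin_ev: "x \<in> nonconst r \<Longrightarrow> lin (ev x)"
  using HomH_carrier [of "web_class r x"] by (auto simp: carrier_web HomH_def HomH_part_def intro: lin_plus)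

end

section \<open>Iterated merges and splits\<close>

definition monotone_labels :: "(nat \<Rightarrow> nat) \<Rightarrow> bool"
  where "monotone_labels \<rho> \<longleftrightarrow> (\<forall>k l. k \<le> l \<longrightarrow> \<rho> k \<le> \<rho> l)"

text \<open>Iterated merges act by a single relabelling of the letters, iterated splits by the sum over the fibres of
  such a relabelling, and both kinds of maps are closed under composition. The target of a complete merge
  and monotonicity determine the relabelling (see \<open>monotone_relabelling_unique\<close>), so that it need not be
  computed step by step.\<close>

definition is_merging :: "nat \<Rightarrow> nat list \<Rightarrow> nat list \<Rightarrow> (vidx fa \<Rightarrow> vidx fa) \<Rightarrow> bool"
  where "is_merging r a b f \<longleftrightarrow> lin f \<and> (\<forall>w. w \<notin> words r a \<longrightarrow> f (mono w) = 0) \<and>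
    (\<exists>\<rho>. monotone_labels \<rho> \<and> (\<forall>w\<in>words r a. relabel \<rho> w \<in> words r b) \<and>
      (\<forall>w\<in>words r a. f (mono w) = mono (relabel \<rho> w)))"

definition is_splitting :: "nat \<Rightarrow> nat list \<Rightarrow> nat list \<Rightarrow> (vidx fa \<Rightarrow> vidx fa) \<Rightarrow> bool"
  where "is_splitting r b a f \<longleftrightarrow> lin f \<and> (\<forall>w. w \<notin> words r b \<longrightarrow> f (mono w) = 0) \<and>
    (\<exists>\<rho>. monotone_labels \<rho> \<and> (\<forall>w\<in>words r a. relabel \<rho> w \<in> words r b) \<and>
      (\<forall>w\<in>words r b. f (mono w) = (\<Sum>w'\<in>{w' \<in> words r a. relabel \<rho> w' = w}. mono w')))"

lemma relabel_id: "relabel (\<lambda>k. k) w = w"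
  by (auto intro!: nth_equalityI)

lemma monotone_labels_comp: "monotone_labels \<rho> \<Longrightarrow> monotone_labels \<rho>' \<Longrightarrow> monotone_labels (\<rho> \<circ> \<rho>')"
  by (simp add: monotone_labels_def)

lemma is_merging_comp:
  assumes "is_merging r a b f" "is_merging r b c g"
  shows "is_merging r a c (g \<circ> f)"
proof -
  obtain \<rho> where \<rho>: "monotone_labels \<rho>" "\<forall>w\<in>words r a. relabel \<rho> w \<in> words r b"
      "\<forall>w\<in>words r a. f (mono w) = mono (relabel \<rho> w)"
    using assms(1) by (auto simp: is_merging_def)
  obtain \<rho>' where \<rho>': "monotone_labels \<rho>'" "\<forall>w\<in>words r b. relabel \<rho>' w \<in> words r c"
      "\<forall>w\<in>words r b. g (mono w) = mono (relabel \<rho>' w)"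
    using assms(2) by (auto simp: is_merging_def)
  show ?thesis
    unfolding is_merging_def
    using assms \<rho> \<rho>'
    by (auto simp: is_merging_def lin_comp lin_zero relabel_relabel [symmetric]
        intro!: exI [of _ "\<rho>' \<circ> \<rho>"] monotone_labels_comp)
qed

lemma finite_content_words: "finite (words r a)"
proof -
  have "fst ` set w \<subseteq> {..length a}" if "w \<in> words r a" for w
  proof
    fix k assume "k \<in> fst ` set w"
    then have "cont a k \<noteq> 0"
      using that cnt_eq_0 [of k w] by (simp add: content_words_def)
    then show "k \<in> {..length a}" by (auto simp: cont_def split: if_splits)
  qed
  then have "words r a \<subseteq> {w. set w \<subseteq> {..length a} \<times> UNIV \<and> length w = r}"
    by (fastforce simp: content_words_def)
  then show ?thesis
    by (rule finite_subset) (rule finite_lists_length_eq, simp)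
qed

text \<open>The fibre of a composite relabelling is the disjoint union of the fibres over the points of a fibre.\<close>

lemma is_splitting_comp:
  assumes "is_splitting r a b f" "is_splitting r b c g"
  shows "is_splitting r a c (g \<circ> f)"
proof -
  obtain \<rho> where \<rho>: "monotone_labels \<rho>" "\<forall>w\<in>words r b. relabel \<rho> w \<in> words r a"
      "\<forall>w\<in>words r a. f (mono w) = (\<Sum>w'\<in>{w' \<in> words r b. relabel \<rho> w' = w}. mono w')"
    using assms(1) by (auto simp: is_splitting_def)
  obtain \<rho>' where \<rho>': "monotone_labels \<rho>'" "\<forall>w\<in>words r c. relabel \<rho>' w \<in> words r b"
      "\<forall>w\<in>words r b. g (mono w) = (\<Sum>w'\<in>{w' \<in> words r c. relabel \<rho>' w' = w}. mono w')"
    using assms(2) by (auto simp: is_splitting_def)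
  have lin: "lin g" "lin f" using assms by (auto simp: is_splitting_def)
  have "(g \<circ> f) (mono w) = (\<Sum>w'\<in>{w' \<in> words r c. relabel (\<rho> \<circ> \<rho>') w' = w}. mono w')"
    if "w \<in> words r a" for w
  proof -
    let ?B = "{w' \<in> words r b. relabel \<rho> w' = w}" and ?C = "{w' \<in> words r c. relabel (\<rho> \<circ> \<rho>') w' = w}"
    have "(g \<circ> f) (mono w) = (\<Sum>v\<in>?B. \<Sum>w'\<in>{w' \<in> words r c. relabel \<rho>' w' = v}. mono w')"
      using that \<rho>(3) \<rho>'(3) by (simp add: lin_sum [OF lin(1)])
    also have "\<dots> = (\<Sum>v\<in>?B. \<Sum>w'\<in>{w' \<in> ?C. relabel \<rho>' w' = v}. mono w')"
      by (rule sum.cong) (auto intro!: sum.cong simp: relabel_relabel [symmetric])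
    also have "\<dots> = (\<Sum>w'\<in>?C. mono w')"
      by (rule sum.group)
        (use \<rho>'(2) finite_content_words in \<open>auto simp: relabel_relabel [symmetric]\<close>)
    finally show ?thesis .
  qed
  moreover have "(g \<circ> f) (mono w) = 0" if "w \<notin> words r a" for w
    using that assms by (simp add: is_splitting_def lin_zero)
  moreover have "\<forall>w\<in>words r c. relabel (\<rho> \<circ> \<rho>') w \<in> words r a"
    using \<rho>(2) \<rho>'(2) by (simp add: relabel_relabel [symmetric])
  ultimately show ?thesis
    unfolding is_splitting_def
    by (intro conjI exI [of _ "\<rho> \<circ> \<rho>'"] lin_comp lin monotone_labels_comp \<rho>(1) \<rho>'(1)) auto
qed

lemma is_merging_proj: "is_merging r a a (proj (words_span (words r a)))"
  unfolding is_merging_def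
  by (auto simp: lin_proj proj_mono relabel_id monotone_labels_def intro!: exI [of _ "\<lambda>k. k"])

lemma is_splitting_proj: "is_splitting r a a (proj (words_span (words r a)))"
proof -
  have "{w' \<in> words r a. w' = w} = {w}" if "w \<in> words r a" for w using that by blast
  then show ?thesis
    unfolding is_splitting_def
    by (auto simp: lin_proj proj_mono relabel_id monotone_labels_def intro!: exI [of _ "\<lambda>k. k"])
qed

lemma cont_merge: "cont (x @ [k + l] @ y) = merge_cont (Suc (length x)) (cont (x @ [k, l] @ y))"
proof
  fix m
  show "cont (x @ [k + l] @ y) m = merge_cont (Suc (length x)) (cont (x @ [k, l] @ y)) m"
  proof (cases "m \<le> Suc (length x)")
    case True
    then show ?thesis by (auto simp: cont_def merge_cont_def nth_append)
  next
    case False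
    then have "length x + 2 \<le> m" by simp
    then obtain n where "m = length x + 2 + n" by (blast dest: le_Suc_ex)
    then show ?thesis by (simp add: cont_def merge_cont_def nth_append)
  qed
qed

lemma monotone_merge_labels: "monotone_labels (merge_labels i)"
  by (auto simp: monotone_labels_def merge_labels_def)

context web_isomorphism
begin

lemma Acomp_merge_iff: "0 < k \<Longrightarrow> 0 < l \<Longrightarrow> x @ [k + l] @ y \<in> Acomp r \<longleftrightarrow> x @ [k, l] @ y \<in> Acomp r"
  by (auto simp: Acomp_def)

lemma Gen_nonconst:
  assumes "sym_ok g" "x @ sym_src g @ y \<in> Acomp r"
  shows "mono [Gen x g y] \<in> nonconst r"
proof -
  have "x @ sym_tgt g @ y \<in> Acomp r"
    using assms by (cases g) (auto simp: Acomp_def)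
  then show ?thesis using assms by (simp add: nonconst_def web_gens_def)
qed

lemma ev_Merge:
  assumes a: "x @ [k, l] @ y \<in> Acomp r"
  shows "is_merging r (x @ [k, l] @ y) (x @ [k + l] @ y) (ev (mono [Gen x (Merge k l) y]))"
proof -
  let ?a = "x @ [k, l] @ y" and ?i = "length x + 1"
  have pos: "0 < k" "0 < l" using a by (auto simp: Acomp_def)
  have eq: "ev (mono [Gen x (Merge k l) y]) = merge_op r ?a ?i"
    using psi a by (simp add: is_psi_def)
  have lin: "lin (ev (mono [Gen x (Merge k l) y]))"
    using Gen_nonconst [of "Merge k l" x y] a pos by (intro lin_ev) simp
  have i: "?i < r" using a length_le_sum_list [of ?a] by (auto simp: Acomp_def)
  have zero: "merge_op r ?a ?i (mono w) = 0" if "w \<notin> words r ?a" for w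
  proof -
    have "fold (\<lambda>j F. divpow (e_op j) (c j) \<circ> F) js F (mono w) = 0" if "F (mono w) = 0" for F js c
      using that by (induction js arbitrary: F) (simp_all add: lin_zero [OF lin_divpow [OF lin_move]] e_op_eq)
    moreover have "proj_comp r ?a (mono w) = 0" using that a by (simp only: Mperm_eq proj_mono) simp
    ultimately show ?thesis unfolding merge_op_def by blast
  qed
  have "relabel (merge_labels ?i) w \<in> words r (x @ [k + l] @ y)" if "w \<in> words r ?a" for w
    using merge_labels_content [OF _ that, of ?i] by (simp only: cont_merge) simp
  then show ?thesis
    unfolding is_merging_def eq using lin [unfolded eq] zero merge_op_mono [OF a _ _ i]
    by (intro conjI exI [of _ "merge_labels ?i"] monotone_merge_labels) auto
qed

lemma ev_Split:
  assumes b: "x @ [k + l] @ y \<in> Acomp r" and pos: "0 < k" "0 < l"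
  shows "is_splitting r (x @ [k + l] @ y) (x @ [k, l] @ y) (ev (mono [Gen x (Split k l) y]))"
proof -
  let ?a = "x @ [k, l] @ y" and ?b = "x @ [k + l] @ y" and ?i = "length x + 1"
  have a: "?a \<in> Acomp r" using b pos Acomp_merge_iff by blast
  have eq: "ev (mono [Gen x (Split k l) y]) = split_op r ?a ?b ?i"
    using psi a by (simp add: is_psi_def)
  have lin: "lin (ev (mono [Gen x (Split k l) y]))"
    using Gen_nonconst [of "Split k l" x y] b pos by (intro lin_ev) simp
  have zero: "split_op r ?a ?b ?i (mono w) = 0" if "w \<notin> words r ?b" for w
  proof -
    have "foldr (\<lambda>j F. divpow (f_op j) (c j) \<circ> F) js F (mono w) = 0" if "F (mono w) = 0" for F js c
      using that by (induction js) (simp_all add: lin_zero [OF lin_divpow [OF lin_move]] f_op_eq)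
    moreover have "proj_comp r ?b (mono w) = 0" using that b by (simp only: Mperm_eq proj_mono) simp
    ultimately show ?thesis unfolding split_op_def by blast
  qed
  have "relabel (merge_labels ?i) w \<in> words r ?b" if "w \<in> words r ?a" for w
    using merge_labels_content [OF _ that, of ?i] by (simp only: cont_merge) simp
  moreover have "cont ?b = merge_cont ?i (cont ?a)" using cont_merge [of x k l y] by simp
  ultimately show ?thesis
    unfolding is_splitting_def eq
    using lin [unfolded eq] zero split_op_mono [OF a b]
    by (intro conjI exI [of _ "merge_labels ?i"] monotone_merge_labels) auto
qed

end

section \<open>Complete merges and splits\<close>

text \<open>The weakly increasing word with content \<open>a\<close>; as a map, it sends a position to the block that contains it.\<close>

definition blocks :: "nat list \<Rightarrow> nat list"
  where "blocks a = concat (map (\<lambda>i. replicate (a ! i) (Suc i)) [0..<length a])"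

abbreviation block_of :: "nat list \<Rightarrow> nat \<Rightarrow> nat"
  where "block_of a k \<equiv> blocks a ! (k - 1)"

lemma blocks_snoc: "blocks (a @ [k]) = blocks a @ replicate k (Suc (length a))"
proof -
  have "map (\<lambda>i. replicate ((a @ [k]) ! i) (Suc i)) [0..<length a]
      = map (\<lambda>i. replicate (a ! i) (Suc i)) [0..<length a]"
    by (rule map_cong) (auto simp: nth_append)
  then show ?thesis by (simp add: blocks_def del: map_eq_conv)
qed

lemma set_blocks: "set (blocks a) \<subseteq> {1..length a}"
  by (auto simp: blocks_def)

lemma sorted_blocks: "sorted (blocks a)"
proof (induction a rule: rev_induct)
  case (snoc k a)
  then show ?case using set_blocks [of a] by (fastforce simp: blocks_snoc sorted_append)
qed (simp add: blocks_def)

lemma count_blocks: "count (mset (blocks a)) k = cont a k"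
proof (induction a rule: rev_induct)
  case (snoc x a)
  then show ?case by (auto simp: blocks_snoc cont_def nth_append)
qed (simp add: blocks_def cont_def)

lemma mset_labels:
  assumes "w \<in> words r a"
  shows "mset (map fst w) = mset (blocks a)"
proof (rule multiset_eqI)
  fix k
  have "count (mset (map fst w)) k = cnt k w"
    by (induction w) auto
  then show "count (mset (map fst w)) k = count (mset (blocks a)) k"
    using assms by (simp add: count_blocks content_words_def)
qed

lemma words_iff_mset: "w \<in> words r a \<longleftrightarrow> length w = r \<and> mset (map fst w) = mset (blocks a)"
proof -
  have "count (mset (map fst w)) k = cnt k w" for k
    by (induction w) auto
  then show ?thesis by (auto simp: content_words_def multiset_eq_iff count_blocks)
qed

lemma blocks_ones: "blocks (ones n) = [1..<Suc n]"
proof (induction n)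
  case (Suc n)
  have "ones (Suc n) = ones n @ [1]"
    by (simp add: ones_def replicate_append_same)
  then show ?case using Suc by (simp add: blocks_snoc)
qed (simp add: blocks_def ones_def)

lemma length_blocks: "length (blocks a) = sum_list a"
proof (induction a rule: rev_induct)
  case (snoc x a)
  then show ?case by (simp add: blocks_snoc)
qed (simp add: blocks_def)

lemma label_range: "w \<in> words r (ones r) \<Longrightarrow> fst ` set w = {1..r}"
  using mset_eq_setD [of "map fst w" "blocks (ones r)"] mset_labels [of w r "ones r"]
  by (auto simp: blocks_ones)

text \<open>Applied to the word \<open>1, \<dots>, r\<close>, a monotone relabelling yields a weakly increasing word, and there is only one
  such word of given content.\<close>

lemma monotone_relabelling_unique:
  assumes "monotone_labels \<rho>" "\<And>w. w \<in> words r (ones r) \<Longrightarrow> relabel \<rho> w \<in> words r b"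
    and "w \<in> words r (ones r)"
  shows "relabel \<rho> w = relabel (block_of b) w"
proof (rule relabel_cong)
  let ?v = "map (\<lambda>k. (k, False)) [1..<Suc r]"
  have fst_v: "map fst (relabel \<rho> ?v) = map \<rho> [1..<Suc r]"
    by (simp add: relabel_def del: upt_Suc)
  have "mset (map \<rho> [1..<Suc r]) = mset (blocks b)"
    using mset_labels [OF assms(2) [OF words_ones_upt [of False]]] unfolding fst_v .
  moreover have "sorted (map \<rho> [1..<Suc r])"
    using assms(1) unfolding monotone_labels_def
    by (auto simp: sorted_iff_nth_mono simp del: upt_Suc)
  ultimately have eq: "map \<rho> [1..<Suc r] = blocks b"
    using sorted_blocks by (metis properties_for_sort)
  fix k assume "k \<in> fst ` set w"
  then have "1 \<le> k" "k \<le> r" using label_range [OF assms(3)] by auto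
  then show "\<rho> k = block_of b k"
    by (simp flip: eq del: upt_Suc)
qed

lemma is_merging_ones:
  assumes "is_merging r (ones r) b f" "w \<in> words r (ones r)"
  shows "f (mono w) = mono (relabel (block_of b) w)" "relabel (block_of b) w \<in> words r b"
  using assms monotone_relabelling_unique [of _ r b] unfolding is_merging_def by metis+

lemma is_splitting_ones:
  assumes "is_splitting r b (ones r) f" "w \<in> words r b"
  shows "f (mono w) = (\<Sum>w'\<in>{w' \<in> words r (ones r). relabel (block_of b) w' = w}. mono w')"
proof -
  obtain \<rho> where \<rho>: "monotone_labels \<rho>" "\<And>w. w \<in> words r (ones r) \<Longrightarrow> relabel \<rho> w \<in> words r b"
      "f (mono w) = (\<Sum>w'\<in>{w' \<in> words r (ones r). relabel \<rho> w' = w}. mono w')"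
    using assms unfolding is_splitting_def by blast
  have "{w' \<in> words r (ones r). relabel \<rho> w' = w} = {w' \<in> words r (ones r). relabel (block_of b) w' = w}"
    using monotone_relabelling_unique [OF \<rho>(1,2)] by auto
  then show ?thesis using \<rho>(3) by simp
qed

lemma pad_mono: "pad x y (mono w) = mono (map (pad_gen x y) w)"
  by (simp add: pad_def)

lemma lin_pad: "lin (pad x y)"
  unfolding pad_def by (rule lin_lin_ext)

lemma pad_gen_pad_gen: "pad_gen x y (pad_gen x' y' g) = pad_gen (x @ x') (y' @ y) g"
  by (cases g) (simp_all add: erase_append)

context web_isomorphism
begin

text \<open>Local webs are composed after adding identity strands, so the property \<open>P\<close> of the operator must hold for every
  way of adding them. The web is required to be a single nonempty word, because \<open>\<psi>\<close> is multiplicative on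
  elements without constant term.\<close>

definition realizes :: "(nat list \<Rightarrow> nat list \<Rightarrow> (vidx fa \<Rightarrow> vidx fa) \<Rightarrow> bool)
    \<Rightarrow> nat list \<Rightarrow> nat list \<Rightarrow> wgen fa \<Rightarrow> bool"
  where "realizes P u v f \<longleftrightarrow> u \<in> Acomp (sum_list v) \<and> v \<in> Acomp (sum_list u) \<and>
    (\<exists>w. w \<noteq> [] \<and> f = mono w \<and> (\<forall>x y. x @ u @ y \<in> Acomp r \<longrightarrow>
      set (map (pad_gen x y) w) \<subseteq> web_gens r \<and>
      P (x @ u @ y) (x @ v @ y) (ev (mono (map (pad_gen x y) w)))))"

lemma realizesI:
  assumes "w \<noteq> []" "f = mono w" "u \<in> Acomp (sum_list v)" "v \<in> Acomp (sum_list u)"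
    and "\<And>x y. x @ u @ y \<in> Acomp r \<Longrightarrow> set (map (pad_gen x y) w) \<subseteq> web_gens r \<and>
      P (x @ u @ y) (x @ v @ y) (ev (mono (map (pad_gen x y) w)))"
  shows "realizes P u v f"
  unfolding realizes_def using assms by blast

lemma realizes_Acomp:
  assumes "realizes P u v f"
  shows "u \<in> Acomp (sum_list v)" "v \<in> Acomp (sum_list u)"
  using assms unfolding realizes_def by simp_all

lemma realizes_pad:
  assumes "realizes P u v f" "\<forall>k\<in>set x \<union> set y. 0 < k"
  shows "realizes P (x @ u @ y) (x @ v @ y) (pad x y f)"
proof -
  obtain w where w: "w \<noteq> []" "f = mono w" "\<And>x y. x @ u @ y \<in> Acomp r \<Longrightarrow>
      set (map (pad_gen x y) w) \<subseteq> web_gens r \<and>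
      P (x @ u @ y) (x @ v @ y) (ev (mono (map (pad_gen x y) w)))"
    using assms(1) unfolding realizes_def by blast
  have eq: "map (pad_gen x' y') (map (pad_gen x y) w) = map (pad_gen (x' @ x) (y @ y')) w" for x' y'
    by (simp add: pad_gen_pad_gen)
  show ?thesis
  proof (rule realizesI [of "map (pad_gen x y) w"])
    show "map (pad_gen x y) w \<noteq> []" "pad x y f = mono (map (pad_gen x y) w)"
      using w(1,2) by (simp_all add: pad_mono)
    show "x @ u @ y \<in> Acomp (sum_list (x @ v @ y))" "x @ v @ y \<in> Acomp (sum_list (x @ u @ y))"
      using realizes_Acomp [OF assms(1)] assms(2) by (auto simp: Acomp_def)
    fix x' y' assume "x' @ (x @ u @ y) @ y' \<in> Acomp r"
    then have "(x' @ x) @ u @ (y @ y') \<in> Acomp r" by simp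
    from w(3) [OF this]
    show "set (map (pad_gen x' y') (map (pad_gen x y) w)) \<subseteq> web_gens r \<and>
      P (x' @ (x @ u @ y) @ y') (x' @ (x @ v @ y) @ y') (ev (mono (map (pad_gen x' y') (map (pad_gen x y) w))))"
      unfolding eq by simp
  qed
qed

lemma realizes_comp:
  assumes "realizes P u v f" "realizes P v v' g"
    and comp: "\<And>a b c F G. P a b F \<Longrightarrow> P b c G \<Longrightarrow> P a c (G \<circ> F)"
  shows "realizes P u v' (g * f)"
proof -
  obtain w where w: "w \<noteq> []" "f = mono w" "\<And>x y. x @ u @ y \<in> Acomp r \<Longrightarrow>
      set (map (pad_gen x y) w) \<subseteq> web_gens r \<and>
      P (x @ u @ y) (x @ v @ y) (ev (mono (map (pad_gen x y) w)))"
    using assms(1) unfolding realizes_def by blast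
  obtain w' where w': "w' \<noteq> []" "g = mono w'" "\<And>x y. x @ v @ y \<in> Acomp r \<Longrightarrow>
      set (map (pad_gen x y) w') \<subseteq> web_gens r \<and>
      P (x @ v @ y) (x @ v' @ y) (ev (mono (map (pad_gen x y) w')))"
    using assms(2) unfolding realizes_def by blast
  have sums: "sum_list u = sum_list v" "sum_list v' = sum_list v"
    and pos: "\<forall>k\<in>set u. 0 < k" "\<forall>k\<in>set v. 0 < k" "\<forall>k\<in>set v'. 0 < k" "u \<noteq> []" "v \<noteq> []" "v' \<noteq> []"
    using realizes_Acomp [OF assms(1)] realizes_Acomp [OF assms(2)] by (auto simp: Acomp_def)
  have "set (map (pad_gen x y) (w' @ w)) \<subseteq> web_gens r \<and>
      P (x @ u @ y) (x @ v' @ y) (ev (mono (map (pad_gen x y) (w' @ w))))"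
    if a: "x @ u @ y \<in> Acomp r" for x y
  proof -
    have b: "x @ v @ y \<in> Acomp r" using a sums pos by (auto simp: Acomp_def)
    let ?w = "map (pad_gen x y) w" and ?w' = "map (pad_gen x y) w'"
    have "mono ?w \<in> nonconst r" "mono ?w' \<in> nonconst r"
      using w(1) w(3) [OF a] w'(1) w'(3) [OF b] by (simp_all add: nonconst_def)
    then have "ev (mono (map (pad_gen x y) (w' @ w))) = ev (mono ?w') \<circ> ev (mono ?w)"
      by (simp add: ev_mult(2) flip: mono_mult)
    then show ?thesis
      using w(3) [OF a] w'(3) [OF b] comp [OF conjunct2 [OF w(3) [OF a]] conjunct2 [OF w'(3) [OF b]]] by simp
  qed
  then show ?thesis
    by (intro realizesI [of "w' @ w"]) (use w(1,2) w'(1,2) sums pos in \<open>simp_all add: Acomp_def mono_mult\<close>)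
qed

lemma realizes_Idn:
  assumes "\<And>a. P a a (proj (words_span (words r a)))" "u \<in> Acomp (sum_list u)"
  shows "realizes P u u (mono [Idn u])"
  unfolding realizes_def
proof (intro conjI exI [of _ "[Idn u]"] allI impI)
  fix x y assume a: "x @ u @ y \<in> Acomp r"
  then have "erase x = x" "erase y = y" by (auto simp: Acomp_def erase_def)
  then show "set (map (pad_gen x y) [Idn u]) \<subseteq> web_gens r"
      "P (x @ u @ y) (x @ u @ y) (ev (mono (map (pad_gen x y) [Idn u])))"
    using a assms by (auto simp: web_gens_def ev_Idn)
qed (use assms(2) in auto)

lemma realizes_Gen:
  assumes "sym_ok g"
    and "\<And>x y. x @ sym_src g @ y \<in> Acomp r \<Longrightarrow>
      P (x @ sym_src g @ y) (x @ sym_tgt g @ y) (ev (mono [Gen x g y]))"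
  shows "realizes P (sym_src g) (sym_tgt g) (mono [Gen [] g []])"
  unfolding realizes_def
proof (intro conjI exI [of _ "[Gen [] g []]"] allI impI)
  fix x y assume a: "x @ sym_src g @ y \<in> Acomp r"
  then have "erase x = x" "erase y = y" by (auto simp: Acomp_def erase_def)
  then show "set (map (pad_gen x y) [Gen [] g []]) \<subseteq> web_gens r"
      "P (x @ sym_src g @ y) (x @ sym_tgt g @ y) (ev (mono (map (pad_gen x y) [Gen [] g []])))"
    using a assms Gen_nonconst [OF assms(1) a] by (auto simp: nonconst_def)
qed (use assms(1) in \<open>cases g; auto simp: Acomp_def\<close>)+

text \<open>The complete split of a thick strand first splits off a thin strand on the left, which then runs alongside
  the complete split of the rest.\<close>

lemma realizes_csplit: "realizes (is_splitting r) [Suc n] (ones (Suc n)) (csplit (Suc n))"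
proof (induction n)
  case 0
  show ?case
    using realizes_Idn [of "is_splitting r" "[1]"] is_splitting_proj
    by (simp add: idw_def erase_def Acomp_def ones_def)
next
  case (Suc n)
  have "realizes (is_splitting r) [Suc (Suc n)] [1, Suc n] (spl 1 (Suc n))"
    using realizes_Gen [of "Split 1 (Suc n)" "is_splitting r"] ev_Split [of _ 1 "Suc n"] by (simp add: spl_def)
  moreover have "realizes (is_splitting r) [1, Suc n] (ones (Suc (Suc n))) (pad [1] [] (csplit (Suc n)))"
    using realizes_pad [OF Suc, of "[1]" "[]"] by (simp add: ones_def)
  ultimately show ?case
    using realizes_comp is_splitting_comp by simp
qed

lemma realizes_cmerge: "realizes (is_merging r) (ones (Suc n)) [Suc n] (cmerge (Suc n))"
proof (induction n)
  case 0
  show ?case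
    using realizes_Idn [of "is_merging r" "[1]"] is_merging_proj
    by (simp add: idw_def erase_def Acomp_def ones_def)
next
  case (Suc n)
  have "realizes (is_merging r) [1, Suc n] [Suc (Suc n)] (mrg 1 (Suc n))"
    using realizes_Gen [of "Merge 1 (Suc n)" "is_merging r"] ev_Merge [of _ 1 "Suc n"] by (simp add: mrg_def)
  moreover have "realizes (is_merging r) (ones (Suc (Suc n))) [1, Suc n] (pad [1] [] (cmerge (Suc n)))"
    using realizes_pad [OF Suc, of "[1]" "[]"] by (simp add: ones_def)
  ultimately show ?case
    using realizes_comp is_merging_comp by simp
qed

lemma ones_add: "ones (m + n) = ones m @ ones n"
  by (simp add: ones_def replicate_add)

lemma realizes_csplits:
  assumes "a \<noteq> []" "\<forall>k\<in>set a. 0 < k"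
  shows "realizes (is_splitting r) a (ones (sum_list a)) (csplits a)"
  using assms
proof (induction a rule: csplits.induct)
  case (2 k)
  then show ?case using realizes_csplit [of "k - 1"] by simp
next
  case (3 k k' a)
  let ?a = "k' # a"
  have "realizes (is_splitting r) ([k] @ ?a @ []) ([k] @ ones (sum_list ?a) @ []) (pad [k] [] (csplits ?a))"
    by (rule realizes_pad) (use 3 in auto)
  moreover have "realizes (is_splitting r) ([] @ [k] @ ones (sum_list ?a)) ([] @ ones k @ ones (sum_list ?a))
      (pad [] (ones (sum_list ?a)) (csplit k))"
    using realizes_csplit [of "k - 1"] 3 by (intro realizes_pad) (auto simp: ones_def)
  ultimately show ?case
    using realizes_comp [of "is_splitting r" "k # ?a" "[k] @ ones (sum_list ?a)"] is_splitting_comp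
    by (simp add: wtensor_def ones_add)
qed simp

lemma realizes_cmerges:
  assumes "a \<noteq> []" "\<forall>k\<in>set a. 0 < k"
  shows "realizes (is_merging r) (ones (sum_list a)) a (cmerges a)"
  using assms
proof (induction a rule: cmerges.induct)
  case (2 k)
  then show ?case using realizes_cmerge [of "k - 1"] by simp
next
  case (3 k k' a)
  let ?a = "k' # a"
  have "realizes (is_merging r) (ones k @ ones (sum_list ?a) @ []) (ones k @ ?a @ []) (pad (ones k) [] (cmerges ?a))"
    by (rule realizes_pad) (use 3 in \<open>auto simp: ones_def\<close>)
  moreover have "realizes (is_merging r) ([] @ ones k @ ?a) ([] @ [k] @ ?a) (pad [] ?a (cmerge k))"
    using realizes_cmerge [of "k - 1"] 3 by (intro realizes_pad) auto
  ultimately show ?case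
    using realizes_comp [of "is_merging r" "ones (sum_list (k # ?a))" "ones k @ ?a" _ "k # ?a"] is_merging_comp
    by (simp add: wtensor_def ones_add)
qed simp

lemma realizes_ev:
  assumes "realizes P a b f" "a \<in> Acomp r"
  shows "f \<in> nonconst r" "P a b (ev f)"
proof -
  obtain w where w: "w \<noteq> []" "f = mono w" "\<And>x y. x @ a @ y \<in> Acomp r \<Longrightarrow>
      set (map (pad_gen x y) w) \<subseteq> web_gens r \<and>
      P (x @ a @ y) (x @ b @ y) (ev (mono (map (pad_gen x y) w)))"
    using assms(1) unfolding realizes_def by blast
  have "pad_gen [] [] g = g" for g by (cases g) (simp_all add: erase_def)
  then have *: "map (pad_gen [] []) w = w" by (simp add: map_idI)
  show "f \<in> nonconst r" "P a b (ev f)"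
    using w(1,2) w(3) [of "[]" "[]"] assms(2) unfolding * by (simp_all add: nonconst_def)
qed

lemma csplits_ev:
  assumes "a \<in> Acomp r"
  shows "csplits a \<in> nonconst r" "is_splitting r a (ones r) (ev (csplits a))"
  using realizes_ev [OF realizes_csplits, of a] assms by (auto simp: Acomp_def)

lemma cmerges_ev:
  assumes "a \<in> Acomp r"
  shows "cmerges a \<in> nonconst r" "is_merging r (ones r) a (ev (cmerges a))"
  using realizes_ev [OF realizes_cmerges, of a] assms ones_Acomp [of r] r_pos
  by (auto simp: Acomp_def)

end

section \<open>Adjacent transpositions\<close>

text \<open>The first letter of \<open>v\<close> is moved to the front of \<open>u\<close> by exchanges with its left neighbours; the tails are
  treated in the same way.\<close>

lemma adjacent_swaps:
  assumes "\<And>xs x y ys. P (xs @ x # y # ys) \<Longrightarrow> P (xs @ y # x # ys)"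
    and "mset u = mset v" "P u"
  shows "P v"
  using assms
proof (induction v arbitrary: u P)
  case (Cons x v)
  then obtain u1 u2 where u: "u = u1 @ x # u2"
    by (metis list.set_intros(1) mset_eq_setD split_list)
  have "P (x # u1 @ u2)"
    using \<open>P u\<close> unfolding u
  proof (induction u1 arbitrary: u2 rule: rev_induct)
    case (snoc y u1)
    from Cons.prems(1) [of u1 y x u2] snoc.prems have "P (u1 @ x # y # u2)" by simp
    from snoc.IH [OF this] show ?case by simp
  qed simp
  moreover have "mset (u1 @ u2) = mset v" using Cons.prems(2) u by simp
  ultimately show ?case
    using Cons.IH [of "\<lambda>v. P (x # v)" "u1 @ u2"] Cons.prems(1) [of "x # _"] by simp
qed simp

definition simple_product :: "nat list \<Rightarrow> nat \<Rightarrow> nat"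
  where "simple_product is = foldr (\<lambda>i \<pi>. transpose i (i + 1) \<circ> \<pi>) is id"

lemma simple_product_simps [simp]:
  "simple_product [] = id"
  "simple_product (i # is) = transpose i (i + 1) \<circ> simple_product is"
  by (simp_all add: simple_product_def)

lemma simple_product_permutes: "set is \<subseteq> {1..<r} \<Longrightarrow> simple_product is permutes {1..r}"
proof (induction "is")
  case (Cons i "is")
  have "transpose i (i + 1) permutes {1..r}"
    using Cons.prems by (intro permutes_swap_id) auto
  moreover have "simple_product is permutes {1..r}" using Cons by simp
  ultimately have "transpose i (i + 1) \<circ> simple_product is permutes {1..r}"
    by (rule permutes_compose [rotated])
  then show ?case by (simp add: comp_def)
qed (simp add: permutes_id)

lemma simple_product_snoc: "simple_product (is @ [i]) = simple_product is \<circ> transpose i (i + 1)"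
  by (induction "is") (simp_all add: comp_assoc)

text \<open>In one-line notation, exchanging two neighbouring entries is multiplication by a simple transposition on
  the right. So the claim is an instance of sorting by exchanges of neighbours.\<close>

lemma permutes_simple_product:
  assumes "\<sigma> permutes {1..r}"
  shows "\<exists>is. set is \<subseteq> {1..<r} \<and> simple_product is = \<sigma>"
proof -
  let ?P = "\<lambda>u. \<exists>is. set is \<subseteq> {1..<r} \<and> u = map (simple_product is) [1..<Suc r]"
  have "?P (map \<sigma> [1..<Suc r])"
  proof (rule adjacent_swaps [of ?P "[1..<Suc r]"])
    show "mset [1..<Suc r] = mset (map \<sigma> [1..<Suc r])"
    proof (rule set_eq_iff_mset_eq_distinct [THEN iffD1])
      show "distinct (map \<sigma> [1..<Suc r])"
        using permutes_inj_on [OF assms] by (simp add: distinct_map del: upt_Suc)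
      show "set [1..<Suc r] = set (map \<sigma> [1..<Suc r])"
        using permutes_image [OF assms] by (simp add: atLeastLessThanSuc_atLeastAtMost del: upt_Suc)
    qed simp
    show "?P [1..<Suc r]" by (rule exI [of _ "[]"]) (simp del: upt_Suc)
    fix xs x y ys assume "?P (xs @ x # y # ys)"
    then obtain "is" where is_props: "set is \<subseteq> {1..<r}" "xs @ x # y # ys = map (simple_product is) [1..<Suc r]"
      by blast
    let ?i = "Suc (length xs)"
    from arg_cong [OF is_props(2), of length] have r: "length xs + 2 + length ys = r" by simp
    have nth: "(xs @ x # y # ys) ! t = simple_product is (Suc t)" if "t < r" for t
      using that by (subst is_props(2)) (simp del: upt_Suc)
    have "xs @ y # x # ys = map (simple_product (is @ [?i])) [1..<Suc r]"
    proof (rule nth_equalityI)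
      fix t assume "t < length (xs @ y # x # ys)"
      then have t: "t < r" using r by simp
      have "(xs @ y # x # ys) ! t = (xs @ x # y # ys) ! transpose (length xs) ?i t"
        by (auto simp: nth_append transpose_def nth_Cons')
      also have "transpose (length xs) ?i t < r" using t r by (auto simp: transpose_def)
      from nth [OF this] have "(xs @ x # y # ys) ! transpose (length xs) ?i t
          = simple_product is (Suc (transpose (length xs) ?i t))" .
      also have "Suc (transpose (length xs) ?i t) = transpose ?i (?i + 1) (Suc t)"
        by (auto simp: transpose_def)
      finally show "(xs @ y # x # ys) ! t = map (simple_product (is @ [?i])) [1..<Suc r] ! t"
        using t unfolding simple_product_snoc by (simp del: upt_Suc)
    qed (use r in simp)
    moreover have "set (is @ [?i]) \<subseteq> {1..<r}" using is_props(1) r by auto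
    ultimately show "?P (xs @ y # x # ys)" by blast
  qed
  then obtain "is" where is_props: "set is \<subseteq> {1..<r}" "map \<sigma> [1..<Suc r] = map (simple_product is) [1..<Suc r]"
    by blast
  have "simple_product is k = \<sigma> k" for k
  proof (cases "k \<in> {1..r}")
    case True
    then show ?thesis using is_props(2) by (auto simp del: upt_Suc)
  next
    case False
    then show ?thesis
      using assms simple_product_permutes [OF is_props(1)] by (metis permutes_not_in)
  qed
  then show ?thesis using is_props(1) by blast
qed

section \<open>The Sergeev superalgebra acting by webs\<close>

lemma words_ones_iff:
  "w \<in> words r (ones r) \<longleftrightarrow> length w = r \<and> distinct (map fst w) \<and> fst ` set w = {1..r}"
proof -
  have "mset (map fst w) = mset [1..<Suc r] \<longleftrightarrow> distinct (map fst w) \<and> fst ` set w = {1..r}"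
    using set_eq_iff_mset_eq_distinct [of "map fst w" "[1..<Suc r]"]
      mset_eq_imp_distinct_iff [of "map fst w" "[1..<Suc r]"] mset_eq_setD [of "map fst w" "[1..<Suc r]"]
    by (auto simp: atLeastLessThanSuc_atLeastAtMost simp del: upt_Suc)
  then show ?thesis by (simp add: words_iff_mset blocks_ones del: upt_Suc)
qed

lemma relabel_permutes_words:
  assumes "w \<in> words r (ones r)" "\<sigma> permutes {1..r}"
  shows "relabel \<sigma> w \<in> words r (ones r)"
proof -
  have "map fst (relabel \<sigma> w) = map \<sigma> (map fst w)" by (simp add: relabel_def)
  moreover have "fst ` set (relabel \<sigma> w) = \<sigma> ` fst ` set w" by (force simp: relabel_def)
  ultimately show ?thesis
    using assms permutes_inj_on [OF assms(2), of "{1..r}"] permutes_image [OF assms(2)]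
    unfolding words_ones_iff by (simp add: distinct_map del: map_map)
qed

lemma words_ones_label_inj:
  assumes "w \<in> words r (ones r)" "s < r" "t < r" "fst (w ! s) = fst (w ! t)"
  shows "s = t"
  using assms nth_eq_iff_index_eq [of "map fst w" s t] by (simp add: words_ones_iff)

lemma words_ones_label_ex:
  assumes "w \<in> words r (ones r)" "k \<in> {1..r}"
  obtains p where "p < r" "fst (w ! p) = k"
  using assms unfolding words_ones_iff by (metis (no_types, lifting) imageE in_set_conv_nth)

text \<open>All labels of \<open>w\<close> are different, so merging the labels \<open>i\<close> and \<open>Suc i\<close> only forgets which of two letters had
  which label.\<close>

lemma merge_fibre_ones:
  assumes w: "w \<in> words r (ones r)" and i: "1 \<le> i" "i < r"
  shows "{w' \<in> words r (ones r). relabel (merge_labels i) w' = relabel (merge_labels i) w}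
    = {w, relabel (transpose i (Suc i)) w}" (is "?A = _")
    and "relabel (transpose i (Suc i)) w \<noteq> w"
proof -
  have len: "length w = r" using w by (simp add: words_ones_iff)
  obtain p where p: "p < r" "fst (w ! p) = i"
    by (rule words_ones_label_ex [OF w, of i]) (use i in auto)
  obtain q where q: "q < r" "fst (w ! q) = Suc i"
    by (rule words_ones_label_ex [OF w, of "Suc i"]) (use i in auto)
  have other: "fst (w ! t) \<noteq> i" "fst (w ! t) \<noteq> Suc i" if "t < r" "t \<noteq> p" "t \<noteq> q" for t
    using words_ones_label_inj [OF w that(1)] p q that(2,3) by metis+
  have sub: "w' = w \<or> w' = relabel (transpose i (Suc i)) w" if "w' \<in> ?A" for w'
  proof -
    from that have w': "w' \<in> words r (ones r)" and len': "length w' = r"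
      and eq: "relabel (merge_labels i) w' = relabel (merge_labels i) w"
      by (auto simp: words_ones_iff)
    have letters: "merge_labels i (fst (w' ! t)) = merge_labels i (fst (w ! t)) \<and> snd (w' ! t) = snd (w ! t)"
      if "t < r" for t
      using arg_cong [OF eq, of "\<lambda>w. w ! t"] that len len' by simp
    have pq: "fst (w' ! p) = i \<or> fst (w' ! p) = Suc i" "fst (w' ! q) = i \<or> fst (w' ! q) = Suc i"
      using letters [OF p(1)] letters [OF q(1)] p q by (auto simp: merge_labels_def split: if_splits)
    have rest: "fst (w' ! t) = fst (w ! t)" if "t < r" "t \<noteq> p" "t \<noteq> q" for t
      using letters [OF that(1)] other [OF that] by (auto simp: merge_labels_def split: if_splits)
    have "fst (w' ! p) \<noteq> fst (w' ! q)"
      using words_ones_label_inj [OF w' p(1) q(1)] p q by auto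
    with pq consider "fst (w' ! p) = i" "fst (w' ! q) = Suc i" | "fst (w' ! p) = Suc i" "fst (w' ! q) = i"
      by auto
    then show ?thesis
    proof cases
      case 1
      have "w' ! t = w ! t" if "t < r" for t
        using 1 p q rest [OF that] letters [OF that] by (cases "t = p"; cases "t = q") (auto simp: prod_eq_iff)
      then show ?thesis using len len' by (simp add: list_eq_iff_nth_eq)
    next
      case 2
      have "w' ! t = relabel (transpose i (Suc i)) w ! t" if "t < r" for t
        using 2 p q rest [OF that] letters [OF that] other [OF that] len that
        by (cases "t = p"; cases "t = q") (auto simp: prod_eq_iff)
      then show ?thesis using len len' by (simp add: list_eq_iff_nth_eq)
    qed
  qed
  have "merge_labels i \<circ> transpose i (Suc i) = merge_labels i"
    by (auto simp: fun_eq_iff merge_labels_def transpose_def)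
  moreover have "transpose i (Suc i) permutes {1..r}"
    using i by (intro permutes_swap_id) auto
  ultimately have "relabel (transpose i (Suc i)) w \<in> ?A"
    using w relabel_permutes_words by (simp add: relabel_relabel)
  then show "?A = {w, relabel (transpose i (Suc i)) w}" using w sub by auto
  show "relabel (transpose i (Suc i)) w \<noteq> w"
  proof
    assume "relabel (transpose i (Suc i)) w = w"
    from arg_cong [OF this, of "\<lambda>w. fst (w ! p)"] show False using p len by simp
  qed
qed

text \<open>Bars are attached to labels rather than to positions, because a dot sits on a strand, and it is the strands
  that a permutation web moves.\<close>

definition barred :: "nat set \<Rightarrow> nat list \<Rightarrow> vidx list"
  where "barred B \<tau> = map (\<lambda>k. (k, k \<in> B)) \<tau>"

text \<open>The scalar by which the dots on the strands \<open>js\<close> change a word with labels \<open>\<tau>\<close> and without bars. The last dot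
  of the list acts first; a dot on \<open>j\<close> then passes the letters to the left of \<open>j\<close> that are barred already,
  namely those with labels in the rest of the list.\<close>

fun dot_sign :: "nat list \<Rightarrow> nat list \<Rightarrow> complex" where
  "dot_sign [] \<tau> = 1"
| "dot_sign (j # js) \<tau> =
    ksign (odd (length (filter (\<lambda>k. k \<in> set js) (takeWhile (\<lambda>k. k \<noteq> j) \<tau>)))) * dot_sign js \<tau>"

lemma dot_sign_nonzero: "dot_sign js \<tau> \<noteq> 0"
  by (induction js) (auto simp: ksign_def)

text \<open>Only the relative order of the dotted labels enters into the sign.\<close>

lemma dot_sign_cong:
  assumes "filter (\<lambda>k. k \<in> set js) \<tau> = filter (\<lambda>k. k \<in> set js) \<tau>'" "distinct js"
  shows "dot_sign js \<tau> = dot_sign js \<tau>'"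
  using assms
proof (induction js)
  case (Cons j js)
  have *: "filter (\<lambda>k. k \<in> set js) (takeWhile (\<lambda>k. k \<noteq> j) u)
      = takeWhile (\<lambda>k. k \<noteq> j) (filter (\<lambda>k. k \<in> set (j # js)) u)" for u
    using Cons.prems(2) by (induction u) auto
  have "filter (\<lambda>k. k \<in> set js) u = filter (\<lambda>k. k \<in> set js) (filter (\<lambda>k. k \<in> set (j # js)) u)" for u
    by (auto intro: filter_cong)
  then have "filter (\<lambda>k. k \<in> set js) \<tau> = filter (\<lambda>k. k \<in> set js) \<tau>'"
    using Cons.prems(1) by metis
  then have "dot_sign js \<tau> = dot_sign js \<tau>'" using Cons by simp
  then show ?case by (simp only: dot_sign.simps * Cons.prems(1))
qed simp

lemma hbar_barred:
  assumes "distinct \<tau>" "j \<in> set \<tau>" "j \<notin> B"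
  shows "hbar_op j (mono (barred B \<tau>)) = fscale
    (ksign (odd (length (filter (\<lambda>k. k \<in> B) (takeWhile (\<lambda>k. k \<noteq> j) \<tau>))))) (mono (barred (insert j B) \<tau>))"
proof -
  let ?t = "length (takeWhile (\<lambda>k. k \<noteq> j) \<tau>)"
  obtain u v where "\<tau> = u @ j # v" "j \<notin> set u"
    using split_list_first [OF assms(2)] by blast
  then have t: "?t < length \<tau>" by (auto simp: takeWhile_append)
  then have nth: "\<tau> ! ?t = j" using nth_length_takeWhile [of "\<lambda>k. k \<noteq> j"] by blast
  have uniq: "\<tau> ! s = j \<longleftrightarrow> s = ?t" if "s < length \<tau>" for s
    using that t nth assms(1) nth_eq_iff_index_eq by metis
  have "take ?t (barred B \<tau>) = barred B (takeWhile (\<lambda>k. k \<noteq> j) \<tau>)"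
    by (simp add: barred_def take_map flip: takeWhile_eq_take)
  then have "list_parity snd (take ?t (barred B \<tau>)) = odd (length (filter (\<lambda>k. k \<in> B) (takeWhile (\<lambda>k. k \<noteq> j) \<tau>)))"
    by (simp add: list_parity_def barred_def filter_map comp_def)
  moreover have "(barred B \<tau>)[?t := (j, \<not> snd (barred B \<tau> ! ?t))] = barred (insert j B) \<tau>"
  proof (rule nth_equalityI)
    fix s assume s: "s < length ((barred B \<tau>)[?t := (j, \<not> snd (barred B \<tau> ! ?t))])"
    show "(barred B \<tau>)[?t := (j, \<not> snd (barred B \<tau> ! ?t))] ! s = barred (insert j B) \<tau> ! s"
      using s t uniq [of s] assms(3) by (cases "s = ?t") (simp_all add: barred_def nth)
  qed (simp add: barred_def)
  moreover have "fst (barred B \<tau> ! s) = j \<longleftrightarrow> s = ?t" if "s < length (barred B \<tau>)" for s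
    using that uniq by (simp add: barred_def)
  ultimately show ?thesis
    using hbar_op_mono [of ?t "barred B \<tau>" j] t by (simp add: barred_def)
qed

lemma erase_ones: "erase (ones n) = ones n"
  by (simp add: erase_def ones_def)

lemma barred_words: "barred B \<tau> \<in> words r (ones r) \<longleftrightarrow> length \<tau> = r \<and> distinct \<tau> \<and> set \<tau> = {1..r}"
  by (simp add: words_ones_iff barred_def comp_def image_image)

lemma (in presentation) cl_carrier:
  "x \<in> carrier (free_superalg G par) \<Longrightarrow> cl x \<in> carrier (presented G par R)"
  by (auto simp: presented_def pres_class_def Let_def FactRing_def A_RCOSETS_def')

context web_isomorphism
begin

lemma ev_dot:
  assumes "j \<in> {1..r}"
  shows "pad (ones (j - 1)) (ones (r - j)) (dot 1) \<in> nonconst r"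
    and "ev (pad (ones (j - 1)) (ones (r - j)) (dot 1)) = hbar_op j \<circ> proj (words_span (words r (ones r)))"
proof -
  let ?x = "ones (j - 1)" and ?y = "ones (r - j)"
  have "ones r = ?x @ [1] @ ?y"
    using assms by (simp add: ones_def flip: replicate_Suc replicate_add)
  then have eq: "?x @ [1] @ ?y = ones r" by simp
  then have A: "?x @ [1] @ ?y \<in> Acomp r" using ones_Acomp r_pos by simp
  have pad: "pad ?x ?y (dot 1) = mono [Gen ?x (Dot 1) ?y]"
    by (simp add: dot_def pad_mono erase_ones)
  show "pad ?x ?y (dot 1) \<in> nonconst r"
    unfolding pad using Gen_nonconst [of "Dot 1"] A by simp
  have "ev (mono [Gen ?x (Dot 1) ?y]) = hbar_op (length ?x + 1) \<circ> proj_comp r (?x @ [1] @ ?y)"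
    using psi A unfolding is_psi_def by blast
  then show "ev (pad ?x ?y (dot 1)) = hbar_op j \<circ> proj (words_span (words r (ones r)))"
    using assms ones_Acomp r_pos unfolding pad eq by (simp add: Mperm_eq)
qed

text \<open>Merging and splitting again yields the sum over a fibre with two elements: the given word, which is
  cancelled by the identity in the crossing, and the word with the two labels exchanged.\<close>

lemma ev_crossing:
  assumes "i \<in> {1..<r}"
  shows "pad (ones (i - 1)) (ones (r - i - 1)) crossing \<in> nonconst r"
    and "w \<in> words r (ones r) \<Longrightarrow> ev (pad (ones (i - 1)) (ones (r - i - 1)) crossing) (mono w)
      = mono (relabel (transpose i (i + 1)) w)"
proof -
  let ?x = "ones (i - 1)" and ?y = "ones (r - i - 1)"
  have "ones r = ?x @ [1, 1] @ ?y"
  proof -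
    have "r = (i - 1) + (2 + (r - i - 1))" using assms by auto
    then have "ones r = ones (i - 1) @ ones 2 @ ones (r - i - 1)" by (metis ones_add)
    moreover have "ones 2 = [1, 1]" by (simp add: ones_def numeral_2_eq_2)
    ultimately show ?thesis by simp
  qed
  then have eq: "?x @ [1, 1] @ ?y = ones r" by simp
  then have A: "?x @ [1, 1] @ ?y \<in> Acomp r" using ones_Acomp r_pos by simp
  then have B: "?x @ [1 + 1] @ ?y \<in> Acomp r" using Acomp_merge_iff [of 1 1] by simp
  let ?s = "mono [Gen ?x (Split 1 1) ?y]" and ?m = "mono [Gen ?x (Merge 1 1) ?y]"
    and ?e = "mono [Idn (ones r)]"
  have nc: "?s \<in> nonconst r" "?m \<in> nonconst r" "?e \<in> nonconst r"
    using Gen_nonconst [of "Split 1 1" ?x ?y] Gen_nonconst [of "Merge 1 1" ?x ?y] A B Idn_nonconst ones_Acomp r_pos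
    by auto
  have pad: "pad ?x ?y crossing = ?s * ?m - ?e"
    unfolding crossing_def lin_diff [OF lin_pad]
    using eq by (simp add: spl_def mrg_def mono_mult pad_mono idw_def erase_append erase_ones erase_def [of "[Suc 0, Suc 0]"])
  have sm: "?s * ?m \<in> nonconst r" using nc nonconst_mult by blast
  have "- ?e \<in> nonconst r"
    using nc(3) by (simp add: nonconst_def words_span_lookup)
  then show pad_nc: "pad ?x ?y crossing \<in> nonconst r"
    using words_span_add [OF sm [unfolded nonconst_def], of "- ?e"] unfolding pad by (simp add: nonconst_def)
  have "ev (?s * ?m) = ev (pad ?x ?y crossing) + ev ?e"
    using ev_add [OF pad_nc nc(3)] unfolding pad by simp
  then have sum: "ev ?s (ev ?m v) = ev (pad ?x ?y crossing) v + ev ?e v" for v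
    unfolding ev_mult(2) [OF nc(1,2)] by (auto dest: fun_cong [of _ _ v])
  assume w: "w \<in> words r (ones r)"
  have i: "i = Suc (length ?x)" "1 \<le> i" "i < r" using assms by auto
  have psi_MS: "ev ?m = merge_op r (?x @ [1, 1] @ ?y) (length ?x + 1) \<and>
      ev ?s = split_op r (?x @ [1, 1] @ ?y) (?x @ [1 + 1] @ ?y) (length ?x + 1)"
    using psi A unfolding is_psi_def by blast
  have "ev ?m = merge_op r (ones r) i"
    using conjunct1 [OF psi_MS] i(2) unfolding eq by simp
  then have m: "ev ?m (mono w) = mono (relabel (merge_labels i) w)"
    using merge_op_mono [of "ones r" r w i] w i(2,3) ones_Acomp by simp
  have "ev ?s = split_op r (ones r) (?x @ [1 + 1] @ ?y) i"
    using conjunct2 [OF psi_MS] i(2) unfolding eq by simp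
  moreover have cont: "cont (?x @ [1 + 1] @ ?y) = merge_cont i (cont (ones r))"
    using cont_merge [of ?x 1 1 ?y] i(1) unfolding eq by simp
  moreover have "relabel (merge_labels i) w \<in> words r (?x @ [1 + 1] @ ?y)"
    unfolding cont using w i by (intro merge_labels_content) auto
  ultimately have "ev ?s (mono (relabel (merge_labels i) w)) =
      (\<Sum>w'\<in>{w' \<in> words r (ones r). relabel (merge_labels i) w' = relabel (merge_labels i) w}. mono w')"
    using split_op_mono [of "ones r" r _ i] i ones_Acomp B by simp
  also have "\<dots> = mono w + mono (relabel (transpose i (Suc i)) w)"
    unfolding merge_fibre_ones(1) [OF w i(2,3)] using merge_fibre_ones(2) [OF w i(2,3)] by (auto simp: sum.insert_if)
  finally have "ev (pad ?x ?y crossing) (mono w) + ev ?e (mono w)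
      = mono w + mono (relabel (transpose i (Suc i)) w)"
    using sum [of "mono w"] m by simp
  moreover have "ev ?e (mono w) = mono w"
    using w ev_Idn ones_Acomp r_pos by (simp add: proj_mono)
  ultimately show "ev (pad ?x ?y crossing) (mono w) = mono (relabel (transpose i (i + 1)) w)"
    by (simp add: add.commute)
qed

end

locale sergeev_web_isomorphism = web_isomorphism +
  fixes \<xi> :: "sgen fa set \<Rightarrow> wgen fa set"
  assumes xi: "is_xi r \<xi>"
begin

sublocale sergeev: presentation "sgens r" sgen_odd "sergeev_rels r"
  by (rule presentation_sergeev)

fun gen_web :: "sgen \<Rightarrow> wgen fa" where
  "gen_web (S i) = pad (ones (i - 1)) (ones (r - i - 1)) crossing"
| "gen_web (C j) = pad (ones (j - 1)) (ones (r - j)) (dot 1)"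

definition word_web :: "sgen list \<Rightarrow> wgen fa"
  where "word_web ws = foldr (\<lambda>g x. gen_web g * x) ws (mono [Idn (ones r)])"

lemma gen_web_nonconst: "g \<in> sgens r \<Longrightarrow> gen_web g \<in> nonconst r"
  using ev_dot(1) ev_crossing(1) by (auto simp: sgens_def)

lemma word_web_nonconst: "set ws \<subseteq> sgens r \<Longrightarrow> word_web ws \<in> nonconst r"
  by (induction ws) (use Idn_nonconst ones_Acomp r_pos gen_web_nonconst nonconst_mult in \<open>auto simp: word_web_def\<close>)

lemma ev_word_web_Cons:
  assumes "set (g # ws) \<subseteq> sgens r"
  shows "ev (word_web (g # ws)) = ev (gen_web g) \<circ> ev (word_web ws)"
  using ev_mult(2) [of "gen_web g" "word_web ws"] assms gen_web_nonconst word_web_nonconst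
  by (simp add: word_web_def)

lemma xi_hom: "\<xi> \<in> ring_hom (sergeev r) (corner (web r) (web_class r (mono [Idn (ones r)])))"
  using xi by (simp add: is_xi_def superalg_iso_def ring_iso_def)

lemma xi_mult:
  assumes "x \<in> carrier (free_superalg (sgens r) sgen_odd)" "y \<in> carrier (free_superalg (sgens r) sgen_odd)"
  shows "\<xi> (sergeev_class r x \<otimes>\<^bsub>sergeev r\<^esub> sergeev_class r y)
      = \<xi> (sergeev_class r x) \<otimes>\<^bsub>web r\<^esub> \<xi> (sergeev_class r y)"
    and "sergeev_class r x \<otimes>\<^bsub>sergeev r\<^esub> sergeev_class r y = sergeev_class r (x * y)"
proof -
  have "sergeev_class r x \<in> carrier (sergeev r)" "sergeev_class r y \<in> carrier (sergeev r)"
    using sergeev.cl_carrier assms by (simp_all add: sergeev_def sergeev_class_def)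
  then show "\<xi> (sergeev_class r x \<otimes>\<^bsub>sergeev r\<^esub> sergeev_class r y)
      = \<xi> (sergeev_class r x) \<otimes>\<^bsub>web r\<^esub> \<xi> (sergeev_class r y)"
    using ring_hom_mult [OF xi_hom] by (simp add: corner_def)
  show "sergeev_class r x \<otimes>\<^bsub>sergeev r\<^esub> sergeev_class r y = sergeev_class r (x * y)"
    using sergeev.cl_mult assms by (simp add: sergeev_def sergeev_class_def)
qed

lemma xi_one: "\<xi> (sergeev_class r 1) = web_class r (mono [Idn (ones r)])"
proof -
  have "\<one>\<^bsub>sergeev r\<^esub> = sergeev_class r 1"
    by (simp add: sergeev_def presented_def Let_def FactRing_def sergeev_class_def pres_class_def free_superalg_def)
  then show ?thesis using ring_hom_one [OF xi_hom] by (simp add: corner_def)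
qed

lemma xi_generator: "g \<in> sgens r \<Longrightarrow> \<xi> (sergeev_class r (mono [g])) = web_class r (gen_web g)"
  using xi by (auto simp: is_xi_def sgens_def)

lemma xi_word: "set ws \<subseteq> sgens r \<Longrightarrow> \<xi> (sergeev_class r (mono ws)) = web_class r (word_web ws)"
proof (induction ws)
  case Nil
  show ?case by (simp add: mono_Nil xi_one word_web_def)
next
  case (Cons g ws)
  have "\<xi> (sergeev_class r (mono [g] * mono ws)) = web_class r (gen_web g) \<otimes>\<^bsub>web r\<^esub> web_class r (word_web ws)"
    using xi_mult [of "mono [g]" "mono ws"] Cons xi_generator by (simp add: carrier_free_superalg)
  then show ?case
    using Cons.prems ev_mult(1) [of "gen_web g" "word_web ws"] gen_web_nonconst word_web_nonconst
    by (simp add: mono_mult word_web_def)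
qed

lemma ev_permutation_web:
  assumes "set is \<subseteq> {1..<r}" "w \<in> words r (ones r)"
  shows "ev (word_web (map S is)) (mono w) = mono (relabel (simple_product is) w)"
  using assms(1)
proof (induction "is")
  case Nil
  show ?case using assms(2) ev_Idn ones_Acomp r_pos
    by (simp add: word_web_def proj_mono id_def relabel_id)
next
  case (Cons i "is")
  have "relabel (simple_product is) w \<in> words r (ones r)"
    using Cons.prems assms(2) by (intro relabel_permutes_words simple_product_permutes) auto
  moreover have "set (S i # map S is) \<subseteq> sgens r" using Cons.prems by (auto simp: sgens_def)
  ultimately show ?case
    using Cons ev_crossing(2) [of i "relabel (simple_product is) w"]
    by (simp add: ev_word_web_Cons relabel_relabel comp_def)
qed

lemma ev_dots_web:
  assumes "set js \<subseteq> {1..r}" "distinct js" "barred {} \<tau> \<in> words r (ones r)"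
  shows "ev (word_web (map C js)) (mono (barred {} \<tau>)) = fscale (dot_sign js \<tau>) (mono (barred (set js) \<tau>))"
  using assms(1,2)
proof (induction js)
  case Nil
  show ?case using assms(3) ev_Idn ones_Acomp r_pos by (simp add: word_web_def proj_mono)
next
  case (Cons j js)
  have \<tau>: "length \<tau> = r" "distinct \<tau>" "set \<tau> = {1..r}" using assms(3) by (auto simp: barred_words)
  then have words: "barred B \<tau> \<in> words r (ones r)" for B by (simp add: barred_words)
  have sub: "set (C j # map C js) \<subseteq> sgens r" using Cons.prems by (auto simp: sgens_def)
  have j: "j \<in> {1..r}" using Cons.prems by simp
  have "ev (gen_web (C j)) (mono (barred (set js) \<tau>)) = hbar_op j (mono (barred (set js) \<tau>))"
    using ev_dot(2) [OF j] words by (simp add: proj_mono)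
  also have "\<dots> = fscale (ksign (odd (length (filter (\<lambda>k. k \<in> set js) (takeWhile (\<lambda>k. k \<noteq> j) \<tau>)))))
      (mono (barred (set (j # js)) \<tau>))"
    using hbar_barred [of \<tau> j "set js"] \<tau> j Cons.prems by simp
  finally have step: "ev (gen_web (C j)) (mono (barred (set js) \<tau>))
      = fscale (ksign (odd (length (filter (\<lambda>k. k \<in> set js) (takeWhile (\<lambda>k. k \<noteq> j) \<tau>)))))
          (mono (barred (set (j # js)) \<tau>))" .
  have lin: "lin (ev (gen_web (C j)))" using sub by (intro lin_ev gen_web_nonconst) simp
  have IH: "ev (word_web (map C js)) (mono (barred {} \<tau>)) = fscale (dot_sign js \<tau>) (mono (barred (set js) \<tau>))"
    using Cons by simp
  show ?case
    using sub by (simp only: list.map ev_word_web_Cons comp_apply IH lin_scale [OF lin] step)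
      (simp add: mult.commute)
qed

end

section \<open>Supertabloids and their readings\<close>

lemma blocks_hat: "blocks (hat r b) = blocks b"
proof -
  have "blocks (b @ replicate n 0) = blocks b" for n
  proof (induction n)
    case (Suc n)
    have "b @ replicate (Suc n) 0 = (b @ replicate n 0) @ [0]"
      by (simp add: replicate_append_same)
    then show ?case using Suc by (simp only: blocks_snoc) simp
  qed simp
  then show ?thesis by (simp add: hat_def)
qed

lemma blocks_append: "\<exists>u. blocks (a @ b) = blocks a @ u"
proof (induction b rule: rev_induct)
  case (snoc k b)
  then show ?case using blocks_snoc [of "a @ b" k] by auto
qed simp

lemma blocks_nth:
  assumes "1 \<le> k" "k \<le> length b" "c < b ! (k - 1)"
  shows "blocks b ! (sum_list (take (k - 1) b) + c) = k"
    and "sum_list (take (k - 1) b) + c < length (blocks b)"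
proof -
  have "b = take (k - 1) b @ [b ! (k - 1)] @ drop k b"
    using id_take_nth_drop [of "k - 1" b] assms(1,2) by simp
  moreover obtain u where "blocks ((take (k - 1) b @ [b ! (k - 1)]) @ drop k b)
      = blocks (take (k - 1) b @ [b ! (k - 1)]) @ u"
    using blocks_append by blast
  moreover have "blocks (take (k - 1) b @ [b ! (k - 1)])
      = blocks (take (k - 1) b) @ replicate (b ! (k - 1)) (Suc (length (take (k - 1) b)))"
    by (rule blocks_snoc)
  moreover have "length (take (k - 1) b) = k - 1" using assms(2) by simp
  ultimately have eq: "blocks b = blocks (take (k - 1) b) @ replicate (b ! (k - 1)) k @ u"
    using assms(1) by simp
  show "blocks b ! (sum_list (take (k - 1) b) + c) = k"
    using assms(3) by (subst eq) (simp add: nth_append length_blocks)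
  show "sum_list (take (k - 1) b) + c < length (blocks b)"
    using assms(3) by (subst eq) (simp add: length_blocks)
qed

lemma count_mset_eq_card: "count (mset u) x = card {i. i < length u \<and> u ! i = x}"
proof -
  have "count (mset u) x = length (filter (\<lambda>y. y = x) u)"
    by (induction u) auto
  then show ?thesis by (simp add: length_filter_conv_card)
qed

text \<open>Equal letters of \<open>u\<close> are numbered from left to right, by consecutive numbers beginning where the block of this
  letter begins in the weakly increasing word of content \<open>b\<close>.\<close>

definition standardization :: "nat list \<Rightarrow> nat list \<Rightarrow> nat \<Rightarrow> nat"
  where "standardization b u p = sum_list (take (u ! (p - 1) - 1) b)
    + card {q \<in> {1..p}. u ! (q - 1) = u ! (p - 1)}"

lemma standardization:
  assumes "mset u = mset (blocks b)"
  shows "p \<in> {1..length u} \<Longrightarrow> block_of b (standardization b u p) = u ! (p - 1)"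
    and "p \<in> {1..length u} \<Longrightarrow> standardization b u p \<in> {1..length u}"
    and "inj_on (standardization b u) {1..length u}"
proof -
  have main: "block_of b (standardization b u p) = u ! (p - 1) \<and> standardization b u p \<in> {1..length u}"
    if p: "p \<in> {1..length u}" for p
  proof -
    let ?k = "u ! (p - 1)" and ?Q = "{q \<in> {1..p}. u ! (q - 1) = u ! (p - 1)}"
    have "?k \<in> set u" using p by (intro nth_mem) auto
    then have k: "1 \<le> ?k" "?k \<le> length b"
      using mset_eq_setD [OF assms] set_blocks [of b] by auto
    have "card ?Q \<le> card {i. i < length u \<and> u ! i = ?k}"
      by (rule card_inj_on_le [of "\<lambda>q. q - 1"]) (use p in \<open>auto simp: inj_on_def\<close>)
    also have "\<dots> = count (mset u) ?k"
      by (rule count_mset_eq_card [symmetric])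
    also have "\<dots> = b ! (?k - 1)" using k by (simp add: assms count_blocks cont_def)
    finally have le: "card ?Q \<le> b ! (?k - 1)" .
    have "card ?Q \<noteq> 0" using p by auto
    with le have c: "card ?Q - 1 < b ! (?k - 1)" by linarith
    have st: "standardization b u p = sum_list (take (?k - 1) b) + card ?Q"
      by (simp only: standardization_def)
    have pred: "standardization b u p - 1 = sum_list (take (?k - 1) b) + (card ?Q - 1)"
      using \<open>card ?Q \<noteq> 0\<close> st by linarith
    have ge: "1 \<le> standardization b u p"
      using \<open>card ?Q \<noteq> 0\<close> st by linarith
    have "standardization b u p - 1 < length u"
      unfolding pred mset_eq_length [OF assms] by (rule blocks_nth(2) [OF k c])
    with ge have "standardization b u p \<in> {1..length u}" by simp
    moreover have "block_of b (standardization b u p) = ?k"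
      unfolding pred by (rule blocks_nth(1) [OF k c])
    ultimately show ?thesis by blast
  qed
  then show "p \<in> {1..length u} \<Longrightarrow> block_of b (standardization b u p) = u ! (p - 1)"
    "p \<in> {1..length u} \<Longrightarrow> standardization b u p \<in> {1..length u}" by blast+
  show "inj_on (standardization b u) {1..length u}"
  proof (rule linorder_inj_onI')
    fix p q assume pq: "p \<in> {1..length u}" "q \<in> {1..length u}" "p < q"
    show "standardization b u p \<noteq> standardization b u q"
    proof
      assume eq: "standardization b u p = standardization b u q"
      then have same: "u ! (p - 1) = u ! (q - 1)" using main [OF pq(1)] main [OF pq(2)] by simp
      have "card {q' \<in> {1..p}. u ! (q' - 1) = u ! (q - 1)} < card {q' \<in> {1..q}. u ! (q' - 1) = u ! (q - 1)}"
      proof (rule psubset_card_mono)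
        have "q \<in> {q' \<in> {1..q}. u ! (q' - 1) = u ! (q - 1)}"
          "q \<notin> {q' \<in> {1..p}. u ! (q' - 1) = u ! (q - 1)}" using pq by auto
        then show "{q' \<in> {1..p}. u ! (q' - 1) = u ! (q - 1)} \<subset> {q' \<in> {1..q}. u ! (q' - 1) = u ! (q - 1)}"
          using pq(3) by fastforce
      qed simp
      then show False using eq same by (simp add: standardization_def)
    qed
  qed
qed

definition letter :: "entry \<Rightarrow> vidx"
  where "letter e = (num e, primed e)"

definition entry_of :: "vidx \<Rightarrow> entry"
  where "entry_of x = Entry (fst x) (snd x)"

lemma entry_of_letter [simp]: "entry_of (letter e) = e"
  by (simp add: entry_of_def letter_def)

lemma letter_entry_of [simp]: "letter (entry_of x) = x"
  by (simp add: entry_of_def letter_def)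

definition reading_word :: "entry multiset list \<Rightarrow> vidx list"
  where "reading_word T = map letter (reading T)"

lemma length_sorted_list_of_multiset: "length (sorted_list_of_multiset R) = size R"
  by (metis mset_sorted_list_of_multiset size_mset)

lemma length_reading_size: "length (reading T) = sum_list (map size T)"
  by (simp add: reading_def length_concat comp_def length_sorted_list_of_multiset)

text \<open>A tabloid is recovered from the multiset of all pairs of an entry and the number of its row. This multiset is
  not affected by permuting the reading word within rows.\<close>

lemma tabloid_count:
  "i < length T \<Longrightarrow> count (T ! i) e
    = count (mset (zip (reading T) (blocks (map size T)))) (e, Suc i)"
proof (induction T rule: rev_induct)
  case (snoc R T)
  have len: "length (reading T) = length (blocks (map size T))"
    by (simp add: length_blocks length_reading_size)
  have "zip u (replicate (length u) j) = map (\<lambda>x. (x, j)) u" for u :: "entry list" and j :: nat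
    by (induction u) auto
  from this [of "sorted_list_of_multiset R" "Suc (length T)"]
  have zip: "zip (reading (T @ [R])) (blocks (map size (T @ [R])))
      = zip (reading T) (blocks (map size T)) @ map (\<lambda>x. (x, Suc (length T))) (sorted_list_of_multiset R)"
    using len by (simp add: reading_def blocks_snoc length_sorted_list_of_multiset)
  have new: "count (mset (map (\<lambda>x. (x, Suc (length T))) u)) (e, Suc i)
      = (if i = length T then count (mset u) e else 0)" for u
    by (induction u) auto
  show ?case
  proof (cases "i = length T")
    case True
    have "(e, Suc i) \<notin> set (zip (reading T) (blocks (map size T)))"
      using True set_blocks [of "map size T"] by (auto dest!: set_zip_rightD)
    then have "count (mset (zip (reading T) (blocks (map size T)))) (e, Suc i) = 0"
      by (metis count_eq_zero_iff set_mset_mset)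
    then show ?thesis using new [of "sorted_list_of_multiset R"] True unfolding zip by simp
  next
    case False
    then show ?thesis
      using snoc new [of "sorted_list_of_multiset R"] unfolding zip by (simp add: nth_append)
  qed
qed simp

locale tabloid_context =
  fixes r :: nat and lam mu a b :: "nat list"
  assumes lam_eq: "a \<in> Acomp r" "lam = hat r a" and mu_eq: "b \<in> Acomp r" "mu = hat r b"
begin

abbreviation tabloids :: "entry multiset list set"
  where "tabloids \<equiv> supertabloids r lam mu"

abbreviation star :: "entry multiset list set"
  where "star \<equiv> supertabloids_star r lam mu"

lemma length_blocks_r: "length (blocks a) = r" "length (blocks b) = r"
  using lam_eq mu_eq by (simp_all add: length_blocks Acomp_def)

lemma comp_of: "comp_of lam = a" "comp_of mu = b"
  using lam_eq mu_eq by (auto simp: hat_def erase_def Acomp_def filter_id_conv)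

lemma supertabloid_sizes:
  assumes "T \<in> tabloids"
  shows "map size T = lam" "length T = r"
proof -
  show len: "length T = r" using assms by (simp add: supertabloids_def)
  show "map size T = lam"
    using assms len length_hat [OF lam_eq(1)] lam_eq(2) by (auto intro!: nth_equalityI simp: supertabloids_def)
qed

lemma mset_reading: "mset (reading T) = sum_list T"
  unfolding reading_def mset_concat by (simp add: comp_def)

lemma length_reading:
  assumes "T \<in> tabloids"
  shows "length (reading T) = r"
proof -
  have "length (reading T) = sum_list (map size T)"
    by (rule length_reading_size)
  then show ?thesis using supertabloid_sizes(1) [OF assms] length_blocks_r(1)
    by (metis lam_eq(2) blocks_hat length_blocks)
qed

lemma count_tabloid:
  assumes "T \<in> tabloids" "i < r"
  shows "count (T ! i) e = count (mset (zip (reading T) (blocks a))) (e, Suc i)"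
  using tabloid_count [of i T e] assms supertabloid_sizes [OF assms(1)] by (simp add: lam_eq(2) blocks_hat)

lemma supertabloid_eqI:
  assumes "T \<in> tabloids" "T' \<in> tabloids"
    and "mset (zip (reading T) (blocks a)) = mset (zip (reading T') (blocks a))"
  shows "T = T'"
proof (rule nth_equalityI)
  fix i assume "i < length T"
  then have i: "i < r" using supertabloid_sizes(2) [OF assms(1)] by simp
  show "T ! i = T' ! i"
    using count_tabloid [OF assms(1) i] count_tabloid [OF assms(2) i] assms(3) by (simp add: multiset_eq_iff)
qed (use assms supertabloid_sizes(2) in simp)

lemma count_reading_num:
  "count (mset (map num (reading T))) j = (\<Sum>R\<leftarrow>T. size (filter_mset (\<lambda>x. num x = j) R))"
proof -
  have "count (image_mset num R) j = size (filter_mset (\<lambda>x. num x = j) R)" for R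
    by (induction R) auto
  moreover have "mset (map num (reading T)) = (\<Sum>R\<leftarrow>T. image_mset num R)"
    unfolding mset_map mset_reading by (induction T) auto
  moreover have "count (sum_list Ms) j = (\<Sum>M\<leftarrow>Ms. count M j)" for Ms :: "nat multiset list"
    by (induction Ms) auto
  ultimately show ?thesis by (simp add: comp_def)
qed

lemma reading_entry_num:
  assumes "T \<in> tabloids" "e \<in> set (reading T)"
  shows "num e \<in> {1..r}"
  using assms by (auto simp: supertabloids_def reading_def)

lemma reading_nums:
  assumes "T \<in> tabloids"
  shows "mset (map num (reading T)) = mset (blocks b)"
proof (rule multiset_eqI)
  fix j
  show "count (mset (map num (reading T))) j = count (mset (blocks b)) j"
  proof (cases "j \<in> {1..r}")
    case True
    then have "count (mset (map num (reading T))) j = mu ! (j - 1)"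
      using assms unfolding count_reading_num by (simp add: supertabloids_def)
    also have "\<dots> = cont mu j" using True length_hat [OF mu_eq(1)] by (simp add: mu_eq(2) cont_def)
    finally show ?thesis by (simp add: mu_eq(2) blocks_hat flip: count_blocks)
  next
    case False
    have "j \<notin> set (map num (reading T))"
      using False reading_entry_num [OF assms] by auto
    then have "count (mset (map num (reading T))) j = 0" by (metis count_eq_zero_iff set_mset_mset)
    moreover have "j \<notin> set (blocks b)"
      using False set_blocks [of b] length_le_sum_list [of b] mu_eq(1) by (auto simp: Acomp_def)
    ultimately show ?thesis by (metis count_eq_zero_iff set_mset_mset)
  qed
qed

lemma reading_word_in_words:
  assumes "T \<in> tabloids"
  shows "reading_word T \<in> words r b"
  using reading_nums [OF assms] length_reading [OF assms]
  by (simp add: words_iff_mset reading_word_def letter_def comp_def)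

lemma inj_on_reading_word: "inj_on reading_word (tabloids)"
proof (rule inj_onI)
  fix T T' assume T: "T \<in> tabloids" "T' \<in> tabloids"
    "reading_word T = reading_word T'"
  have "reading T = map entry_of (reading_word T)" for T
    by (simp add: reading_word_def comp_def)
  then have "reading T = reading T'" using T(3) by metis
  then show "T = T'" using supertabloid_eqI [OF T(1,2)] by simp
qed

lemma finite_supertabloids: "finite (tabloids)"
proof -
  have "reading_word ` tabloids \<subseteq> words r b"
    using reading_word_in_words by blast
  then show ?thesis
    using finite_imageD [OF _ inj_on_reading_word] finite_subset finite_content_words by blast
qed

section \<open>The permutation of a supertabloid\<close>

lemma tab_perm_eq:
  assumes "T \<in> tabloids" "p \<in> {1..r}"
  shows "tab_perm r mu T p = standardization mu (map num (reading T)) p"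
proof -
  have "tab_entry T q = reading T ! (q - 1)" for q by (simp add: tab_entry_def)
  moreover have "map num (reading T) ! (q - 1) = num (reading T ! (q - 1))" if "q \<in> {1..p}" for q
    using that assms length_reading [OF assms(1)] by auto
  ultimately show ?thesis
    using assms(2) unfolding tab_perm_def standardization_def
    by (auto intro!: arg_cong [of _ _ card])
qed

lemma tab_perm:
  assumes T: "T \<in> tabloids"
  shows "tab_perm r mu T permutes {1..r}"
    and "p \<in> {1..r} \<Longrightarrow> block_of b (tab_perm r mu T p) = num (reading T ! (p - 1))"
proof -
  let ?u = "map num (reading T)"
  have m: "mset ?u = mset (blocks mu)" using reading_nums [OF T] by (simp add: mu_eq(2) blocks_hat)
  have len: "length ?u = r" using length_reading [OF T] by simp
  note st = standardization [OF m, unfolded len] and eq = tab_perm_eq [OF T]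
  have "inj_on (tab_perm r mu T) {1..r}"
    by (subst inj_on_cong [OF eq]) (assumption, rule st(3))
  moreover have "tab_perm r mu T ` {1..r} \<subseteq> {1..r}"
    by (rule image_subsetI) (simp only: eq st(2))
  ultimately have "bij_betw (tab_perm r mu T) {1..r} {1..r}"
    by (simp add: bij_betw_def endo_inj_surj)
  then show "tab_perm r mu T permutes {1..r}"
    by (rule bij_imp_permutes) (unfold tab_perm_def, rule if_not_P)
  assume p: "p \<in> {1..r}"
  have "block_of mu (standardization mu ?u p) = ?u ! (p - 1)" by (rule st(1) [OF p])
  then show "block_of b (tab_perm r mu T p) = num (reading T ! (p - 1))"
    unfolding eq [OF p] using nth_map [of "p - 1" "reading T" num] p len by (auto simp: mu_eq(2) blocks_hat)
qed

abbreviation dots :: "entry multiset list \<Rightarrow> nat list"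
  where "dots T \<equiv> filter (tab_dotted r mu T) [1..<r + 1]"

lemma dots_iff:
  assumes "T \<in> tabloids" "p \<in> {1..r}"
  shows "tab_perm r mu T p \<in> set (dots T) \<longleftrightarrow> primed (reading T ! (p - 1))"
proof -
  have perm: "tab_perm r mu T permutes {1..r}" by (rule tab_perm(1) [OF assms(1)])
  then have "tab_perm r mu T p \<in> {1..r}" using assms(2) by (metis permutes_in_image)
  moreover have "tab_perm r mu T q = tab_perm r mu T p \<longleftrightarrow> q = p" for q
    using permutes_inj [OF perm] by (auto dest: injD)
  moreover have "set (dots T) = {j \<in> {1..r}. tab_dotted r mu T j}" by auto
  ultimately show ?thesis
    using assms(2) by (auto simp: tab_dotted_def tab_entry_def simp del: set_filter)
qed

text \<open>In one-line notation these are the label words in the fibre over the weakly increasing word of the shape,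
  which is how they arise from the complete split.\<close>

definition row_perms :: "nat list set"
  where "row_perms = {\<tau>. length \<tau> = r \<and> distinct \<tau> \<and> set \<tau> = {1..r} \<and> map (block_of a) \<tau> = blocks a}"

lemma finite_row_perms: "finite row_perms"
  by (rule finite_subset [OF _ finite_lists_length_eq [of "{1..r}" r]]) (auto simp: row_perms_def)

lemma row_perms_id: "[1..<Suc r] \<in> row_perms"
  using length_blocks_r(1)
  by (auto simp: row_perms_def intro!: nth_equalityI simp del: upt_Suc)

text \<open>Permuting within rows preserves the multiset of pairs of an entry and its row, hence the tabloid.\<close>

lemma row_perm_reading_eq:
  assumes "T \<in> tabloids" "T' \<in> tabloids" "\<tau> \<in> row_perms"
    and "map (\<lambda>k. reading T ! (k - 1)) \<tau> = reading T'"
  shows "T = T'"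
proof (rule supertabloid_eqI [OF assms(1,2)])
  have zip: "zip (map f u) (map g u) = map (\<lambda>k. (f k, g k)) u"
    for f :: "nat \<Rightarrow> entry" and g :: "nat \<Rightarrow> nat" and u
    by (induction u) auto
  have "mset \<tau> = mset [1..<Suc r]"
    using assms(3) by (intro iffD1 [OF set_eq_iff_mset_eq_distinct]) (auto simp: row_perms_def atLeastLessThanSuc_atLeastAtMost simp del: upt_Suc)
  then have main: "mset (zip (map (\<lambda>k. reading T ! (k - 1)) \<tau>) (map (block_of a) \<tau>))
      = mset (zip (map (\<lambda>k. reading T ! (k - 1)) [1..<Suc r]) (map (block_of a) [1..<Suc r]))"
    unfolding zip mset_map by simp
  have reading: "map (\<lambda>k. reading T ! (k - 1)) [1..<Suc r] = reading T"
    using length_reading [OF assms(1)] by (auto intro!: nth_equalityI simp del: upt_Suc)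
  have rows: "map (block_of a) u = blocks a" if "u \<in> row_perms" for u
    using that by (simp add: row_perms_def)
  show "mset (zip (reading T) (blocks a)) = mset (zip (reading T') (blocks a))"
    using main unfolding assms(4) reading rows [OF assms(3)] rows [OF row_perms_id] by simp
qed

text \<open>Two places of one row with the same entry make this entry occur twice in the row.\<close>

lemma star_entry_multiplicity:
  assumes T: "T \<in> star" and "p < r" "q < r" "p \<noteq> q"
    and "reading T ! p = reading T ! q" "block_of a (Suc p) = block_of a (Suc q)"
  shows "\<not> primed (reading T ! p)"
proof
  assume primed: "primed (reading T ! p)"
  have T': "T \<in> tabloids" using T by (simp add: supertabloids_star_def)
  let ?e = "reading T ! p" and ?z = "zip (reading T) (blocks a)"
  have len: "length (reading T) = r" "length ?z = r"
    using length_reading [OF T'] length_blocks_r(1) by simp_all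
  define i where "i = blocks a ! p - 1"
  have "blocks a ! p \<in> {1..length a}"
    using set_blocks [of a] nth_mem [of p "blocks a"] assms(2) length_blocks_r(1) by blast
  then have i: "Suc i = blocks a ! p" "Suc i \<le> length a" by (auto simp: i_def)
  have "length a \<le> r" using lam_eq(1) length_le_sum_list [of a] by (auto simp: Acomp_def)
  with i have ir: "i < r" by simp
  have "{p, q} \<subseteq> {t. t < length ?z \<and> ?z ! t = (?e, Suc i)}"
    using assms len i length_blocks_r(1) by auto
  then have "card {p, q} \<le> card {t. t < length ?z \<and> ?z ! t = (?e, Suc i)}"
    by (intro card_mono) auto
  also have "\<dots> = count (mset ?z) (?e, Suc i)"
    by (rule count_mset_eq_card [symmetric])
  also have "\<dots> = count (T ! i) ?e" by (rule count_tabloid [OF T' ir, symmetric])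
  finally have ge: "2 \<le> count (T ! i) ?e" using assms(4) by simp
  have "num ?e \<in> set (blocks b)"
    using mset_eq_setD [OF reading_nums [OF T']] len(1) assms(2) by force
  then have "num ?e \<in> {1..length b}" using set_blocks by blast
  moreover have "\<forall>i\<in>{1..length a}. \<forall>j\<in>{1..length b}. count (T ! (i - 1)) (Entry j True) \<le> 1"
    using T by (simp add: supertabloids_star_def len_def comp_of)
  moreover have "Suc i \<in> {1..length a}" using i(2) by simp
  ultimately have "count (T ! (Suc i - 1)) (Entry (num ?e) True) \<le> 1" by blast
  moreover have "Entry (num ?e) True = ?e" using primed by (simp add: entry_eq_iff)
  ultimately show False using ge by simp
qed

lemma filter_pointwise_cong:
  "list_all2 (\<lambda>x y. x = y \<or> \<not> P x \<and> \<not> P y) u v \<Longrightarrow> filter P u = filter P v"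
  by (induction rule: list_all2_induct) auto

text \<open>Entries repeated in a row of \<open>T\<close> are unprimed, so a row permutation that fixes the reading word of \<open>T\<close> only moves places of
  unprimed entries. These carry no dot, and the word of dotted labels does not change.\<close>

lemma dot_sign_row_perm:
  assumes T: "T \<in> star" and \<tau>: "\<tau> \<in> row_perms"
    and eq: "map (\<lambda>k. reading T ! (k - 1)) \<tau> = reading T"
  shows "dot_sign (dots T) (map (tab_perm r mu T) \<tau>) = dot_sign (dots T) (map (tab_perm r mu T) [1..<Suc r])"
proof (rule dot_sign_cong)
  have T': "T \<in> tabloids" using T by (simp add: supertabloids_star_def)
  have len: "length \<tau> = r" "set \<tau> = {1..r}" using \<tau> by (simp_all add: row_perms_def)
  have "tab_perm r mu T (\<tau> ! p) = tab_perm r mu T (Suc p) \<or>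
      tab_perm r mu T (\<tau> ! p) \<notin> set (dots T) \<and> tab_perm r mu T (Suc p) \<notin> set (dots T)"
    if p: "p < r" for p
  proof (cases "\<tau> ! p = Suc p")
    case False
    have k: "\<tau> ! p \<in> {1..r}" using p len nth_mem by blast
    have "reading T ! (\<tau> ! p - 1) = reading T ! p"
      using arg_cong [OF eq, of "\<lambda>u. u ! p"] p len by simp
    moreover have "map (block_of a) \<tau> = blocks a" using \<tau> by (simp add: row_perms_def)
    from arg_cong [OF this, of "\<lambda>u. u ! p"] have "block_of a (\<tau> ! p) = block_of a (Suc p)"
      using p len by (simp only: nth_map diff_Suc_1)
    ultimately have "\<not> primed (reading T ! p)"
      using star_entry_multiplicity [OF T p, of "\<tau> ! p - 1"] k False by force
    then show ?thesis
      using dots_iff [OF T' k] dots_iff [OF T', of "Suc p"] p \<open>reading T ! (\<tau> ! p - 1) = reading T ! p\<close> by auto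
  qed simp
  then show "filter (\<lambda>k. k \<in> set (dots T)) (map (tab_perm r mu T) \<tau>)
      = filter (\<lambda>k. k \<in> set (dots T)) (map (tab_perm r mu T) [1..<Suc r])"
    by (intro filter_pointwise_cong) (auto simp: list_all2_conv_all_nth len simp del: upt_Suc)
qed simp

end

section \<open>Rearranging words within rows\<close>

text \<open>The rows are treated from left to right: \<open>pre\<close> consists of the rows that are rearranged already, and \<open>B\<close> is
  the word of row numbers, which tells for every place to which row it belongs.\<close>

lemma rearrange_rows:
  assumes "list_all2 (\<lambda>u v. mset u = mset v) ws ws'"
    and "list_all2 (\<lambda>u c. \<exists>k. c = replicate (length u) k) ws cs"
    and "\<And>xs x y ys. length (xs @ x # y # ys) = length B \<Longrightarrow> B ! length xs = B ! Suc (length xs) \<Longrightarrow>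
      P (xs @ x # y # ys) \<Longrightarrow> P (xs @ y # x # ys)"
    and "B = B' @ concat cs" "length pre = length B'" "P (pre @ concat ws)"
  shows "P (pre @ concat ws')"
  using assms
proof (induction ws ws' arbitrary: cs B' pre rule: list_all2_induct)
  case (Cons u ws v ws')
  obtain c cs' where cs: "cs = c # cs'" "\<exists>k. c = replicate (length u) k"
      "list_all2 (\<lambda>u c. \<exists>k. c = replicate (length u) k) ws cs'"
    using Cons.prems(1) unfolding list_all2_Cons1 by blast
  then obtain k where c: "c = replicate (length u) k" by blast
  have lens: "length (concat ws) = length (concat cs')"
    using cs(3) by (induction rule: list_all2_induct) auto
  have "length v = length u" using Cons.hyps by (metis mset_eq_length)
  let ?Q = "\<lambda>z. length z = length u \<and> P (pre @ z @ concat ws)"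
  have "?Q v"
  proof (rule adjacent_swaps [of ?Q u])
    fix xs x y ys assume Q: "?Q (xs @ x # y # ys)"
    have "B ! length (pre @ xs) = k" "B ! Suc (length (pre @ xs)) = k"
      using Cons.prems(3,4) cs(1) c Q by (auto simp: nth_append)
    moreover have "length ((pre @ xs) @ x # y # (ys @ concat ws)) = length B"
      using Cons.prems(3,4) cs(1) c Q lens by simp
    ultimately show "?Q (xs @ y # x # ys)"
      using Cons.prems(2) [of "pre @ xs" x y "ys @ concat ws"] Q by simp
  qed (use Cons.hyps Cons.prems(5) in auto)
  then have "P ((pre @ v) @ concat ws)" by simp
  moreover have "B = (B' @ c) @ concat cs'" using Cons.prems(3) cs(1) by simp
  moreover have "length (pre @ v) = length (B' @ c)"
    using Cons.prems(4) c \<open>length v = length u\<close> by simp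
  ultimately have "P ((pre @ v) @ concat ws')"
    using Cons.IH [OF cs(3) Cons.prems(2)] by blast
  then show ?case by simp
qed simp

lemma split_into_rows: "length w = sum_list a \<Longrightarrow> \<exists>ws. concat ws = w \<and> map length ws = a"
proof (induction a arbitrary: w)
  case (Cons k a)
  then obtain ws where "concat ws = drop k w" "map length ws = a"
    using Cons.IH [of "drop k w"] Cons.prems by fastforce
  then show ?case using Cons.prems by (intro exI [of _ "take k w # ws"]) simp
qed simp

section \<open>Homomorphisms out of a permutation supermodule\<close>

text \<open>Elements of different parity have no monomial in common, so their sum cannot cancel.\<close>

lemma homog_components:
  assumes "x \<in> homog par p" "y \<in> homog par (\<not> p)" "x + y \<in> words_span B"
  shows "x \<in> words_span B" "y \<in> words_span B"
proof -
  have "Poly_Mapping.lookup x (Word w) = 0 \<and> Poly_Mapping.lookup y (Word w) = 0" if "w \<notin> B" for w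
  proof -
    have "Poly_Mapping.lookup x (Word w) + Poly_Mapping.lookup y (Word w) = 0"
      using assms(3) that by (simp add: words_span_lookup lookup_add)
    moreover have "Poly_Mapping.lookup x (Word w) = 0 \<or> Poly_Mapping.lookup y (Word w) = 0"
      using assms(1,2) unfolding homog_eq_words_span words_span_lookup by auto
    ultimately show ?thesis by auto
  qed
  then show "x \<in> words_span B" "y \<in> words_span B" by (simp_all add: words_span_lookup)
qed

lemma homog_mono: "mono w \<in> homog par (list_parity par w)"
  by (simp add: homog_def)

lemma HomH_part_generator:
  assumes "f \<in> HomH_part r p (words_span (words r a)) (words_span (words r b))"
    and "g \<in> sgens r" "x \<in> words_span (words r a)"
  shows "f (sgen_act g x) = fscale (ksign (p \<and> sgen_odd g)) (sgen_act g (f x))"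
proof -
  have len: "y \<in> words_span {w. length w = r}" if "y \<in> words_span (words r c)" for y c
    using that by (auto simp: words_span_def content_words_def)
  have "f x \<in> words_span (words r b)" using assms(1,3) by (auto simp: HomH_part_iff)
  moreover have "f (sergeev_act (sergeev_class r (mono [g])) x)
      = fscale (ksign (p \<and> sgen_odd g)) (sergeev_act (sergeev_class r (mono [g])) (f x))"
    using assms(1,3) sergeev_generator_class [OF assms(2)] unfolding HomH_part_iff by blast
  ultimately show ?thesis using len assms(3) by (simp add: sergeev_act_generator)
qed

abbreviation even_word :: "nat list \<Rightarrow> vidx list"
  where "even_word u \<equiv> map (\<lambda>k. (k, False)) u"

lemma even_word_in_words: "even_word u \<in> words r a \<longleftrightarrow> length u = r \<and> mset u = mset (blocks a)"
  by (simp add: words_iff_mset comp_def)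

text \<open>The generators \<open>S i\<close> and \<open>C j\<close> send a word to a nonzero multiple of the word with two letters exchanged
  or one bar changed. Hence the words on which \<open>f\<close> vanishes are closed under both operations, and starting
  from the weakly increasing even word they reach every word of the same content.\<close>

lemma HomH_part_determined:
  assumes f: "f \<in> HomH_part r p (words_span (words r a)) (words_span (words r b))"
    and a: "a \<in> Acomp r" and zero: "f (mono (even_word (blocks a))) = 0"
  shows "f = 0"
proof -
  have lin: "lin f" using f by (simp add: HomH_part_iff)
  have move: "f (sgen_act g (mono w)) = 0" if "g \<in> sgens r" "w \<in> words r a" "f (mono w) = 0" for g w
    using HomH_part_generator [OF f that(1), of "mono w"] that
    by (simp add: lin_zero [OF lin_sgen_act])
  have even: "f (mono (even_word u)) = 0" if "even_word u \<in> words r a" for u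
  proof -
    let ?P = "\<lambda>u. even_word u \<in> words r a \<and> f (mono (even_word u)) = 0"
    have "?P u"
    proof (rule adjacent_swaps [of ?P "blocks a"])
      show "mset (blocks a) = mset u" using that by (simp add: even_word_in_words)
      show "?P (blocks a)"
        using zero a by (simp add: even_word_in_words length_blocks Acomp_def)
      fix xs x y ys assume P: "?P (xs @ x # y # ys)"
      then have words: "even_word (xs @ x # y # ys) \<in> words r a" by blast
      then have len: "length xs + 2 + length ys = r" by (simp add: content_words_def)
      have "even_word (xs @ y # x # ys) \<in> words r a"
        using words unfolding even_word_in_words by (simp add: add_mset_commute)
      moreover have "sgen_act (S (Suc (length xs))) (mono (even_word (xs @ x # y # ys)))
          = mono (even_word (xs @ y # x # ys))"
        by (simp add: nth_append list_update_append ksign_def)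
      moreover have "S (Suc (length xs)) \<in> sgens r" using len by (simp add: sgens_def)
      ultimately show "?P (xs @ y # x # ys)" using move [OF _ words] P by metis
    qed
    then show ?thesis by blast
  qed
  have "f (mono w) = 0" if "w \<in> words r a" for w
    using that
  proof (induction "length (filter snd w)" arbitrary: w)
    case 0
    then have "\<forall>x\<in>set w. \<not> snd x" by (auto simp: filter_empty_conv)
    then have "w = even_word (map fst w)" by (auto intro!: nth_equalityI simp: prod_eq_iff)
    then show ?case using even [of "map fst w"] 0 by metis
  next
    case (Suc n)
    then have "filter snd w \<noteq> []" by auto
    then obtain t where t: "t < length w" "snd (w ! t)"
      by (auto simp: filter_empty_conv in_set_conv_nth)
    let ?w = "w[t := (fst (w ! t), False)]"
    have fst: "map fst ?w = map fst w"
      using t by (metis fst_conv list_update_id map_update nth_map)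
    have w: "?w \<in> words r a"
      using Suc.prems unfolding words_iff_mset fst by simp
    have "w = take t w @ w ! t # drop (Suc t) w" "?w = take t w @ (fst (w ! t), False) # drop (Suc t) w"
      using t by (simp_all add: id_take_nth_drop [symmetric] upd_conv_take_nth_drop)
    from this [THEN arg_cong, of "\<lambda>u. length (filter snd u)"]
    have "length (filter snd w) = Suc (length (filter snd ?w))"
      using t(2) by simp
    then have IH: "f (mono ?w) = 0" using Suc w by simp
    have "Suc t \<le> r" using t Suc.prems by (simp add: content_words_def)
    then have "f (sgen_act (C (Suc t)) (mono ?w)) = 0"
      using move [OF _ w IH, of "C (Suc t)"] by (auto simp: sgens_def simp del: sgen_act.simps)
    \<comment> \<open>The word \<open>w\<close> is recovered from \<open>?w\<close> by the generator \<open>C (Suc t)\<close>, up to a power of the imaginary unit.\<close>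
    moreover have "?w[t := (fst (w ! t), True)] = w"
      using t by (metis list_update_id list_update_overwrite prod.collapse)
    then have "sgen_act (C (Suc t)) (mono ?w) = fscale (ksign (list_parity snd (take t ?w)) * (ksign False * \<i>)) (mono w)"
      using sgen_act_C [of "Suc t" ?w] t by simp
    ultimately have "fscale (ksign (list_parity snd (take t ?w)) * (ksign False * \<i>)) (f (mono w)) = 0"
      by (simp add: lin_scale [OF lin])
    then show ?case by (simp add: fscale_eq_0_iff ksign_def split: if_splits)
  qed
  moreover have "f (mono w) = 0" if "w \<notin> words r a" for w
    using f that by (simp add: HomH_part_iff)
  ultimately have "f (mono w) = 0" for w by blast
  then have "f x = 0 x" for x
    using lin_eqI [OF lin lin_0, of x] by simp
  then show ?thesis by (rule ext)
qed

lemma HomH_determined: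
  assumes "f \<in> HomH r (words_span (words r a)) (words_span (words r b))"
    and a: "a \<in> Acomp r" and zero: "f (mono (even_word (blocks a))) = 0"
  shows "f = 0"
proof -
  obtain f0 f1 where f: "f = f0 + f1"
    "f0 \<in> HomH_part r False (words_span (words r a)) (words_span (words r b))"
    "f1 \<in> HomH_part r True (words_span (words r a)) (words_span (words r b))"
    using assms(1) by (auto simp: HomH_def)
  let ?v = "mono (even_word (blocks a))"
  have v: "?v \<in> words_span (words r a)"
    using a by (simp add: even_word_in_words length_blocks Acomp_def)
  have hv: "?v \<in> homog snd (list_parity snd (even_word (blocks a)))" by (rule homog_mono)
  have "f0 ?v \<in> homog snd (False \<noteq> list_parity snd (even_word (blocks a)))"
    "f1 ?v \<in> homog snd (True \<noteq> list_parity snd (even_word (blocks a)))"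
    using f(2,3) v hv unfolding HomH_part_iff by blast+
  moreover have "f0 ?v + f1 ?v \<in> words_span {}"
    using zero f(1) by (simp add: words_span_zero)
  ultimately have "f0 ?v \<in> words_span {}" "f1 ?v \<in> words_span {}"
    using homog_components [of "f0 ?v" snd _ "f1 ?v" "{}"] by auto
  then have "f0 ?v = 0" "f1 ?v = 0" by (auto simp: words_span_def)
  then show ?thesis
    using HomH_part_determined [OF f(2) a] HomH_part_determined [OF f(3) a] f(1) by simp
qed

lemma HomH_maps: "f \<in> HomH r A B \<Longrightarrow> (\<And>x y. x \<in> B \<Longrightarrow> y \<in> B \<Longrightarrow> x + y \<in> B) \<Longrightarrow> x \<in> A \<Longrightarrow> f x \<in> B"
  by (auto simp: HomH_def HomH_part_iff)

text \<open>An exchange of two equal even letters fixes the weakly increasing even word, and the generator \<open>S i\<close> is even,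
  so both parity components of \<open>f\<close> commute with it.\<close>

lemma HomH_row_invariant:
  assumes "f \<in> HomH r (words_span (words r a)) (words_span (words r b))"
    and a: "a \<in> Acomp r" and i: "1 \<le> i" "i < r" "blocks a ! (i - 1) = blocks a ! i"
  shows "sgen_act (S i) (f (mono (even_word (blocks a)))) = f (mono (even_word (blocks a)))"
proof -
  obtain f0 f1 where f: "f = f0 + f1"
    "f0 \<in> HomH_part r False (words_span (words r a)) (words_span (words r b))"
    "f1 \<in> HomH_part r True (words_span (words r a)) (words_span (words r b))"
    using assms(1) by (auto simp: HomH_def)
  let ?v = "mono (even_word (blocks a))"
  have len: "length (blocks a) = r" using a by (simp add: length_blocks Acomp_def)
  have v: "?v \<in> words_span (words r a)"
    using len by (simp add: even_word_in_words)
  have swap: "(even_word (blocks a))[i - 1 := even_word (blocks a) ! i, i := even_word (blocks a) ! (i - 1)]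
      = even_word (blocks a)"
    using i len by (auto intro!: nth_equalityI simp: nth_list_update)
  have fixed: "sgen_act (S i) ?v = ?v"
    unfolding sgen_act_S swap using i len by (simp add: ksign_def)
  have g: "S i \<in> sgens r" using i by (simp add: sgens_def)
  have "f0 ?v = sgen_act (S i) (f0 ?v)" "f1 ?v = sgen_act (S i) (f1 ?v)"
    using HomH_part_generator [OF f(2) g v] HomH_part_generator [OF f(3) g v] unfolding fixed
    by (simp_all add: ksign_def)
  then show ?thesis by (simp only: f(1) plus_fun_apply lin_add [OF lin_sgen_act])
qed

lemma lookup_sgen_act_S:
  assumes "x \<in> words_span {w. length w = r}" "1 \<le> i" "i < r" "length w = r"
  shows "Poly_Mapping.lookup (sgen_act (S i) x) (Word w)
    = ksign (snd (w ! (i - 1)) \<and> snd (w ! i)) * Poly_Mapping.lookup x (Word (w[i - 1 := w ! i, i := w ! (i - 1)]))"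
proof -
  let ?s = "\<lambda>w. w[i - 1 := w ! i, i := w ! (i - 1)]"
  let ?k = "\<lambda>w. ksign (snd (w ! (i - 1)) \<and> snd (w ! i))"
  have inv: "?s (?s u) = u" if "length u = r" for u :: "vidx list"
    using assms(2,3) that by (auto intro!: nth_equalityI simp: nth_list_update)
  have "Poly_Mapping.lookup (sgen_act (S i) x) (Word w)
      = (\<Sum>u\<in>Poly_Mapping.keys x. Poly_Mapping.lookup x u * (?k (letters u) * Poly_Mapping.lookup (mono (?s (letters u))) (Word w)))"
    by (simp add: lin_ext_def lookup_sum lookup_fscale mult.assoc)
  also have "\<dots> = (\<Sum>u\<in>Poly_Mapping.keys x. if u = Word (?s w) then ?k w * Poly_Mapping.lookup x u else 0)"
  proof (rule sum.cong)
    fix u assume "u \<in> Poly_Mapping.keys x"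
    then have len: "length (letters u) = r" using assms(1) by (auto simp: words_span_def)
    have "w = ?s (letters u) \<longleftrightarrow> letters u = ?s w"
      using inv [OF len] inv [OF assms(4)] by metis
    moreover have "letters u = ?s w \<longleftrightarrow> u = Word (?s w)" by (cases u) simp
    moreover have "?k (?s w) = ?k w"
      using assms(2-4) by (simp add: nth_list_update conj_commute)
    ultimately show "Poly_Mapping.lookup x u * (?k (letters u) * Poly_Mapping.lookup (mono (?s (letters u))) (Word w))
        = (if u = Word (?s w) then ?k w * Poly_Mapping.lookup x u else 0)"
      by (auto simp: lookup_mono)
  qed simp
  also have "\<dots> = ?k w * Poly_Mapping.lookup x (Word (?s w))"
    by (simp add: in_keys_iff)
  finally show ?thesis .
qed

context tabloid_context
begin

text \<open>By invariance, the coefficients of \<open>x\<close> at two words that differ by an exchange within a row agree up to sign. So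
  if \<open>x\<close> has a nonzero coefficient at \<open>w\<close>, it has one at every rearrangement of the rows of \<open>w\<close>. Let \<open>T\<close> be the
  tabloid with these rows. If no primed entry is repeated in a row of \<open>T\<close>, then sorting the rows leads to the
  reading word of \<open>T\<close>. Otherwise two equal odd letters can be made neighbours; their exchange fixes the word and
  changes the sign of its coefficient, which is a contradiction.\<close>

lemma row_invariant_vanishes:
  assumes x: "x \<in> words_span (words r b)"
    and inv: "\<And>i. 1 \<le> i \<Longrightarrow> i < r \<Longrightarrow> blocks a ! (i - 1) = blocks a ! i \<Longrightarrow> sgen_act (S i) x = x"
    and zero: "\<And>T. T \<in> star \<Longrightarrow> Poly_Mapping.lookup x (Word (reading_word T)) = 0"
  shows "x = 0"
proof -
  have x': "x \<in> words_span {w. length w = r}"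
    using x by (auto simp: words_span_def content_words_def)
  let ?P = "\<lambda>w. Poly_Mapping.lookup x (Word w) \<noteq> 0"
  have swap: "Poly_Mapping.lookup x (Word (xs @ x1 # x2 # ys))
      = ksign (snd x1 \<and> snd x2) * Poly_Mapping.lookup x (Word (xs @ x2 # x1 # ys))"
    if "length (xs @ x1 # x2 # ys) = r" "blocks a ! length xs = blocks a ! Suc (length xs)" for xs x1 x2 ys
    using lookup_sgen_act_S [OF x', of "Suc (length xs)" "xs @ x1 # x2 # ys"] inv [of "Suc (length xs)"] that
    by (simp add: nth_append list_update_append del: sgen_act.simps)
  have False if w: "?P w" for w
  proof -
    have words: "w \<in> words r b" using x w by (auto simp: words_span_lookup)
    then have len: "length w = r" by (simp add: content_words_def)
    have lam: "sum_list lam = r" "length lam = r"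
      using lam_eq length_hat [of a r] by (simp_all add: hat_def Acomp_def sum_list_replicate)
    obtain ws where ws: "concat ws = w" "map length ws = lam"
      using split_into_rows [of w lam] len lam by auto
    then have len_ws: "length ws = r" using lam by (metis length_map)
    define cs where "cs = map (\<lambda>i. replicate (lam ! i) (Suc i)) [0..<length lam]"
    have cs: "blocks a = concat cs"
      by (simp add: cs_def lam_eq(2) flip: blocks_hat [of r a]) (simp add: blocks_def)
    have rows: "list_all2 (\<lambda>u c. \<exists>k. c = replicate (length u) k) ws cs"
      using len_ws lam ws(2) by (auto simp: list_all2_conv_all_nth cs_def)
    have rearrange: "?P (concat ws')" if "list_all2 (\<lambda>u v. mset u = mset v) ws ws'" for ws'
    proof -
      have "?P ([] @ concat ws')"
      proof (rule rearrange_rows [OF that rows, of "blocks a" ?P "[]"])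
        show "?P (xs @ x2 # x1 # ys)" if "length (xs @ x1 # x2 # ys) = length (blocks a)"
          "blocks a ! length xs = blocks a ! Suc (length xs)" "?P (xs @ x1 # x2 # ys)" for xs x1 x2 ys
          using swap [of xs x1 x2 ys] that length_blocks_r(1) by auto
      qed (use w ws cs in simp_all)
      then show ?thesis by simp
    qed
    define T where "T = map (\<lambda>u. mset (map entry_of u)) ws"
    have "mset (concat ws) = mset w" using ws by simp
    have nums: "(\<Sum>R\<leftarrow>T. size (filter_mset (\<lambda>x. num x = j) R)) = cnt j w" for j
    proof -
      have "size (filter_mset (\<lambda>x. num x = j) (mset (map entry_of u))) = cnt j u" for u
        by (induction u) (auto simp: entry_of_def)
      then have "(\<Sum>R\<leftarrow>T. size (filter_mset (\<lambda>x. num x = j) R)) = (\<Sum>u\<leftarrow>ws. cnt j u)"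
        by (simp add: T_def comp_def del: mset_map)
      also have "\<dots> = cnt j w" unfolding ws(1) [symmetric]
        by (induction ws) auto
      finally show ?thesis .
    qed
    have T: "T \<in> tabloids"
      unfolding supertabloids_def
    proof (intro CollectI conjI ballI allI impI)
      show "length T = r" by (simp add: T_def len_ws)
      show "num e \<in> {1..r}" if "R \<in> set T" "e \<in># R" for R e
      proof -
        from that obtain u y where y: "u \<in> set ws" "y \<in> set u" "e = entry_of y"
          by (auto simp: T_def)
        then have "y \<in> set w" using ws(1) by auto
        then have "fst y \<in> set (blocks b)"
          using mset_eq_setD [OF mset_labels [OF words]] by auto
        then show ?thesis
          using y(3) set_blocks [of b] length_le_sum_list [of b] mu_eq(1)
          by (auto simp: entry_of_def Acomp_def)
      qed
      show "size (T ! i) = lam ! i" if "i < r" for i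
        using that len_ws ws(2) by (auto simp: T_def)
      show "(\<Sum>R\<leftarrow>T. size (filter_mset (\<lambda>x. num x = j) R)) = mu ! (j - 1)" if "j \<in> {1..r}" for j
      proof -
        have "cnt j w = cont b j" using words by (simp add: content_words_def)
        also have "\<dots> = mu ! (j - 1)"
          using that by (auto simp: mu_eq(2) cont_def hat_def nth_append)
        finally show ?thesis by (simp add: nums)
      qed
    qed
    show False
    proof (cases "T \<in> star")
      case True
      have "list_all2 (\<lambda>u v. mset u = mset v) ws (map (\<lambda>R. map letter (sorted_list_of_multiset R)) T)"
        by (simp add: T_def list_all2_conv_all_nth multiset.map_comp comp_def)
      from rearrange [OF this] have "?P (reading_word T)"
        by (simp add: reading_word_def reading_def map_concat comp_def)
      then show False using zero [OF True] by simp
    next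
      case False
      then obtain i j where ij: "i \<in> {1..len lam}" "\<not> count (T ! (i - 1)) (Entry j True) \<le> 1"
        using T by (auto simp: supertabloids_star_def)
      let ?y = "(j, True)"
      have "length a \<le> r" using lam_eq(1) length_le_sum_list [of a] by (auto simp: Acomp_def)
      then have i: "i - 1 < length ws" using ij(1) len_ws by (auto simp: len_def comp_of)
      have "count (mset (ws ! (i - 1))) ?y = count (T ! (i - 1)) (Entry j True)"
      proof -
        have "count (mset (map entry_of u)) (Entry j True) = count (mset u) ?y" for u
          by (induction u) (auto simp: entry_of_def)
        then show ?thesis using i by (simp add: T_def del: mset_map)
      qed
      then have "2 \<le> count (mset (ws ! (i - 1))) ?y" using ij(2) by linarith
      then have "{#?y, ?y#} \<subseteq># mset (ws ! (i - 1))"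
        by (simp add: count_le_replicate_mset_subset_eq numeral_2_eq_2)
      then obtain M where "mset (ws ! (i - 1)) = {#?y, ?y#} + M"
        by (metis subset_mset.le_iff_add)
      moreover obtain zs where "mset zs = M" using ex_mset by blast
      ultimately have row: "mset (ws ! (i - 1)) = mset (?y # ?y # zs)" by simp
      let ?ws = "ws[i - 1 := ?y # ?y # zs]"
      have "list_all2 (\<lambda>u v. mset u = mset v) ws ?ws"
        using row i by (auto simp: list_all2_conv_all_nth nth_list_update)
      from rearrange [OF this] have P: "?P (concat ?ws)" .
      let ?xs = "concat (take (i - 1) ws)" and ?ys = "zs @ concat (drop i ws)"
      have "concat ?ws = ?xs @ ?y # ?y # ?ys"
        using i ij(1) by (simp add: upd_conv_take_nth_drop)
      moreover have "length (concat ?ws) = r"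
      proof -
        have "map length ?ws = map length ws"
          using mset_eq_length [OF row] i by (metis list_update_id map_update nth_map)
        then show ?thesis by (simp add: length_concat ws(2) lam)
      qed
      moreover have "blocks a ! length ?xs = i" "blocks a ! Suc (length ?xs) = i"
      proof -
        have "length (ws ! (i - 1)) = lam ! (i - 1)" using ws(2) i by (metis nth_map)
        then have c: "c < 2 \<Longrightarrow> c < lam ! (i - 1)" for c
          using mset_eq_length [OF row] by auto
        have sum: "length ?xs = sum_list (take (i - 1) lam)"
          by (simp add: length_concat take_map flip: ws(2))
        have "1 \<le> i" "i \<le> length lam" using ij(1) i len_ws lam by auto
        from blocks_nth(1) [OF this c, of 0] blocks_nth(1) [OF this c, of 1]
        show "blocks a ! length ?xs = i" "blocks a ! Suc (length ?xs) = i"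
          unfolding sum by (simp_all add: lam_eq(2) blocks_hat)
      qed
      ultimately have "Poly_Mapping.lookup x (Word (?xs @ ?y # ?y # ?ys))
          = - Poly_Mapping.lookup x (Word (?xs @ ?y # ?y # ?ys))"
        using swap [of ?xs ?y ?y ?ys] by (simp add: ksign_def)
      then show False using P \<open>concat ?ws = ?xs @ ?y # ?y # ?ys\<close> by simp
    qed
  qed
  then show ?thesis
    by (intro poly_mapping_eqI) (metis lookup_zero word.collapse)
qed

end

section \<open>The webs attached to supertabloids\<close>

locale tabloid_web_context = sergeev_web_isomorphism r \<psi> \<xi> + tabloid_context r lam mu a b
  for r \<psi> \<xi> lam mu a b
begin

text \<open>The factorization of the permutation that defines \<open>w\<^sub>T\<close> is an arbitrary one, and only its product is used.\<close>

lemma theta_factors: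
  assumes T: "T \<in> tabloids"
  obtains f "is" where "f \<in> nonconst r" "theta r \<xi> lam mu T = web_class r f"
    "set is \<subseteq> {1..<r}" "simple_product is = tab_perm r mu T"
    "ev f = ev (cmerges b) \<circ> (ev (word_web (map C (dots T))) \<circ> ev (word_web (map S is))) \<circ> ev (csplits a)"
proof -
  define "is" where "is = (SOME is. set is \<subseteq> {1..<r} \<and> simple_product is = tab_perm r mu T)"
  have is_props: "set is \<subseteq> {1..<r} \<and> simple_product is = tab_perm r mu T"
    unfolding is_def by (rule someI_ex) (rule permutes_simple_product [OF tab_perm(1) [OF T]])
  have sets: "set (map C (dots T)) \<subseteq> sgens r" "set (map S is) \<subseteq> sgens r"
    using is_props by (auto simp: sgens_def)
  let ?w = "word_web (map C (dots T))" and ?w' = "word_web (map S is)"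
  have nc: "?w \<in> nonconst r" "?w' \<in> nonconst r" "?w * ?w' \<in> nonconst r"
    using sets word_web_nonconst nonconst_mult by blast+
  have perm: "sergeev_perm r (tab_perm r mu T) = sergeev_class r (mono (map S is))"
    unfolding sergeev_perm_def is_def simple_product_def ..
  have "w_tab r \<xi> mu T = web_class r ?w \<otimes>\<^bsub>web r\<^esub> web_class r ?w'"
    unfolding w_tab_def perm using sets
    by (subst xi_mult(1)) (simp_all only: carrier_free_superalg mono_in_words_span mem_Collect_eq xi_word)
  then have w_tab: "w_tab r \<xi> mu T = web_class r (?w * ?w')" using ev_mult(1) nc by simp
  note csplits = csplits_ev [OF lam_eq(1)] and cmerges = cmerges_ev [OF mu_eq(1)]
  have nc': "cmerges b * (?w * ?w') \<in> nonconst r" using nc cmerges nonconst_mult by blast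
  show ?thesis
  proof (rule that [of "cmerges b * (?w * ?w') * csplits a" "is"])
    show "cmerges b * (?w * ?w') * csplits a \<in> nonconst r"
      using nc' csplits nonconst_mult by blast
    show "theta r \<xi> lam mu T = web_class r (cmerges b * (?w * ?w') * csplits a)"
      unfolding theta_def w_tab comp_of using ev_mult(1) nc nc' csplits(1) cmerges(1) by simp
    show "ev (cmerges b * (?w * ?w') * csplits a)
        = ev (cmerges b) \<circ> (ev ?w \<circ> ev ?w') \<circ> ev (csplits a)"
      using ev_mult(2) nc nc' csplits(1) cmerges(1) by simp
  qed (use is_props in auto)
qed

abbreviation Hom_lam_mu :: "(vidx fa \<Rightarrow> vidx fa) set"
  where "Hom_lam_mu \<equiv> HomH r (words_span (words r a)) (words_span (words r b))"

abbreviation theta_op :: "entry multiset list \<Rightarrow> vidx fa \<Rightarrow> vidx fa"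
  where "theta_op T \<equiv> \<psi> (theta r \<xi> lam mu T)"

text \<open>A priori \<open>\<psi>\<close> yields an endomorphism of the direct sum of all permutation supermodules. It vanishes outside \<open>M\<^sup>\<lambda>\<close>
  because of the complete split and has its image in \<open>M\<^sup>\<mu>\<close> because of the complete merge; as the parity components
  cannot cancel, they inherit both properties.\<close>

lemma theta_HomH:
  assumes T: "T \<in> tabloids"
  shows "theta_op T \<in> Hom_lam_mu"
proof -
  obtain f "is" where f: "f \<in> nonconst r" "theta r \<xi> lam mu T = web_class r f"
    "ev f = ev (cmerges b) \<circ> (ev (word_web (map C (dots T))) \<circ> ev (word_web (map S is))) \<circ> ev (csplits a)"
    "set is \<subseteq> {1..<r}"
    using theta_factors [OF T] by metis
  have sets: "set (map C (dots T)) \<subseteq> sgens r" "set (map S is) \<subseteq> sgens r"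
    using f(4) by (auto simp: sgens_def)
  have merging: "is_merging r (ones r) b (ev (cmerges b))" and splitting: "is_splitting r a (ones r) (ev (csplits a))"
    using cmerges_ev(2) csplits_ev(2) lam_eq mu_eq by auto
  have source: "ev f (mono w) = 0" if "w \<notin> words r a" for w
  proof -
    have "ev (csplits a) (mono w) = 0" using splitting that by (simp add: is_splitting_def)
    then show ?thesis
      using lin_ev word_web_nonconst sets cmerges_ev(1) [OF mu_eq(1)] by (simp add: f(3) lin_zero)
  qed
  have target: "ev f x \<in> words_span (words r b)" for x
  proof -
    have "ev (cmerges b) (mono w) \<in> words_span (words r b)" for w
      using merging is_merging_ones [OF merging, of w]
      by (cases "w \<in> words r (ones r)") (auto simp: is_merging_def words_span_zero)
    then have "ev (cmerges b) y \<in> words_span (words r b)" for y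
      using merging lin_maps_words_span [of "ev (cmerges b)" UNIV _ y]
      by (simp add: is_merging_def words_span_def)
    then show ?thesis by (simp add: f(3))
  qed
  let ?U = "\<Union>c\<in>Acomp r. words r c"
  have "ev f \<in> HomH r (words_span ?U) (words_span ?U)"
    using HomH_carrier [of "web_class r f"] f(1) by (simp add: carrier_web Msum_eq [OF r_pos])
  then obtain f0 f1 where comps: "ev f = f0 + f1" "f0 \<in> HomH_part r False (words_span ?U) (words_span ?U)"
    "f1 \<in> HomH_part r True (words_span ?U) (words_span ?U)"
    by (auto simp: HomH_def)
  have components: "f0 (mono w) \<in> words_span B \<and> f1 (mono w) \<in> words_span B"
    if "ev f (mono w) \<in> words_span B" for w B
  proof (cases "w \<in> ?U")
    case True
    have "f0 (mono w) \<in> homog snd (False \<noteq> list_parity snd w)"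
      "f1 (mono w) \<in> homog snd (True \<noteq> list_parity snd w)"
      using comps(2,3) True homog_mono [of w snd] unfolding HomH_part_iff by (metis IntI mono_in_words_span)+
    then show ?thesis
      using homog_components [of "f0 (mono w)" snd _ "f1 (mono w)" B] that comps(1) by auto
  next
    case False
    then show ?thesis using comps(2,3) by (simp add: HomH_part_iff words_span_zero)
  qed
  have aU: "words_span (words r a) \<subseteq> words_span ?U"
    using lam_eq(1) by (auto simp: words_span_def)
  have restrict: "g \<in> HomH_part r p (words_span (words r a)) (words_span (words r b))"
    if g: "g \<in> HomH_part r p (words_span ?U) (words_span ?U)" and "g = f0 \<or> g = f1" for g p
    unfolding HomH_part_iff
  proof (intro conjI allI ballI impI)
    show lin: "lin g" using g by (simp add: HomH_part_iff)
    show "g (mono w) = 0" if "mono w \<notin> words_span (words r a)" for w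
    proof -
      have "ev f (mono w) \<in> words_span {}" using source that by (simp add: words_span_zero)
      from components [OF this] \<open>g = f0 \<or> g = f1\<close> show ?thesis by (auto simp: words_span_def)
    qed
    show "g x \<in> words_span (words r b)" if "x \<in> words_span (words r a)" for x
      using lin_maps_words_span [OF lin _ that] components [OF target] \<open>g = f0 \<or> g = f1\<close> by blast
    show "g x \<in> homog snd (p \<noteq> q)" if "x \<in> words_span (words r a) \<inter> homog snd q" for q x
      using g that aU unfolding HomH_part_iff by blast
    show "g (sergeev_act X x) = fscale (ksign (p \<and> q)) (sergeev_act X (g x))"
      if "X \<in> hom_part (sergeev r) q" "x \<in> words_span (words r a)" for q X x
      using g that aU unfolding HomH_part_iff by blast
  qed
  show ?thesis
    unfolding f(2) HomH_def using comps(1) restrict [OF comps(2)] restrict [OF comps(3)] by blast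
qed

text \<open>The complete split turns \<open>v\<close> into the sum of the words whose labels form a row permutation \<open>\<tau>\<close>. The web \<open>w\<^sub>T\<close>
  applies \<open>\<sigma>\<^sub>T\<close> to the labels and puts bars on the dotted ones, and the complete merge replaces a label by the
  number of its block. By construction of \<open>\<sigma>\<^sub>T\<close>, the strand \<open>k\<close> has become the \<open>k\<close>-th letter of the reading word.\<close>

lemma theta_even_word:
  assumes T: "T \<in> tabloids"
  shows "theta_op T (mono (even_word (blocks a)))
    = (\<Sum>\<tau>\<in>row_perms. fscale (dot_sign (dots T) (map (tab_perm r mu T) \<tau>))
        (mono (map (\<lambda>k. letter (reading T ! (k - 1))) \<tau>)))"
proof -
  obtain f "is" where f: "theta r \<xi> lam mu T = web_class r f"
    "ev f = ev (cmerges b) \<circ> (ev (word_web (map C (dots T))) \<circ> ev (word_web (map S is))) \<circ> ev (csplits a)"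
    "set is \<subseteq> {1..<r}" "simple_product is = tab_perm r mu T"
    using theta_factors [OF T] by metis
  let ?\<sigma> = "tab_perm r mu T" and ?M = "ev (cmerges b)"
  let ?W = "ev (word_web (map C (dots T)))" and ?W' = "ev (word_web (map S is))"
  have sets: "set (map C (dots T)) \<subseteq> sgens r" "set (map S is) \<subseteq> sgens r"
    using f(3) by (auto simp: sgens_def)
  have lin: "lin ?M" "lin ?W" "lin ?W'"
    using lin_ev word_web_nonconst sets cmerges_ev(1) [OF mu_eq(1)] by auto
  have even_barred: "even_word u = barred {} u" for u by (simp add: barred_def)
  have v: "even_word (blocks a) \<in> words r a"
    using length_blocks_r(1) by (simp add: even_word_in_words)
  have "{w \<in> words r (ones r). relabel (block_of a) w = even_word (blocks a)} = barred {} ` row_perms" (is "?L = ?R")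
  proof (intro equalityI subsetI)
    fix w assume w: "w \<in> ?L"
    then have eq: "relabel (block_of a) w = even_word (blocks a)" and len: "length w = r"
      and dist: "distinct (map fst w)" "fst ` set w = {1..r}"
      by (auto simp: words_ones_iff)
    have "\<not> snd (w ! t)" if "t < length w" for t
      using arg_cong [OF eq, of "\<lambda>u. snd (u ! t)"] that len length_blocks_r(1) by simp
    then have "w = barred {} (map fst w)"
      by (auto intro!: nth_equalityI simp: barred_def prod_eq_iff)
    moreover have "map (block_of a) (map fst w) = blocks a"
      using arg_cong [OF eq, of "map fst"] by (simp add: relabel_def comp_def)
    ultimately show "w \<in> ?R" using len dist by (auto simp: row_perms_def)
  next
    fix w assume "w \<in> ?R"
    then obtain \<tau> where \<tau>: "\<tau> \<in> row_perms" "w = barred {} \<tau>" by blast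
    moreover have "relabel (block_of a) w = even_word (map (block_of a) \<tau>)"
      unfolding \<tau>(2) by (simp add: relabel_def barred_def)
    ultimately show "w \<in> ?L" by (simp add: row_perms_def barred_words)
  qed
  then have split: "ev (csplits a) (mono (even_word (blocks a))) = (\<Sum>\<tau>\<in>row_perms. mono (barred {} \<tau>))"
    using is_splitting_ones [OF csplits_ev(2) [OF lam_eq(1)] v]
    by (simp add: sum.reindex inj_on_def barred_def)
  have summand: "?M (?W (?W' (mono (barred {} \<tau>)))) = fscale (dot_sign (dots T) (map ?\<sigma> \<tau>))
      (mono (map (\<lambda>k. letter (reading T ! (k - 1))) \<tau>))" if \<tau>: "\<tau> \<in> row_perms" for \<tau>
  proof -
    have perm: "?\<sigma> permutes {1..r}" by (rule tab_perm(1) [OF T])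
    have words: "barred {} \<tau> \<in> words r (ones r)" using \<tau> by (simp add: row_perms_def barred_words)
    have "?W' (mono (barred {} \<tau>)) = mono (relabel ?\<sigma> (barred {} \<tau>))"
      using ev_permutation_web [OF f(3) words] by (simp add: f(4))
    also have "relabel ?\<sigma> (barred {} \<tau>) = barred {} (map ?\<sigma> \<tau>)"
      by (simp add: relabel_def barred_def)
    finally have W': "?W' (mono (barred {} \<tau>)) = mono (barred {} (map ?\<sigma> \<tau>))" .
    have words': "barred B (map ?\<sigma> \<tau>) \<in> words r (ones r)" for B
    proof -
      have "distinct (map ?\<sigma> \<tau>)" "set (map ?\<sigma> \<tau>) = {1..r}"
        using \<tau> permutes_inj_on [OF perm] permutes_image [OF perm] by (auto simp: row_perms_def distinct_map)
      then show ?thesis using \<tau> by (simp add: barred_words row_perms_def)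
    qed
    have "?W (mono (barred {} (map ?\<sigma> \<tau>)))
        = fscale (dot_sign (dots T) (map ?\<sigma> \<tau>)) (mono (barred (set (dots T)) (map ?\<sigma> \<tau>)))"
      by (rule ev_dots_web [OF _ _ words']) auto
    moreover have "?M (mono (barred (set (dots T)) (map ?\<sigma> \<tau>)))
        = mono (relabel (block_of b) (barred (set (dots T)) (map ?\<sigma> \<tau>)))"
      by (rule is_merging_ones(1) [OF cmerges_ev(2) [OF mu_eq(1)] words'])
    moreover have "relabel (block_of b) (barred (set (dots T)) (map ?\<sigma> \<tau>))
        = map (\<lambda>k. letter (reading T ! (k - 1))) \<tau>"
    proof -
      have "(block_of b (?\<sigma> k), ?\<sigma> k \<in> set (dots T)) = letter (reading T ! (k - 1))" if "k \<in> set \<tau>" for k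
      proof -
        have "k \<in> {1..r}" using that \<tau> by (simp add: row_perms_def)
        then show ?thesis using tab_perm(2) [OF T] dots_iff [OF T] by (simp only: letter_def)
      qed
      then show ?thesis by (simp add: relabel_def barred_def)
    qed
    ultimately show ?thesis by (simp add: W' lin_scale [OF lin(1)])
  qed
  have "theta_op T (mono (even_word (blocks a))) = (\<Sum>\<tau>\<in>row_perms. ?M (?W (?W' (mono (barred {} \<tau>)))))"
    unfolding f(1,2) comp_apply split lin_sum [OF lin(3)] lin_sum [OF lin(2)] lin_sum [OF lin(1)] ..
  also have "\<dots> = (\<Sum>\<tau>\<in>row_perms. fscale (dot_sign (dots T) (map ?\<sigma> \<tau>))
      (mono (map (\<lambda>k. letter (reading T ! (k - 1))) \<tau>)))"
    using summand by (rule sum.cong [OF refl])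
  finally show ?thesis .
qed

text \<open>These coordinates separate the homomorphisms from \<open>M\<^sup>\<lambda>\<close> to \<open>M\<^sup>\<mu>\<close>, as reading words represent all orbits on which
  an invariant vector can be supported.\<close>

definition coeff :: "(vidx fa \<Rightarrow> vidx fa) \<Rightarrow> entry multiset list \<Rightarrow> complex"
  where "coeff f T = Poly_Mapping.lookup (f (mono (even_word (blocks a)))) (Word (reading_word T))"

lemma coeff_theta_eq:
  "T \<in> tabloids \<Longrightarrow> coeff (theta_op T) T' = (\<Sum>\<tau>\<in>{\<tau> \<in> row_perms.
      map (\<lambda>k. reading T ! (k - 1)) \<tau> = reading T'}. dot_sign (dots T) (map (tab_perm r mu T) \<tau>))"
proof -
  assume T: "T \<in> tabloids"
  have inj: "map letter u = map letter v \<longleftrightarrow> u = v" for u v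
    by (metis (no_types, lifting) entry_of_letter list.map_comp list.map_ident_strong comp_apply)
  have "(\<lambda>k. letter (reading T ! (k - 1))) = letter \<circ> (\<lambda>k. reading T ! (k - 1))" by auto
  then have "reading_word T' = map (\<lambda>k. letter (reading T ! (k - 1))) \<tau>
      \<longleftrightarrow> map (\<lambda>k. reading T ! (k - 1)) \<tau> = reading T'" for \<tau>
    unfolding reading_word_def using inj by (metis map_map)
  then show ?thesis
    unfolding coeff_def theta_even_word [OF T] lookup_sum lookup_fscale lookup_mono word.inject
    by (simp add: sum.inter_filter [OF finite_row_perms] if_distrib cong: if_cong)
qed

lemma coeff_theta:
  assumes T: "T \<in> tabloids" and T': "T' \<in> tabloids"
  shows "T \<noteq> T' \<Longrightarrow> coeff (theta_op T) T' = 0"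
    and "T \<in> star \<Longrightarrow> coeff (theta_op T) T \<noteq> 0"
proof -
  assume "T \<noteq> T'"
  then have "{\<tau> \<in> row_perms. map (\<lambda>k. reading T ! (k - 1)) \<tau> = reading T'} = {}"
    using row_perm_reading_eq [OF T T'] by blast
  then show "coeff (theta_op T) T' = 0" by (simp only: coeff_theta_eq [OF T] sum.empty)
next
  assume star: "T \<in> star"
  let ?F = "{\<tau> \<in> row_perms. map (\<lambda>k. reading T ! (k - 1)) \<tau> = reading T}"
  have "coeff (theta_op T) T = (\<Sum>\<tau>\<in>?F. dot_sign (dots T) (map (tab_perm r mu T) [1..<Suc r]))"
    unfolding coeff_theta_eq [OF T] by (rule sum.cong) (use dot_sign_row_perm [OF star] in auto)
  also have "\<dots> = of_nat (card ?F) * dot_sign (dots T) (map (tab_perm r mu T) [1..<Suc r])" by simp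
  also have "\<dots> \<noteq> 0"
  proof -
    have "map (\<lambda>k. reading T ! (k - 1)) [1..<Suc r] = reading T"
      using length_reading [OF T] by (auto intro!: nth_equalityI simp del: upt_Suc)
    then have "[1..<Suc r] \<in> ?F" using row_perms_id by blast
    moreover have "finite ?F" using finite_row_perms by simp
    ultimately have "card ?F \<noteq> 0" by (metis card_eq_0_iff empty_iff)
    then show ?thesis using dot_sign_nonzero by simp
  qed
  finally show "coeff (theta_op T) T \<noteq> 0" .
qed

lemma coeff_scale: "coeff (op_scale c f) T = c * coeff f T"
  by (simp add: coeff_def op_scale_def lookup_fscale)

lemma coeff_sum: "coeff (sum f A) T = (\<Sum>x\<in>A. coeff (f x) T)"
  by (induction A rule: infinite_finite_induct) (simp_all add: coeff_def lookup_add)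

lemma star_subset: "star \<subseteq> tabloids"
  by (auto simp: supertabloids_star_def)

lemma finite_star: "finite (star)"
  using star_subset finite_supertabloids finite_subset by blast

lemma coeff_combination:
  assumes "T \<in> star"
  shows "coeff (\<Sum>T'\<in>star. op_scale (c T') (theta_op T')) T = c T * coeff (theta_op T) T"
proof -
  have "coeff (\<Sum>T'\<in>star. op_scale (c T') (theta_op T')) T
      = (\<Sum>T'\<in>star. c T' * coeff (theta_op T') T)"
    by (simp add: coeff_sum coeff_scale)
  also have "\<dots> = (\<Sum>T'\<in>{T}. c T' * coeff (theta_op T') T)"
    using assms star_subset coeff_theta(1)
    by (intro sum.mono_neutral_right finite_star) auto
  finally show ?thesis by simp
qed

lemma theta_inj: "inj_on theta_op (star)"
proof (rule inj_onI, rule ccontr)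
  fix T T' assume *: "T \<in> star" "T' \<in> star"
    "theta_op T = theta_op T'" "T \<noteq> T'"
  then have T: "T \<in> tabloids" "T' \<in> tabloids" using star_subset by blast+
  have "coeff (theta_op T') T = 0" "coeff (theta_op T) T \<noteq> 0"
    using coeff_theta(1) [OF T(2,1)] coeff_theta(2) [OF T(1,1)] * by auto
  with *(3) show False by simp
qed

lemma theta_independent: "\<not> op_dependent (theta_op ` star)"
proof
  assume "op_dependent (theta_op ` star)"
  then obtain u where u: "\<exists>f\<in>theta_op ` star. u f \<noteq> 0"
    "(\<Sum>f\<in>theta_op ` star. op_scale (u f) f) = 0"
    unfolding ops.dependent_finite [OF finite_imageI [OF finite_star]] by (elim exE conjE)
  then obtain T where T: "T \<in> star" "u (theta_op T) \<noteq> 0" by blast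
  have "(\<Sum>T'\<in>star. op_scale (u (theta_op T')) (theta_op T')) = 0"
    using u(2) by (simp add: sum.reindex [OF theta_inj])
  then have "u (theta_op T) * coeff (theta_op T) T = 0"
    using coeff_combination [OF T(1), of "\<lambda>T. u (theta_op T)"] by (simp add: coeff_def)
  moreover have "coeff (theta_op T) T \<noteq> 0"
    using T(1) star_subset by (intro coeff_theta(2)) auto
  ultimately show False using T(2) by simp
qed

text \<open>The coefficient matrix is diagonal, which leaves only one candidate for the combination that equals \<open>f\<close>. The
  difference is a homomorphism whose value at \<open>v\<close> is invariant under exchanges within rows and has zero coefficients at the reading words of \<open>star\<close>.\<close>

lemma theta_spans:
  "op_span (theta_op ` star) = Hom_lam_mu"
proof
  show "op_span (theta_op ` star) \<subseteq> Hom_lam_mu"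
    using theta_HomH star_subset by (intro ops.span_minimal HomH_subspace) blast
next
  show "Hom_lam_mu \<subseteq> op_span (theta_op ` star)"
  proof
    fix f assume f: "f \<in> Hom_lam_mu"
    define g where "g = (\<Sum>T\<in>star. op_scale (coeff f T / coeff (theta_op T) T) (theta_op T))"
    have g_span: "g \<in> op_span (theta_op ` star)"
      unfolding g_def by (intro ops.span_sum ops.span_scale ops.span_base) auto
    have "op_span (theta_op ` star) \<subseteq> Hom_lam_mu"
      using theta_HomH star_subset by (intro ops.span_minimal HomH_subspace) blast
    then have d: "f - g \<in> Hom_lam_mu"
      using f g_span ops.subspace_diff [OF HomH_subspace] by blast
    \<comment> \<open>By construction of \<open>g\<close>, the coefficients at the reading words of the tabloids in \<open>star\<close> vanish.\<close>
    have "(f - g) (mono (even_word (blocks a))) = 0"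
    proof (rule row_invariant_vanishes)
      show "(f - g) (mono (even_word (blocks a))) \<in> words_span (words r b)"
        using length_blocks_r(1)
        by (intro HomH_maps [OF d]) (auto simp: words_span_add even_word_in_words)
      show "sgen_act (S i) ((f - g) (mono (even_word (blocks a)))) = (f - g) (mono (even_word (blocks a)))"
        if "1 \<le> i" "i < r" "blocks a ! (i - 1) = blocks a ! i" for i
        by (rule HomH_row_invariant [OF d lam_eq(1) that])
      fix T assume T: "T \<in> star"
      have "coeff g T = coeff f T"
        unfolding g_def using coeff_combination [OF T, of "\<lambda>T. coeff f T / coeff (theta_op T) T"]
          coeff_theta(2) [OF _ _ T] T star_subset by auto
      then show "Poly_Mapping.lookup ((f - g) (mono (even_word (blocks a)))) (Word (reading_word T)) = 0"
        by (simp add: coeff_def lookup_minus)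
    qed
    then have "f - g = 0" by (rule HomH_determined [OF d lam_eq(1)])
    then show "f \<in> op_span (theta_op ` star)" using g_span by simp
  qed
qed

end

theorem corollary5p5:
  fixes r :: nat and lam mu :: "nat list"
    and \<psi> :: "wgen fa set \<Rightarrow> vidx fa \<Rightarrow> vidx fa"
    and \<xi> :: "sgen fa set \<Rightarrow> wgen fa set"
  assumes "r \<ge> 1" and "lam \<in> Lam' r" and "mu \<in> Lam' r"
    and "is_psi r \<psi>" and "is_xi r \<xi>"
  shows "inj_on (\<lambda>T. \<psi> (theta r \<xi> lam mu T)) (supertabloids_star r lam mu) \<and>
    \<not> op_dependent {\<psi> (theta r \<xi> lam mu T) | T. T \<in> supertabloids_star r lam mu} \<and>
    op_span {\<psi> (theta r \<xi> lam mu T) | T. T \<in> supertabloids_star r lam mu}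
      = HomH r (Mperm r lam) (Mperm r mu)"
proof -
  note lam = Lam'_eq_hat [OF assms(2,1)] and mu = Lam'_eq_hat [OF assms(3,1)]
  interpret tabloid_web_context r \<psi> \<xi> lam mu "erase lam" "erase mu"
    by unfold_locales (use assms lam mu in simp_all)
  have "{\<psi> (theta r \<xi> lam mu T) | T. T \<in> supertabloids_star r lam mu} = theta_op ` star"
    by blast
  moreover have "Mperm r lam = words_span (words r (erase lam))" "Mperm r mu = words_span (words r (erase mu))"
    using Mperm_eq [OF lam(1)] Mperm_eq [OF mu(1)] lam(2) mu(2) by simp_all
  ultimately show ?thesis using theta_inj theta_independent theta_spans by simp
qed

end
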